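(* Let $k$ be a field, $n\ge2$, $m_1,\ldots,m_n\ge2$ integers, and $q=\{q_{ij}\}_{1\le i<j\le n}$ elements of $k^\times$ that freely generate a free abelian subgroup of $k^\times$. Let \[\Lambda_q(m_1,\ldots,m_n)=k\langle x_1,\ldots,x_n\rangle/\big(x_i^{m_i}\ (1\le i\le n),\ x_jx_i-q_{ij}x_ix_j\ (i<j)\big).\] Then as an algebra \[ \mathrm{HH}^*(\Lambda_q(m_1,\ldots,m_n))\cong k[U]/(U^2)\times_k{\textstyle\bigwedge^*_k}(V_1,\ldots,V_n), \] with $U$ in cohomological degree $0$ and each $V_i$ in degree $1$, and the Gerstenhaber bracket is given by $[V_i,U]=(m_i-1)U$ and $[V_i,V_j]=0$ for all $i,j$.
   Context: $\mathrm{HH}^*$ denotes Hochschild cohomology $\mathrm{HH}^*(\Lambda,\Lambda)$ with its cup product and Gerstenhaber bracket. The fiber product $k[U]/(U^2)\times_k\bigwedge^*_k(V_1,\ldots,V_n)$ is the fiber product over $k$ with respect to the augmentations sending $U$ and all $V_i$ to $0$; thus $U\cdot V_i=0$ for all $i$, $U^2=0$, and the $V_i$ generate an exterior algebra. *)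

theory Defs
  imports Main
begin

text \<open>
  Concrete model of the quantum complete intersection
  Lambda_q(m_1,...,m_n) = k<x_1..x_n>/(x_i^(m_i), x_j x_i - q_ij x_i x_j (i<j)),
  indices 0-based (i < n).  Elements are coefficient functions on the standard
  PBW basis of ordered monomials x^a = x_0^(a 0) ... x_(n-1)^(a (n-1)),
  with 0 <= a i < m i.  An element x of Lambda is a function
  (nat => nat) => 'k supported on the monomial set Mon n m.
\<close>

type_synonym mon = "nat \<Rightarrow> nat"
type_synonym 'k elt = "mon \<Rightarrow> 'k"
type_synonym 'k cochain = "mon list \<Rightarrow> mon \<Rightarrow> 'k"

definition Mon :: "nat \<Rightarrow> (nat \<Rightarrow> nat) \<Rightarrow> mon set" where
  "Mon n m = {a. \<forall>i. (i < n \<longrightarrow> a i < m i) \<and> (n \<le> i \<longrightarrow> a i = 0)}"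

text \<open>x^a * x^b = (prod_{i<j} q_ij^(a_j b_i)) x^(a+b), since x_j x_i = q_ij x_i x_j.\<close>
definition qcoef :: "nat \<Rightarrow> (nat \<Rightarrow> nat \<Rightarrow> 'k::field) \<Rightarrow> mon \<Rightarrow> mon \<Rightarrow> 'k" where
  "qcoef n q a b = (\<Prod>j<n. \<Prod>i<j. q i j ^ (a j * b i))"

definition lmult :: "nat \<Rightarrow> (nat \<Rightarrow> nat) \<Rightarrow> (nat \<Rightarrow> nat \<Rightarrow> 'k::field) \<Rightarrow> 'k elt \<Rightarrow> 'k elt \<Rightarrow> 'k elt" where
  "lmult n m q x y = (\<lambda>c. \<Sum>a\<in>Mon n m. \<Sum>b\<in>Mon n m.
      if c \<in> Mon n m \<and> (\<lambda>i. a i + b i) = c then x a * y b * qcoef n q a b else 0)"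

definition bas :: "mon \<Rightarrow> 'k::field elt" where
  "bas a = (\<lambda>c. if c = a then 1 else 0)"

text \<open>Hochschild d-cochains: k-linear maps Lambda^{\<otimes>d} \<rightarrow> Lambda, given by their values on
  tuples of basis monomials (zero outside the relevant support).\<close>
definition cochains :: "nat \<Rightarrow> (nat \<Rightarrow> nat) \<Rightarrow> nat \<Rightarrow> 'k::field cochain set" where
  "cochains n m d = {f. \<forall>as c. f as c \<noteq> 0 \<longrightarrow> length as = d \<and> set as \<subseteq> Mon n m \<and> c \<in> Mon n m}"

definition ext :: "nat \<Rightarrow> (nat \<Rightarrow> nat) \<Rightarrow> 'k::field cochain \<Rightarrow> 'k elt list \<Rightarrow> 'k elt" where
  "ext n m f xs = (\<lambda>c. \<Sum>as\<in>{as. set as \<subseteq> Mon n m \<and> length as = length xs}.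
      (\<Prod>i<length xs. (xs ! i) (as ! i)) * f as c)"

definition hdiff :: "nat \<Rightarrow> (nat \<Rightarrow> nat) \<Rightarrow> (nat \<Rightarrow> nat \<Rightarrow> 'k::field) \<Rightarrow> nat \<Rightarrow> 'k cochain \<Rightarrow> 'k cochain" where
  "hdiff n m q d f = (\<lambda>as c.
     if length as = Suc d \<and> set as \<subseteq> Mon n m \<and> c \<in> Mon n m then
       lmult n m q (bas (hd as)) (f (tl as)) c
       + (\<Sum>i\<in>{1..d}. (-1) ^ i *
            ext n m f (map bas (take (i - 1) as)
                       @ [lmult n m q (bas (as ! (i - 1))) (bas (as ! i))]
                       @ map bas (drop (Suc i) as)) c)
       + (-1) ^ Suc d * lmult n m q (f (butlast as)) (bas (last as)) c
     else 0)"

definition is_cocycle :: "nat \<Rightarrow> (nat \<Rightarrow> nat) \<Rightarrow> (nat \<Rightarrow> nat \<Rightarrow> 'k::field) \<Rightarrow> nat \<Rightarrow> 'k cochain \<Rightarrow> bool" where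
  "is_cocycle n m q d f \<longleftrightarrow> f \<in> cochains n m d \<and> hdiff n m q d f = (\<lambda>_ _. 0)"

definition is_coboundary :: "nat \<Rightarrow> (nat \<Rightarrow> nat) \<Rightarrow> (nat \<Rightarrow> nat \<Rightarrow> 'k::field) \<Rightarrow> nat \<Rightarrow> 'k cochain \<Rightarrow> bool" where
  "is_coboundary n m q d h \<longleftrightarrow>
     (if d = 0 then h = (\<lambda>_ _. 0) else (\<exists>g\<in>cochains n m (d - 1). h = hdiff n m q (d - 1) g))"

definition cup :: "nat \<Rightarrow> (nat \<Rightarrow> nat) \<Rightarrow> (nat \<Rightarrow> nat \<Rightarrow> 'k::field) \<Rightarrow> nat \<Rightarrow> nat \<Rightarrow> 'k cochain \<Rightarrow> 'k cochain \<Rightarrow> 'k cochain" where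
  "cup n m q p r f g = (\<lambda>as c.
     if length as = p + r \<and> set as \<subseteq> Mon n m then lmult n m q (f (take p as)) (g (drop p as)) c else 0)"

text \<open>Gerstenhaber composition f \<circ> g = sum_{i=1}^p (-1)^((r-1)(i-1)) f \<circ>_i g
  for f of degree p and g of degree r.\<close>
definition gcirc :: "nat \<Rightarrow> (nat \<Rightarrow> nat) \<Rightarrow> nat \<Rightarrow> nat \<Rightarrow> 'k::field cochain \<Rightarrow> 'k cochain \<Rightarrow> 'k cochain" where
  "gcirc n m p r f g = (\<lambda>as c.
     if length as = p + r - 1 \<and> set as \<subseteq> Mon n m then
       (\<Sum>i\<in>{1..p}. (-1) ^ ((r + 1) * (i - 1)) *
          ext n m f (map bas (take (i - 1) as) @ [g (take r (drop (i - 1) as))]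
                     @ map bas (drop (i - 1 + r) as)) c)
     else 0)"

text \<open>Gerstenhaber bracket [f,g] = f \<circ> g - (-1)^((p-1)(r-1)) g \<circ> f.\<close>
definition gbr :: "nat \<Rightarrow> (nat \<Rightarrow> nat) \<Rightarrow> nat \<Rightarrow> nat \<Rightarrow> 'k::field cochain \<Rightarrow> 'k cochain \<Rightarrow> 'k cochain" where
  "gbr n m p r f g = (\<lambda>as c. gcirc n m p r f g as c - (-1) ^ ((p + 1) * (r + 1)) * gcirc n m r p g f as c)"

definition unit0 :: "'k::field cochain" where
  "unit0 = (\<lambda>as c. if as = [] \<and> c = (\<lambda>_. 0) then 1 else 0)"

fun cup_list :: "nat \<Rightarrow> (nat \<Rightarrow> nat) \<Rightarrow> (nat \<Rightarrow> nat \<Rightarrow> 'k::field) \<Rightarrow> (nat \<Rightarrow> 'k cochain) \<Rightarrow> nat list \<Rightarrow> 'k cochain" where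
  "cup_list n m q V [] = unit0"
| "cup_list n m q V (i # is) = cup n m q 1 (length is) (V i) (cup_list n m q V is)"

definition Vset :: "nat \<Rightarrow> (nat \<Rightarrow> nat) \<Rightarrow> (nat \<Rightarrow> nat \<Rightarrow> 'k::field) \<Rightarrow> (nat \<Rightarrow> 'k cochain) \<Rightarrow> nat set \<Rightarrow> 'k cochain" where
  "Vset n m q V S = cup_list n m q V (sorted_list_of_set S)"

text \<open>The degree-d part of the linear combination u U + sum_{|S|=d} c_S V_S
  (the U-term only occurs in degree 0); the images of the basis
  {1, U} \<union> {V_S : S nonempty} of k[U]/(U^2) \<times>_k \<Lambda>(V_1..V_n).\<close>
definition lincomb :: "nat \<Rightarrow> (nat \<Rightarrow> nat) \<Rightarrow> (nat \<Rightarrow> nat \<Rightarrow> 'k::field) \<Rightarrow> 'k cochain \<Rightarrow> (nat \<Rightarrow> 'k cochain)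
    \<Rightarrow> nat \<Rightarrow> 'k \<Rightarrow> (nat set \<Rightarrow> 'k) \<Rightarrow> 'k cochain" where
  "lincomb n m q U V d u cS = (\<lambda>as x.
     (if d = 0 then u * U as x else 0)
     + (\<Sum>S\<in>{S. S \<subseteq> {..<n} \<and> card S = d}. cS S * Vset n m q V S as x))"

end

theory Submission
  imports Defs "HOL-Library.Function_Algebras"
begin

text \<open>
  The Hochschild complex splits by multidegree \<open>\<delta>\<close>, and up to rescaling the parameters \<open>q\<close> enter the part
  of multidegree \<open>\<delta>\<close> only through the factors \<open>\<lambda>\<^sub>i\<close> by which \<open>x\<^sub>i\<close> commutes with a monomial of that
  degree. The minimal resolution, whose generators are indexed by \<open>f\<close> in \<open>\<nat>\<^sup>n\<close>, maps to the bar resolution.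
  An acyclic matching on the bar cells, whose critical cells are the leading terms of the images of these
  generators, shows that restricting cochains along this map is injective on cohomology. On the small
  complex the differential in direction \<open>i\<close> is multiplication by \<open>\<lambda>\<^sub>i - 1\<close> or
  \<open>1 + \<lambda>\<^sub>i + ... + \<lambda>\<^sub>i\<^sup>m\<^sup>-\<^sup>1\<close> with \<open>m = m\<^sub>i\<close>. If \<open>\<delta>\<close> has a nonzero entry away from \<open>i\<close>, then \<open>\<lambda>\<^sub>i\<close> is
  not a root of unity because the \<open>q\<^sub>i\<^sub>j\<close> are free, so direction \<open>i\<close> is contractible unless \<open>\<delta>\<close> is maximal
  there. As \<open>n \<ge> 2\<close> only two multidegrees survive: the top degree of the algebra, which gives U, and
  \<open>\<delta> = 0\<close>, where all differentials on the small complex vanish and the products of the Euler derivations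
  are dual to the generators with \<open>f\<close> in \<open>{0,1}\<^sup>n\<close>.
\<close>

subsection \<open>The bar differential on scalar cochains\<close>

text \<open>The argument is algebraic discrete Morse theory run by hand, and no homotopy inverse of
  the comparison map is built. Spanning follows once a cocycle that restricts to zero on the small
  complex is known to be a coboundary; independence follows because \<open>J\<close> is a chain map
  and the differentials at the relevant generators vanish. The obstacle is truncation: products
  outside the box are zero, and values outside the box do not exist. Face identities therefore hold
  only inside a window of degrees, and most of the side conditions below express that window.
  Truncation also explains multidegree 0: the norm coefficient there is \<open>m i\<close> as an
  element of the field, which may be nonzero, but the generators at which it occurs have degrees
  outside the window. This makes the argument uniform in the characteristic.\<close>

declare plus_fun_apply [simp del] zero_fun_apply [simp del]

lemmas pt = plus_fun_apply zero_fun_apply le_fun_def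

definition pw :: "nat \<Rightarrow> nat \<Rightarrow> mon" where
  "pw i s = (\<lambda>k. if k = i then s else 0)"

lemma pw_apply: "pw i s k = (if k = i then s else 0)"
  by (simp add: pw_def)

lemma pw_eq_0_iff [simp]: "pw i s = 0 \<longleftrightarrow> s = 0"
  by (auto simp: pw_def fun_eq_iff pt)

lemma pw_add: "pw i s + pw i t = pw i (s + t)"
  by (auto simp: pw_def pt fun_eq_iff)

lemma mon_le_add: "(a::mon) \<le> a + b" "(b::mon) \<le> a + b"
  by (auto simp: pt)

lemma mon_add_mono: "a \<le> c \<Longrightarrow> b \<le> d \<Longrightarrow> a + b \<le> c + (d::mon)"
  by (auto simp: pt add_mono)

locale exponent_box =
  fixes n :: nat and m :: mon
  assumes m2: "i < n \<Longrightarrow> 2 \<le> m i"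
begin

abbreviation M :: "mon set" where "M \<equiv> Mon n m"

lemma m_pos: "i < n \<Longrightarrow> 0 < m i"
  using m2[of i] by simp

lemma zero_in_M [simp]: "0 \<in> M"
  by (auto simp: Mon_def m_pos pt)

lemma pw_in_M: "i < n \<Longrightarrow> s < m i \<Longrightarrow> pw i s \<in> M"
  by (auto simp: Mon_def pw_def m_pos)

lemma M_downward: "b \<in> M \<Longrightarrow> a \<le> b \<Longrightarrow> a \<in> M"
  unfolding Mon_def le_fun_def
  by clarsimp (metis le_zero_eq order_le_less_trans)

lemma add_M_D: "a + b \<in> M \<Longrightarrow> a \<in> M" "a + b \<in> M \<Longrightarrow> b \<in> M"
  by (auto intro: M_downward mon_le_add)

lemma M_less: "a \<in> M \<Longrightarrow> i < n \<Longrightarrow> a i < m i"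
  by (auto simp: Mon_def)

lemma M_zero: "a \<in> M \<Longrightarrow> n \<le> i \<Longrightarrow> a i = 0"
  by (auto simp: Mon_def)

lemma M_pos_less: "a \<in> M \<Longrightarrow> 0 < a i \<Longrightarrow> i < n"
  by (metis M_zero not_less less_numeral_extra(3))

text \<open>A cochain of multidegree \<open>\<delta>\<close> sends a list of exponents \<open>as\<close> to a multiple of the monomial with exponent
  \<open>sum_list as + \<delta>\<close>, so it is a scalar function \<open>z\<close> of \<open>as\<close>. In \<open>df\<close> only the left outer face carries a
  coefficient, the character \<open>L\<close>; \<open>inn\<close> collects the inner faces and the right outer face.\<close>
fun inn :: "(mon list \<Rightarrow> 'k::field) \<Rightarrow> mon list \<Rightarrow> 'k" where
  "inn z [] = 0"
| "inn z [a] = - z []"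
| "inn z (a # b # as) = - (if a + b \<in> M then z ((a + b) # as) else 0) - inn (\<lambda>bs. z (a # bs)) (b # as)"

definition df :: "(mon \<Rightarrow> 'k::field) \<Rightarrow> (mon list \<Rightarrow> 'k) \<Rightarrow> mon list \<Rightarrow> 'k" where
  "df L z as = L (hd as) * z (tl as) + inn z as"

lemma df_Cons: "df L z (a # as) = L a * z as + inn z (a # as)"
  by (simp add: df_def)

lemma inn_cong:
  assumes "\<And>v. Suc (length v) = length as \<Longrightarrow> sum_list v \<le> sum_list as \<Longrightarrow> (set as \<subseteq> M \<Longrightarrow> set v \<subseteq> M) \<Longrightarrow> z v = w v"
  shows "inn z as = inn w as"
  using assms
proof (induction z as arbitrary: w rule: inn.induct)
  case (1 z)
  then show ?case by simp
next
  case (2 z a)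
  then show ?case by (simp add: pt)
next
  case (3 z a b as)
  have "a + b \<in> M \<Longrightarrow> z ((a + b) # as) = w ((a + b) # as)"
    by (rule 3(2)) (auto simp: add.assoc)
  moreover have "inn (\<lambda>bs. z (a # bs)) (b # as) = inn (\<lambda>bs. w (a # bs)) (b # as)"
    by (rule 3(1), rule 3(2)) (auto simp: add.assoc intro: mon_add_mono)
  ultimately show ?case by simp
qed

lemma inn_zero [simp]: "inn (\<lambda>_. 0) as = 0"
  by (induction "(\<lambda>_. 0) :: mon list \<Rightarrow> 'a" as rule: inn.induct) auto

lemma inn_lin: "inn (\<lambda>as. c * z as + w as) as = c * inn z as + inn w as"
proof (induction z as arbitrary: w rule: inn.induct)
  case (3 z a b as)
  show ?case
    using 3[of "\<lambda>bs. w (a # bs)"] by (simp add: algebra_simps)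
next
  case (2 z a) then show ?case by (simp add: algebra_simps)
qed auto

lemma inn_uminus: "inn (\<lambda>as. - z as) as = - inn z as"
  using inn_lin[of "-1" z "\<lambda>_. 0" as] by simp

lemma df_lin: "df L (\<lambda>as. c * z as + w as) as = c * df L z as + df L w as"
  unfolding df_def inn_lin by (simp add: algebra_simps)

lemma df_diff: "df L (\<lambda>as. z as - w as) as = df L z as - df L w as"
  using df_lin[of L "-1" w z as] by simp

lemma df_zero [simp]: "df L (\<lambda>_. 0) as = 0"
  by (simp add: df_def)

lemma df_cong:
  assumes "as \<noteq> []"
    and "\<And>v. Suc (length v) = length as \<Longrightarrow> sum_list v \<le> sum_list as \<Longrightarrow> (set as \<subseteq> M \<Longrightarrow> set v \<subseteq> M) \<Longrightarrow> z v = w v"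
  shows "df L z as = df L w as"
proof -
  obtain a bs where as: "as = a # bs" using assms(1) by (cases as) auto
  have "z bs = w bs" by (rule assms(2)) (auto simp: as mon_le_add)
  moreover have "inn z as = inn w as" by (rule inn_cong, rule assms(2))
  ultimately show ?thesis by (simp add: df_def as)
qed

text \<open>The faces cancel in pairs, as in a bar complex without its left outer face. The one
  doubtful pair drops the last two entries, either one by one or after multiplying them; the latter
  requires their product to lie in the box.\<close>

lemma inn_inn:
  assumes "\<And>xs a b. as = xs @ [a, b] \<Longrightarrow> z xs \<noteq> 0 \<Longrightarrow> a + b \<in> M"
  shows "inn (inn z) as = 0"
  using assms
proof (induction as arbitrary: z rule: length_induct)
  case (1 as)
  consider "as = []" | a where "as = [a]" | a b where "as = [a, b]" | a b c bs where "as = a # b # c # bs"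
    by (metis list.exhaust)
  then show ?case
  proof cases
    case (3 a b)
    then show ?thesis using 1(2)[of "[]" a b] by auto
  next
    case (4 a b c bs)
    \<comment> \<open>\<open>T\<close> absorbs the first entry of its argument into
      \<open>a\<close>; its default at the empty list is the right outer face of the one-entry
      list.\<close>
    define T where "T = (\<lambda>xs. case xs of [] \<Rightarrow> z [] | x # xs \<Rightarrow> if a + x \<in> M then z ((a + x) # xs) else 0)"
    have za: "(\<lambda>xs. inn z (a # xs)) = (\<lambda>xs. (-1) * T xs + (- inn (\<lambda>bs. z (a # bs)) xs))"
      by (auto simp: T_def fun_eq_iff split: list.splits)
    have IH: "inn (inn (\<lambda>bs. z (a # bs))) (b # c # bs) = 0"
    proof (rule 1(1)[rule_format])
      show "length (b # c # bs) < length as" using 4 by simp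
      fix xs x y assume "b # c # bs = xs @ [x, y]" "z (a # xs) \<noteq> 0"
      then show "x + y \<in> M" using 1(2)[of "a # xs" x y] 4 by simp
    qed
    have "inn (\<lambda>xs. - inn (\<lambda>bs. z (a # bs)) xs) (b # c # bs) = 0"
      using IH by (simp only: inn_uminus minus_zero)
    then have 2: "inn (\<lambda>xs. inn z (a # xs)) (b # c # bs) = - inn T (b # c # bs)"
      unfolding za using inn_lin[of "-1" T "\<lambda>xs. - inn (\<lambda>bs. z (a # bs)) xs"] by simp
    have Tb: "(\<lambda>xs. T (b # xs)) = (\<lambda>xs. if a + b \<in> M then z ((a + b) # xs) else 0)"
      by (simp add: T_def)
    have 3: "inn T (b # c # bs) = - (if b + c \<in> M then T ((b + c) # bs) else 0)
       - (if a + b \<in> M then inn (\<lambda>xs. z ((a + b) # xs)) (c # bs) else 0)"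
      by (simp add: Tb)
    have abc: "a + b + c \<in> M \<Longrightarrow> a + b \<in> M \<and> b + c \<in> M"
      using add_M_D[of "a + b" c] add_M_D[of a "b + c"] by (auto simp: add.assoc)
    show ?thesis
      using 2 3 abc by (simp add: 4 T_def add.assoc)
  qed auto
qed

text \<open>The exponent \<open>w + \<delta>\<close> of the value lies in the box; beyond \<open>n\<close> this forces \<open>\<delta> i = 0\<close>.\<close>
definition win :: "(nat \<Rightarrow> int) \<Rightarrow> mon \<Rightarrow> bool" where
  "win \<delta> w \<longleftrightarrow> (\<forall>i. if i < n then 0 \<le> int (w i) + \<delta> i \<and> int (w i) + \<delta> i < int (m i) else int (w i) + \<delta> i = 0)"

definition cell :: "(nat \<Rightarrow> int) \<Rightarrow> mon list \<Rightarrow> bool" where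
  "cell \<delta> as \<longleftrightarrow> set as \<subseteq> M \<and> win \<delta> (sum_list as)"

definition supp_in :: "(nat \<Rightarrow> int) \<Rightarrow> nat \<Rightarrow> (mon list \<Rightarrow> 'k::field) \<Rightarrow> bool" where
  "supp_in \<delta> d z \<longleftrightarrow> (\<forall>as. z as \<noteq> 0 \<longrightarrow> cell \<delta> as \<and> length as = d)"

definition dd :: "(nat \<Rightarrow> int) \<Rightarrow> (mon \<Rightarrow> 'k::field) \<Rightarrow> nat \<Rightarrow> (mon list \<Rightarrow> 'k) \<Rightarrow> mon list \<Rightarrow> 'k" where
  "dd \<delta> L d z as = (if cell \<delta> as \<and> length as = Suc d then df L z as else 0)"

definition cocyc :: "(nat \<Rightarrow> int) \<Rightarrow> (mon \<Rightarrow> 'k::field) \<Rightarrow> nat \<Rightarrow> (mon list \<Rightarrow> 'k) \<Rightarrow> bool" where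
  "cocyc \<delta> L d z \<longleftrightarrow> supp_in \<delta> d z \<and> dd \<delta> L d z = (\<lambda>_. 0)"

lemma supp_in_dd: "supp_in \<delta> (Suc d) (dd \<delta> L d z)"
  by (simp add: supp_in_def dd_def)

lemma sum_list_M_zero: "set as \<subseteq> M \<Longrightarrow> n \<le> i \<Longrightarrow> sum_list as i = 0" for as :: "mon list"
  by (induction as) (auto simp: M_zero pt)

lemma df_supp:
  assumes "\<And>v. sum_list v \<le> sum_list as \<Longrightarrow> z v = 0" "as \<noteq> []"
  shows "df L z as = 0"
  using df_cong[of as z "\<lambda>_. 0"] assms by simp

text \<open>Below the window all faces leave the window as well.\<close>
lemma df_eq_dd:
  assumes "supp_in \<delta> d z" "set v \<subseteq> M" "length v = Suc d"
    and up: "\<And>i. i < n \<Longrightarrow> int (sum_list v i) + \<delta> i < int (m i)"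
    and hi: "\<And>i. n \<le> i \<Longrightarrow> \<delta> i = 0"
  shows "dd \<delta> L d z v = df L z v"
proof (cases "cell \<delta> v")
  case False
  then obtain i where i: "i < n" "int (sum_list v i) + \<delta> i < 0"
    using assms sum_list_M_zero[OF assms(2)] unfolding cell_def win_def
    by (metis add_0 linorder_not_le of_nat_0)
  have "df L z v = 0"
  proof (rule df_supp)
    fix u assume "sum_list u \<le> sum_list v"
    then have "int (sum_list u i) + \<delta> i < 0" using i by (auto simp: le_fun_def dest!: spec[of _ i])
    then have "\<not> cell \<delta> u" using i by (auto simp: cell_def win_def split: if_splits intro!: exI[of _ i])
    then show "z u = 0" using assms(1) by (auto simp: supp_in_def)
  qed (use assms in auto)
  then show ?thesis using False by (simp add: dd_def)
qed (use assms in \<open>simp add: dd_def\<close>)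

text \<open>The left face multiplies by a character and commutes with the faces in
  \<open>inn\<close>. Two left faces cancel against the left face of the merged pair, provided that
  pair stays in the box.\<close>

lemma df_df:
  assumes L: "\<And>a b. L (a + b) = L a * L b"
    and supp: "\<And>a b as. \<rho> = a # b # as \<Longrightarrow> z as \<noteq> 0 \<Longrightarrow> a + b \<in> M"
      "\<And>xs a b. \<rho> = xs @ [a, b] \<Longrightarrow> z xs \<noteq> 0 \<Longrightarrow> a + b \<in> M"
    and len: "2 \<le> length \<rho>"
  shows "df L (df L z) \<rho> = 0"
proof -
  obtain a b as where \<rho>: "\<rho> = a # b # as"
    using len by (metis Suc_le_length_iff numeral_2_eq_2)
  define l where "l = (\<lambda>xs. L (hd xs) * z (tl xs))"
  have d: "df L z = (\<lambda>xs. 1 * l xs + inn z xs)"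
    by (simp add: df_def l_def fun_eq_iff)
  have "inn (\<lambda>xs. l (a # xs)) (b # as) = L a * inn z (b # as)"
    using inn_lin[of "L a" z "\<lambda>_. 0"] by (simp add: l_def)
  then have "df L (df L z) \<rho> = (L a * L b - (if a + b \<in> M then L (a + b) else 0)) * z as + inn (inn z) \<rho>"
    unfolding df_Cons \<rho> unfolding d inn_lin by (simp add: l_def algebra_simps)
  moreover have "inn (inn z) \<rho> = 0"
    by (rule inn_inn) (use supp(2) in blast)
  moreover have "z as \<noteq> 0 \<Longrightarrow> a + b \<in> M"
    using supp(1) \<rho> by blast
  ultimately show ?thesis using L by (auto simp: \<rho>)
qed

lemma cell_beyond: "cell \<delta> as \<Longrightarrow> n \<le> i \<Longrightarrow> \<delta> i = 0"
  using sum_list_M_zero[of as i] by (auto simp: cell_def win_def dest!: spec[of _ i])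

text \<open>Both values lie in intervals of length \<open>m i\<close>, so their difference is an
  exponent of the box. This supplies the side conditions for cancelling double outer faces.\<close>

lemma win_diff_in_M:
  assumes "win \<delta> v" "win \<delta> (v + w)"
  shows "w \<in> M"
proof -
  have "w i < m i" if "i < n" for i
    using assms(1)[unfolded win_def, rule_format, of i] assms(2)[unfolded win_def, rule_format, of i] that
    by (simp add: pt)
  moreover have "w i = 0" if "n \<le> i" for i
    using assms(1)[unfolded win_def, rule_format, of i] assms(2)[unfolded win_def, rule_format, of i] that
    by (simp add: pt)
  ultimately show ?thesis by (auto simp: Mon_def)
qed

text \<open>A face of a cell can leave the window only at its lower edge, where \<open>df\<close> is
  zero anyway; so cutting off after the first differential changes nothing.\<close>

lemma dd_dd:
  assumes L: "\<And>a b. L (a + b) = L a * L b" and z: "supp_in \<delta> d z"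
  shows "dd \<delta> L (Suc d) (dd \<delta> L d z) = (\<lambda>_. 0)"
proof
  fix \<rho>
  show "dd \<delta> L (Suc d) (dd \<delta> L d z) \<rho> = 0"
  proof (cases "cell \<delta> \<rho> \<and> length \<rho> = Suc (Suc d)")
    case True
    have "df L (dd \<delta> L d z) \<rho> = df L (df L z) \<rho>"
    proof (rule df_cong)
      fix v assume v: "Suc (length v) = length \<rho>" "sum_list v \<le> sum_list \<rho>" "set \<rho> \<subseteq> M \<Longrightarrow> set v \<subseteq> M"
      show "dd \<delta> L d z v = df L z v"
      proof (rule df_eq_dd[OF z])
        show "set v \<subseteq> M" "length v = Suc d" using v True by (auto simp: cell_def)
        fix i
        show "n \<le> i \<Longrightarrow> \<delta> i = 0" using True cell_beyond by blast
        assume "i < n"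
        then have "int (sum_list \<rho> i) + \<delta> i < int (m i)" using True by (auto simp: cell_def win_def)
        moreover have "sum_list v i \<le> sum_list \<rho> i" using v(2) by (simp add: le_fun_def)
        ultimately show "int (sum_list v i) + \<delta> i < int (m i)" by linarith
      qed
    qed (use True in auto)
    also have "\<dots> = 0"
    proof (rule df_df[OF L])
      fix xs a b assume \<rho>: "\<rho> = xs @ [a, b]" and nz: "z xs \<noteq> 0"
      have "win \<delta> (sum_list xs)" "win \<delta> (sum_list xs + (a + b))"
        using z nz True by (auto simp: supp_in_def cell_def \<rho> add.assoc)
      then show "a + b \<in> M" by (rule win_diff_in_M)
    next
      fix a b xs assume \<rho>: "\<rho> = a # b # xs" and nz: "z xs \<noteq> 0"
      have "win \<delta> (sum_list xs)" "win \<delta> (sum_list xs + (a + b))"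
        using z nz True by (auto simp: supp_in_def cell_def \<rho> ac_simps)
      then show "a + b \<in> M" by (rule win_diff_in_M)
    qed (use True in auto)
    finally show ?thesis by (simp add: dd_def)
  qed (auto simp: dd_def)
qed

end

subsection \<open>An acyclic matching on lists of monomials\<close>

text \<open>The last letter of the normal word, since normal words descend.\<close>

definition mi :: "mon \<Rightarrow> nat" where
  "mi a = (LEAST i. 0 < a i)"

lemma mi_pos: "a \<noteq> 0 \<Longrightarrow> 0 < a (mi a)"
  unfolding mi_def by (rule LeastI_ex) (auto simp: fun_eq_iff pt)

lemma mi_le: "0 < a i \<Longrightarrow> mi a \<le> i"
  unfolding mi_def by (rule Least_le)

lemma below_mi: "i < mi a \<Longrightarrow> a i = 0"
  using mi_le[of a i] by force

lemma mi_pw [simp]: "0 < s \<Longrightarrow> mi (pw i s) = i"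
  using mi_pos[of "pw i s"] by (auto simp: pw_apply split: if_splits)

lemma mi_eqI: "0 < a p \<Longrightarrow> (\<And>i. i < p \<Longrightarrow> a i = 0) \<Longrightarrow> mi a = p"
  by (metis le_neq_implies_less less_nat_zero_code mi_le mi_pos zero_fun_apply)

datatype status = Critical | Up | Down | OddUnits | EvenUnits

context exponent_box
begin

text \<open>Normal words list the variables in descending order, so the obstructions are the words \<open>x\<^sub>r x\<^sub>p\<close> with
  \<open>r < p\<close> and \<open>x\<^sub>p\<close> to the power \<open>m p\<close>. \<open>piece a as\<close> is the shortest right factor of \<open>a\<close> that forms an
  obstruction with the first entry of \<open>as\<close>; it is \<open>None\<close> if \<open>a\<close> can be merged with that entry.\<close>
definition piece :: "mon \<Rightarrow> mon list \<Rightarrow> mon option" where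
  "piece a as = (case as of [] \<Rightarrow> Some (pw (mi a) 1)
     | b # _ \<Rightarrow>
         if mi a < mi b then Some (pw (mi a) 1)
         else if b (mi b) = 1 then
           (if a (mi b) = m (mi b) - 1 then Some (pw (mi b) (m (mi b) - 1)) else None)
         else if mi a = mi b then Some (pw (mi a) 1)
         else None)"

text \<open>The list is read from its end. The critical lists are the Anick chains. At the first entry where the
  suffix stops being critical the list is matched with the one in which this entry is merged with its
  right neighbour (\<open>Up\<close>) or loses its \<open>piece\<close> (\<open>Down\<close>). As the complex is not normalised, a run of
  unit monomials in front of a critical suffix has to be matched by the parity of its length.\<close>
fun status :: "mon list \<Rightarrow> status" where
  "status [] = Critical"
| "status (a # as) = (case status as of
       Critical \<Rightarrow> if a = 0 then OddUnits
         else (case piece a as of None \<Rightarrow> Up | Some t \<Rightarrow> if a = t then Critical else Down)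
     | OddUnits \<Rightarrow> if a = 0 then EvenUnits else Down
     | EvenUnits \<Rightarrow> if a = 0 then OddUnits else Up
     | Up \<Rightarrow> Up
     | Down \<Rightarrow> Down)"

definition ups :: "mon list \<Rightarrow> bool" where "ups as \<longleftrightarrow> status as \<in> {Up, EvenUnits}"
definition downs :: "mon list \<Rightarrow> bool" where "downs as \<longleftrightarrow> status as \<in> {Down, OddUnits}"

lemma status_cases: "status as = Critical \<or> ups as \<or> downs as"
  by (cases "status as") (auto simp: ups_def downs_def)

lemma not_both: "\<not> (ups as \<and> downs as)" "status as = Critical \<Longrightarrow> \<not> ups as" "status as = Critical \<Longrightarrow> \<not> downs as"
  by (auto simp: ups_def downs_def)

fun mg :: "mon list \<Rightarrow> mon list" where
  "mg [] = []"
| "mg (a # as) = (if status as = Critical then (a + hd as) # tl as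
     else if status as = OddUnits \<and> a = 0 then as else a # mg as)"

fun sp :: "mon list \<Rightarrow> mon list" where
  "sp [] = []"
| "sp (a # as) = (if status as = Critical then
       (if a = 0 then 0 # 0 # as else (a - the (piece a as)) # the (piece a as) # as)
     else if status as = EvenUnits \<and> a = 0 then 0 # 0 # as else a # sp as)"

lemma critE:
  assumes "status (b # c) = Critical"
  shows "status c = Critical" "b \<noteq> 0" "piece b c = Some b"
  using assms by (auto split: status.splits if_splits option.splits)

text \<open>A long piece must complete \<open>x^m\<close> together with the single letter behind it,
  so \<open>a\<close> has to carry the maximal exponent of that variable; every other obstruction
  uses one letter.\<close>

lemma piece_Some:
  assumes a: "a \<in> M" "a \<noteq> 0" and c: "status c = Critical" "set c \<subseteq> M" and t: "piece a c = Some t"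
  shows "t = pw (mi a) 1 \<or> t = pw (mi a) (m (mi a) - 1) \<and> a (mi a) = m (mi a) - 1"
proof (cases c)
  case Nil
  then show ?thesis using t by (simp add: piece_def)
next
  case (Cons b c')
  have b: "b \<noteq> 0" "b \<in> M" using critE(2)[OF c(1)[unfolded Cons]] c(2) Cons by auto
  have p: "mi b < n" using b mi_pos M_pos_less by blast
  show ?thesis
  proof (cases "mi a < mi b \<or> b (mi b) \<noteq> 1")
    case True
    then show ?thesis using t unfolding piece_def Cons list.case by (metis option.distinct(1) option.inject)
  next
    case False
    then have "a (mi b) = m (mi b) - 1" and tt: "t = pw (mi b) (m (mi b) - 1)"
      using t unfolding piece_def Cons list.case by (metis option.distinct(1) option.inject)+
    moreover from this have "mi a \<le> mi b" using mi_le[of a "mi b"] m2[OF p] by simp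
    ultimately show ?thesis using False by (auto)
  qed
qed

lemma mi_less: "a \<in> M \<Longrightarrow> a \<noteq> 0 \<Longrightarrow> mi a < n"
  using mi_pos M_pos_less by blast

lemma crit_hd:
  assumes "status (b # c) = Critical" "b \<in> M" "set c \<subseteq> M"
  shows "\<exists>s. b = pw (mi b) s \<and> 0 < s \<and> (s = 1 \<or> s = m (mi b) - 1)"
proof -
  have "b \<noteq> 0" using critE[OF assms(1)] by simp
  then have "0 < m (mi b) - 1" using m2 mi_less[OF assms(2)] by fastforce
  then show ?thesis
    using piece_Some[OF assms(2) _ _ assms(3) critE(3)[OF assms(1)]] critE[OF assms(1)] by auto
qed

text \<open>The piece retains everything that its choice depends on, so cutting again returns it
  whole.\<close>

lemma piece_self:
  assumes a: "a \<in> M" "a \<noteq> 0" and c: "status c = Critical" "set c \<subseteq> M" and t: "piece a c = Some t"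
  shows "status (t # c) = Critical" "t \<le> a" "t \<in> M" "mi t = mi a" "t \<noteq> 0"
proof -
  have p: "mi a < n" using a mi_less by blast
  have mp: "2 \<le> m (mi a)" using m2[OF p] .
  note T = piece_Some[OF assms]
  show t0: "t \<noteq> 0" using T mp by auto
  show mt: "mi t = mi a" using T mp by auto
  show "t \<le> a" using T mi_pos[OF a(2)] by (auto simp: le_fun_def pw_apply)
  then show "t \<in> M" using a M_downward by blast
  have "piece t c = Some t"
  proof (cases c)
    case Nil
    then show ?thesis using t mt by (simp add: piece_def)
  next
    case (Cons b c')
    show ?thesis using t mt unfolding piece_def Cons
      by (auto split: if_splits simp: pw_apply)
  qed
  then show "status (t # c) = Critical" using c t0 by simp
qed

text \<open>The remainder forms no obstruction with the piece: it has no smaller variable, and its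
  exponent at \<open>mi a\<close> has dropped below \<open>m - 1\<close>, or to 0 if the piece is a
  longer power. The split list is therefore an up-list.\<close>

lemma split_piece:
  assumes a: "a \<in> M" "a \<noteq> 0" and c: "status c = Critical" "set c \<subseteq> M" and t: "piece a c = Some t" "a \<noteq> t"
  shows "a - t \<noteq> 0" "a - t \<in> M" "(a - t) + t = a" "piece (a - t) (t # c) = None"
proof -
  note S = piece_self[OF a c t(1)] and T = piece_Some[OF a c t(1)]
  have p: "mi a < n" using a mi_less by blast
  have mp: "2 \<le> m (mi a)" "a (mi a) < m (mi a)" using m2[OF p] M_less[OF a(1) p] .
  show eq: "(a - t) + t = a" using S(2) by (auto simp: fun_eq_iff pt)
  show nz: "a - t \<noteq> 0" using eq t(2) by force
  show "a - t \<in> M" by (rule M_downward[OF a(1)]) (auto simp: le_fun_def)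
  have le: "mi a \<le> mi (a - t)"
    using mi_pos[OF nz] by (auto intro!: mi_le)
  have hd: "t (mi t) = 1 \<Longrightarrow> (a - t) (mi a) < m (mi a) - 1"
    using S mp by simp
  have hd2: "t (mi t) \<noteq> 1 \<Longrightarrow> (a - t) (mi a) = 0"
    using T S by (auto simp: pw_apply)
  have ne: "t (mi t) \<noteq> 1 \<Longrightarrow> mi (a - t) \<noteq> mi a"
    using hd2 mi_pos[OF nz] by force
  show "piece (a - t) (t # c) = None"
    using le hd ne S(4) unfolding piece_def list.case by (auto simp del: minus_apply)
qed

text \<open>The converse of splitting. The normal word of \<open>a + b\<close> is that of
  \<open>a\<close> followed by that of \<open>b\<close>, and its shortest right factor obstructing
  with \<open>c\<close> is \<open>b\<close> again.\<close>

lemma merge_piece: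
  assumes bc: "status (b # c) = Critical" and M: "a \<in> M" "b \<in> M" "set c \<subseteq> M"
    and a: "a \<noteq> 0" "piece a (b # c) = None"
  shows "a + b \<in> M" "piece (a + b) c = Some b" "mi b \<le> mi a" "mi (a + b) = mi b"
    "b (mi b) = 1 \<or> mi b < mi a" "\<exists>s. b = pw (mi b) s"
proof -
  note c = critE[OF bc]
  obtain s where s: "b = pw (mi b) s" "0 < s" "s = 1 \<or> s = m (mi b) - 1"
    using crit_hd[OF bc M(2,3)] by auto
  then show "\<exists>s. b = pw (mi b) s" by blast
  have p: "mi b < n" using M c mi_less by blast
  have mp: "2 \<le> m (mi b)" using m2[OF p] .
  have bp: "b (mi b) = s" by (subst s(1)) (simp add: pw_apply)
  show le: "mi b \<le> mi a" using a(2) by (auto simp: piece_def split: if_splits)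
  show mab: "mi (a + b) = mi b"
    by (rule mi_eqI) (use le mi_pos[OF c(2)] in \<open>auto simp: pt below_mi\<close>)
  show one: "b (mi b) = 1 \<or> mi b < mi a" using a(2) le by (auto simp: piece_def split: if_splits)
  have ab: "(a + b) i = (if i = mi b then a i + s else a i)" for i
    by (subst s(1)) (simp add: pt pw_apply)
  have lt: "a (mi b) + s < m (mi b)"
  proof (cases "b (mi b) = 1")
    case True
    then have "a (mi b) \<noteq> m (mi b) - 1" using a(2) le by (auto simp: piece_def split: if_splits)
    then show ?thesis using M_less[OF M(1) p] True bp by simp
  next
    case False
    then show ?thesis using one below_mi[of "mi b" a] s bp mp by auto
  qed
  then show "a + b \<in> M" using M(1) p ab by (auto simp: Mon_def)
  show "piece (a + b) c = Some b"
  proof (cases c)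
    case Nil
    then have "b = pw (mi b) 1" using c(3) by (simp add: piece_def)
    then have "s = 1" using bp by (metis pw_apply)
    then show ?thesis using Nil mab s by (simp add: piece_def)
  next
    case (Cons b' c')
    consider "mi b < mi b'" | "\<not> mi b < mi b'" "b' (mi b') = 1" "b (mi b') = m (mi b') - 1" "b = pw (mi b') (m (mi b') - 1)"
      | "b' (mi b') \<noteq> 1" "mi b = mi b'" "b = pw (mi b) 1"
      using c(3) unfolding piece_def Cons list.case by (metis option.distinct(1) option.inject)
    then show ?thesis
    proof cases
      case 1
      then have "b = pw (mi b) 1" using c(3) by (auto simp: piece_def Cons)
      then show ?thesis using 1 by (simp add: piece_def Cons mab)
    next
      case 2
      have eq: "mi b = mi b'" using 2(4) c(2) mi_pw by (metis gr0I pw_eq_0_iff)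
      have "a (mi b) = 0" using lt 2 bp eq by simp
      then have "(a + b) (mi b') = m (mi b') - 1" using ab 2 bp eq by simp
      moreover have "\<not> mi (a + b) < mi b'" using mab eq by simp
      ultimately show ?thesis using 2(2) unfolding piece_def Cons list.case 2(4)[symmetric] by simp
    next
      case 3
      show ?thesis using 3(1,2) unfolding piece_def Cons list.case mab 3(3)[symmetric] by simp
    qed
  qed
qed

section \<open>Merging and splitting as inverse bijections\<close>

lemma status_app_Up: "status bs = Up \<Longrightarrow> status (as @ bs) = Up"
  by (induction as) auto

lemma status_app_Even:
  assumes "status bs = EvenUnits" "as = [] \<or> last as \<noteq> 0"
  shows "ups (as @ bs)"
proof (cases as rule: rev_cases)
  case Nil
  then show ?thesis using assms by (simp add: ups_def)
next
  case (snoc xs x)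
  then have "status (x # bs) = Up" using assms by simp
  then show ?thesis using status_app_Up[of "x # bs" xs] snoc by (simp add: ups_def)
qed

lemma noncritical_app: "status bs \<noteq> Critical \<Longrightarrow> status (as @ bs) \<noteq> Critical"
  by (induction as) (auto split: status.splits)

lemma critical_suffix: "status (as @ bs) = Critical \<Longrightarrow> status bs = Critical"
  using noncritical_app by blast

lemma critical_nonzero: "status as = Critical \<Longrightarrow> a \<in> set as \<Longrightarrow> a \<noteq> 0"
proof (induction as)
  case (Cons b as)
  then show ?case using critE(1,2)[OF Cons.prems(1)] by (cases "a = b") (auto simp del: status.simps)
qed simp

lemma sp_OddUnits: "status as = OddUnits \<Longrightarrow> sp as = 0 # as"
  by (cases as) (auto split: status.splits if_splits option.splits)

text \<open>Both maps act at the first place from the right where criticality fails and copy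
  everything to its left, so each undoes the other.\<close>

lemma mg_props:
  assumes "ups \<rho>" "set \<rho> \<subseteq> M"
  shows "status (mg \<rho>) = (if status \<rho> = Up then Down else OddUnits) \<and> sp (mg \<rho>) = \<rho> \<and> set (mg \<rho>) \<subseteq> M
    \<and> Suc (length (mg \<rho>)) = length \<rho> \<and> sum_list (mg \<rho>) = sum_list \<rho>"
  using assms
proof (induction \<rho>)
  case (Cons a as)
  show ?case
  proof (cases "status as = Critical")
    case True
    then have a: "a \<noteq> 0" "piece a as = None" "status (a # as) = Up"
      using Cons(2) by (auto simp: ups_def split: if_splits option.splits)
    obtain b c where as: "as = b # c" using a by (cases as) (auto simp: piece_def)
    note mp = merge_piece[OF True[unfolded as] _ _ _ a(1) a(2)[unfolded as]]
    have M: "a \<in> M" "b \<in> M" "set c \<subseteq> M" using Cons(3) by (auto simp: as)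
    note mp = mp[OF M] and c = critE[OF True[unfolded as]]
    have ab: "a + b \<noteq> 0" "a + b \<noteq> b" using c(2) a by (auto simp: fun_eq_iff pt)
    have "a + b - b = a" by (auto simp: fun_eq_iff pt)
    then show ?thesis using a True mp(1,2) ab c M
      by (simp add: as add.assoc del: status.simps) (simp)
  next
    case False
    then show ?thesis using Cons by (cases "status as") (auto simp: ups_def sp_OddUnits split: if_splits)
  qed
qed (simp add: ups_def)

lemma sp_props:
  assumes "downs \<tau>" "set \<tau> \<subseteq> M"
  shows "status (sp \<tau>) = (if status \<tau> = Down then Up else EvenUnits) \<and> mg (sp \<tau>) = \<tau> \<and> set (sp \<tau>) \<subseteq> M
    \<and> length (sp \<tau>) = Suc (length \<tau>) \<and> sum_list (sp \<tau>) = sum_list \<tau>"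
  using assms
proof (induction \<tau>)
  case (Cons a as)
  show ?case
  proof (cases "status as = Critical")
    case True
    show ?thesis
    proof (cases "a = 0")
      case True
      then show ?thesis using \<open>status as = Critical\<close> Cons(3) by simp
    next
      case False
      then obtain t where t: "piece a as = Some t" "a \<noteq> t" and st: "status (a # as) = Down"
        using Cons(2) True by (auto simp: downs_def split: option.splits if_splits)
      have M: "a \<in> M" "set as \<subseteq> M" using Cons(3) by auto
      note p = piece_self[OF M(1) False True M(2) t(1)] split_piece[OF M(1) False True M(2) t]
      have up: "status ((a - t) # t # as) = Up"
        using p(1) p(6) p(9) by (simp del: status.simps(2) add: status.simps(2)[of "a - t"])
      have "sp (a # as) = (a - t) # t # as" using False True t by simp
      moreover have "mg ((a - t) # t # as) = a # as" using p(1) p(8) by (simp del: status.simps)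
      ultimately show ?thesis using up st p M by (simp del: sp.simps mg.simps status.simps add: add.assoc[symmetric])
    qed
  next
    case False
    then show ?thesis using Cons by (cases "status as") (auto simp: downs_def split: if_splits)
  qed
qed (simp add: downs_def)

lemma unit_runs:
  "(status \<rho> = EvenUnits \<longrightarrow> (\<exists>k c. \<rho> = replicate k 0 @ c \<and> even k \<and> 0 < k \<and> status c = Critical
      \<and> mg \<rho> = replicate (k - 1) 0 @ c)) \<and>
   (status \<rho> = OddUnits \<longrightarrow> (\<exists>k c. \<rho> = replicate k 0 @ c \<and> odd k \<and> status c = Critical))"
proof (induction \<rho>)
  case (Cons a \<rho>)
  show ?case
  proof (intro conjI impI)
    assume e: "status (a # \<rho>) = EvenUnits"
    then have a: "a = 0" "status \<rho> = OddUnits" by (auto split: status.splits if_splits option.splits)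
    then obtain k c where k: "\<rho> = replicate k 0 @ c" "odd k" "status c = Critical" using Cons by auto
    show "\<exists>k c. a # \<rho> = replicate k 0 @ c \<and> even k \<and> 0 < k \<and> status c = Critical \<and> mg (a # \<rho>) = replicate (k - 1) 0 @ c"
      by (rule exI[of _ "Suc k"], rule exI[of _ c]) (use k a in auto)
  next
    assume e: "status (a # \<rho>) = OddUnits"
    then have a: "a = 0" "status \<rho> = EvenUnits \<or> status \<rho> = Critical" by (auto split: status.splits if_splits option.splits)
    then show "\<exists>k c. a # \<rho> = replicate k 0 @ c \<and> odd k \<and> status c = Critical"
    proof (elim disjE)
      assume "status \<rho> = EvenUnits"
      then obtain k c where k: "\<rho> = replicate k 0 @ c" "even k" "status c = Critical" using Cons by auto
      show ?thesis
        by (rule exI[of _ "Suc k"], rule exI[of _ c]) (use k a in auto)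
    next
      assume "status \<rho> = Critical"
      then show ?thesis using a by (intro exI[of _ 1] exI[of _ \<rho>]) auto
    qed
  qed
qed simp

text \<open>Counting faces needs two cases: a genuine merge, or an even run of units whose left
  neighbour, if any, is not a unit.\<close>

lemma ups_decomp:
  assumes "ups \<rho>"
  shows "(\<exists>A a b c. \<rho> = A @ a # b # c \<and> status (b # c) = Critical \<and> a \<noteq> 0 \<and> piece a (b # c) = None
      \<and> mg \<rho> = A @ (a + b) # c) \<or>
    (\<exists>A k c. \<rho> = A @ replicate k 0 @ c \<and> even k \<and> 0 < k \<and> status c = Critical \<and> (A \<noteq> [] \<longrightarrow> last A \<noteq> 0)
      \<and> status (replicate k 0 @ c) = EvenUnits \<and> mg \<rho> = A @ replicate (k - 1) 0 @ c)"
    (is "?P \<rho> \<or> ?Q \<rho>")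
    using assms
proof (induction \<rho>)
  case (Cons a as)
  show ?case
  proof (cases "status (a # as) = EvenUnits")
    case True
    then obtain k c where k: "a # as = replicate k 0 @ c" "even k" "0 < k" "status c = Critical"
        "mg (a # as) = replicate (k - 1) 0 @ c" using unit_runs[of "a # as"] by blast
    have "status (replicate k 0 @ c) = EvenUnits" by (simp only: k(1)[symmetric] True)
    then show ?thesis
      by (intro disjI2 exI[of _ "[]"] exI[of _ k] exI[of _ c]) (use k in \<open>simp del: mg.simps\<close>)
  next
    case False
    then have up: "status (a # as) = Up" using Cons(2) by (auto simp: ups_def)
    then consider "status as = Critical" | "status as = EvenUnits" "a \<noteq> 0" | "status as = Up"
      by (auto split: status.splits if_splits option.splits)
    then show ?thesis
    proof cases
      case 1
      then have a: "a \<noteq> 0" "piece a as = None"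
        using up by (auto split: if_splits option.splits)
      obtain b c where as: "as = b # c" using a by (cases as) (auto simp: piece_def)
      show ?thesis
        by (rule disjI1, rule exI[of _ "[]"], rule exI[of _ a], rule exI[of _ b], rule exI[of _ c])
          (use 1 a as in simp)
    next
      case 2
      then obtain k c where k: "as = replicate k 0 @ c" "even k" "0 < k" "status c = Critical"
        "mg as = replicate (k - 1) 0 @ c" using unit_runs[of as] by auto
      show ?thesis
        by (rule disjI2, rule exI[of _ "[a]"], rule exI[of _ k], rule exI[of _ c]) (use k 2 in auto)
    next
      case 3
      then have mg: "mg (a # as) = a # mg as" by simp
      have "ups as" using 3 by (simp add: ups_def)
      then consider "?P as" | "?Q as" using Cons(1) by blast
      then show ?thesis
      proof cases
        case 1
        then obtain A x b c where *: "as = A @ x # b # c" "status (b # c) = Critical" "x \<noteq> 0"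
          "piece x (b # c) = None" "mg as = A @ (x + b) # c" by blast
        show ?thesis
          by (rule disjI1, rule exI[of _ "a # A"], rule exI[of _ x], rule exI[of _ b], rule exI[of _ c])
            (use * mg in \<open>simp del: mg.simps status.simps\<close>)
      next
        case 2
        then obtain A k c where *: "as = A @ replicate k 0 @ c" "even k" "0 < k" "status c = Critical"
          "A \<noteq> [] \<longrightarrow> last A \<noteq> 0" "status (replicate k 0 @ c) = EvenUnits" "mg as = A @ replicate (k - 1) 0 @ c"
          by blast
        then have "A \<noteq> []" using 3 by auto
        then show ?thesis
          by (intro disjI2 exI[of _ "a # A"] exI[of _ k] exI[of _ c])
            (use * mg in \<open>simp del: mg.simps status.simps\<close>)
      qed
    qed
  qed
qed (simp add: ups_def)

text \<open>The number of pairs of letters that are not in normal order. Replacing two adjacent entries by their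
  product never increases the total \<open>bad\<close> of such pairs.\<close>
definition noninv :: "mon \<Rightarrow> mon \<Rightarrow> nat" where
  "noninv a b = (\<Sum>j<n. \<Sum>i<j. a i * b j)"

lemma noninv_add: "noninv (a + a') b = noninv a b + noninv a' b" "noninv a (b + b') = noninv a b + noninv a b'"
  by (simp_all add: noninv_def pt algebra_simps sum.distrib)

lemma noninv_0 [simp]: "noninv 0 b = 0" "noninv a 0 = 0"
  by (simp_all add: noninv_def pt)

lemma noninv_pos: "i < j \<Longrightarrow> j < n \<Longrightarrow> 0 < a i \<Longrightarrow> 0 < b j \<Longrightarrow> 0 < noninv a b"
  unfolding noninv_def by (rule sum_pos2[of _ j]) (auto intro!: sum_pos2[of _ i])

lemma noninv_pw: "p \<le> mi a \<Longrightarrow> noninv a (pw p s) = 0"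
  by (auto simp: noninv_def pw_apply below_mi)

fun bad :: "mon list \<Rightarrow> nat" where
  "bad [] = 0"
| "bad (a # as) = noninv a (sum_list as) + bad as"

lemma bad_merge: "bad (X @ u # v # Y) = bad (X @ (u + v) # Y) + noninv u v"
  by (induction X) (auto simp: noninv_add ac_simps)

lemma bad_snoc: "bad (as @ [a]) = bad as + noninv (sum_list as) a"
  by (induction as) (auto simp: noninv_add)

definition deg :: "mon list \<Rightarrow> nat" where
  "deg as = (\<Sum>i<n. sum_list as i)"

lemma deg_merge: "deg (X @ u # v # Y) = deg (X @ (u + v) # Y)"
  by (simp add: deg_def ac_simps)

lemma deg_snoc: "a \<in> M \<Longrightarrow> a \<noteq> 0 \<Longrightarrow> deg as < deg (as @ [a])"
  unfolding deg_def by (rule sum_strict_mono_ex1) (auto simp: pt intro!: bexI[of _ "mi a"] mi_pos mi_less)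

text \<open>Critical lists are closed under suffixes, so this is the length of the longest critical
  suffix.\<close>

fun suf :: "mon list \<Rightarrow> nat" where
  "suf [] = 0"
| "suf (a # as) = (if status (a # as) = Critical then Suc (suf as) else suf as)"

lemma suf_le: "suf as \<le> length as"
  by (induction as) (auto simp del: status.simps)

lemma suf_critical: "status as = Critical \<Longrightarrow> suf as = length as"
proof (induction as)
  case (Cons a as)
  then show ?case using critE(1)[OF Cons.prems] by (simp del: status.simps)
qed simp

lemma suf_app: "suf bs \<le> suf (as @ bs)"
  by (induction as) (auto simp del: status.simps)

lemma suf_noncritical: "status bs \<noteq> Critical \<Longrightarrow> suf (as @ bs) = suf bs"
proof (induction as)
  case (Cons a as)
  then show ?case using noncritical_app[of bs "a # as"] by (simp del: status.simps)
qed simp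

text \<open>A lexicographic order on lists of one length: the second summand is at most the length,
  hence the factor \<open>Suc (length as)\<close>. Compared with the partner, the right outer face
  lowers \<open>deg\<close>, a merge inside the critical suffix lowers \<open>bad\<close>, and a
  merge just before that suffix leaves a longer one.\<close>

definition mu :: "mon list \<Rightarrow> nat" where
  "mu as = Suc (length as) * (deg as + bad as) + (length as - suf as)"

lemma mu_less1: "length as = length bs \<Longrightarrow> deg as + bad as < deg bs + bad bs \<Longrightarrow> mu as < mu bs"
proof -
  assume l: "length as = length bs" and "deg as + bad as < deg bs + bad bs"
  then have "Suc (length bs) * Suc (deg as + bad as) \<le> Suc (length bs) * (deg bs + bad bs)"
    by (intro mult_le_mono2) simp
  then show ?thesis using l unfolding mu_def by simp
qed

lemma mu_less2: "length as = length bs \<Longrightarrow> deg as + bad as \<le> deg bs + bad bs \<Longrightarrow> suf bs < suf as \<Longrightarrow> mu as < mu bs"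
proof -
  assume l: "length as = length bs" and "deg as + bad as \<le> deg bs + bad bs" and s: "suf bs < suf as"
  then have "Suc (length bs) * (deg as + bad as) \<le> Suc (length bs) * (deg bs + bad bs)"
    by (intro mult_le_mono2) simp
  then show ?thesis using l s suf_le[of as] unfolding mu_def by (simp only: l)
qed

text \<open>Neighbours in a critical list form an obstruction. A power obstruction leaves the box,
  so a face inside a critical list comes from letters out of order.\<close>

lemma critical_adjacent:
  assumes "status (u # v # c) = Critical" "u \<in> M" "v \<in> M" "set c \<subseteq> M" "u + v \<in> M"
  shows "0 < noninv u v"
proof -
  note u = critE[OF assms(1)]
  note v = critE[OF u(1)]
  have p: "mi v < n" using v assms mi_less by blast
  have mp: "2 \<le> m (mi v)" using m2[OF p] .
  have uv: "u (mi v) + v (mi v) < m (mi v)" using M_less[OF assms(5) p] by (simp add: pt)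
  obtain s where s: "v = pw (mi v) s" "0 < s" "s = 1 \<or> s = m (mi v) - 1"
    using crit_hd[OF u(1) assms(3,4)] by auto
  have vs: "v (mi v) = s" by (subst s(1)) (simp add: pw_apply)
  consider "mi u < mi v" | "v (mi v) = 1" "u (mi v) = m (mi v) - 1" | "v (mi v) \<noteq> 1" "mi u = mi v"
    using u(3) unfolding piece_def list.case by (metis option.distinct(1))
  then show ?thesis
  proof cases
    case 1
    then show ?thesis using noninv_pos[of "mi u" "mi v" u v] p mi_pos[OF u(2)] mi_pos[OF v(2)] by simp
  next
    case 2
    then show ?thesis using uv mp by simp
  next
    case 3
    then have "s = m (mi v) - 1" using vs s by simp
    then show ?thesis using uv vs mi_pos[OF u(2)] 3 mp by simp
  qed
qed

lemma critical_merge: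
  assumes "status (X @ u # v # Y) = Critical" "set (X @ u # v # Y) \<subseteq> M" "u + v \<in> M"
  shows "0 < noninv u v"
  using critical_adjacent[OF critical_suffix[OF assms(1)]] assms by auto

section \<open>Faces of matched lists\<close>

lemma inn_no_faces:
  assumes "\<And>X u v Y. as = X @ u # v # Y \<Longrightarrow> u + v \<in> M \<Longrightarrow> z (X @ (u + v) # Y) = 0"
    and "z (butlast as) = 0"
  shows "inn z as = 0"
  using assms
proof (induction z as rule: inn.induct)
  case (3 z a b as)
  have "inn (\<lambda>bs. z (a # bs)) (b # as) = 0"
  proof (rule 3(1))
    fix X u v Y assume "b # as = X @ u # v # Y" "u + v \<in> M"
    then show "z (a # X @ (u + v) # Y) = 0" using 3(2)[of "a # X" u v Y] by simp
  qed (use 3(3) in simp)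
  moreover have "a + b \<in> M \<Longrightarrow> z ((a + b) # as) = 0" using 3(2)[of "[]" a b as] by simp
  ultimately show ?case by simp
qed auto

lemma inn_one_face:
  assumes "\<And>X u v Y. A = X @ u # v # Y \<Longrightarrow> u + v \<in> M \<Longrightarrow> z (X @ (u + v) # Y @ a # b # c) = 0"
    and "\<And>X u. A = X @ [u] \<Longrightarrow> u + a \<in> M \<Longrightarrow> z (X @ (u + a) # b # c) = 0"
    and "\<And>X u v Y. b # c = X @ u # v # Y \<Longrightarrow> u + v \<in> M \<Longrightarrow> z (A @ a # X @ (u + v) # Y) = 0"
    and "z (A @ a # butlast (b # c)) = 0"
    and "a + b \<in> M"
  shows "inn z (A @ a # b # c) = (-1) ^ Suc (length A) * z (A @ (a + b) # c)"
  using assms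
proof (induction A arbitrary: z)
  case Nil
  have "inn (\<lambda>bs. z (a # bs)) (b # c) = 0"
    by (rule inn_no_faces) (use Nil(3,4) in auto)
  then show ?case using Nil(5) by simp
next
  case (Cons x A)
  have IH: "inn (\<lambda>bs. z (x # bs)) (A @ a # b # c) = (-1) ^ Suc (length A) * z (x # A @ (a + b) # c)"
  proof (rule Cons.IH)
    fix X u v Y assume "A = X @ u # v # Y" "u + v \<in> M"
    then show "z (x # X @ (u + v) # Y @ a # b # c) = 0" using Cons.prems(1)[of "x # X" u v Y] by simp
  next
    fix X u assume "A = X @ [u]" "u + a \<in> M"
    then show "z (x # X @ (u + a) # b # c) = 0" using Cons.prems(2)[of "x # X" u] by simp
  next
    fix X u v Y assume "b # c = X @ u # v # Y" "u + v \<in> M"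
    then show "z (x # A @ a # X @ (u + v) # Y) = 0" using Cons.prems(3)[of X u v Y] by simp
  next
    show "z (x # A @ a # butlast (b # c)) = 0" using Cons.prems(4) by simp
  qed (rule Cons.prems(5))
  show ?case
  proof (cases A)
    case Nil
    then have "x + a \<in> M \<Longrightarrow> z ((x + a) # b # c) = 0" using Cons.prems(2)[of "[]" x] by simp
    then show ?thesis using IH Nil by simp
  next
    case (Cons y A')
    then have "x + y \<in> M \<Longrightarrow> z ((x + y) # A' @ a # b # c) = 0" using Cons.prems(1)[of "[]" x y A'] by simp
    then show ?thesis using IH Cons by simp
  qed
qed

text \<open>The merges of neighbouring units, and the merge of the last unit into \<open>c\<close>
  (the right outer face if \<open>c\<close> is empty), give \<open>k\<close> copies of one list with
  alternating signs.\<close>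

lemma inn_units:
  assumes "\<And>k X u v Y. c = X @ u # v # Y \<Longrightarrow> u + v \<in> M \<Longrightarrow> z (replicate k 0 @ X @ (u + v) # Y) = 0"
    and "\<And>k. c \<noteq> [] \<Longrightarrow> z (replicate k 0 @ butlast c) = 0"
    and "set c \<subseteq> M" "0 < k"
  shows "inn z (replicate k 0 @ c) = (if even k then 0 else - z (replicate (k - 1) 0 @ c))"
  using assms
proof (induction k arbitrary: z)
  case (Suc k)
  show ?case
  proof (cases "k = 0")
    case True
    show ?thesis
    proof (cases c)
      case Nil
      then show ?thesis using True by simp
    next
      case (Cons b c')
      have "inn (\<lambda>bs. z (0 # bs)) (b # c') = 0"
      proof (rule inn_no_faces)
        fix X u v Y assume "b # c' = X @ u # v # Y" "u + v \<in> M"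
        then show "z (0 # X @ (u + v) # Y) = 0" using Suc.prems(1)[of X u v Y 1] Cons by simp
      next
        show "z (0 # butlast (b # c')) = 0" using Suc.prems(2)[of 1] Cons by simp
      qed
      then show ?thesis using True Cons Suc.prems(3) by simp
    qed
  next
    case False
    then obtain l where l: "k = Suc l" by (cases k) auto
    have "inn (\<lambda>bs. z (0 # bs)) (replicate k 0 @ c) = (if even k then 0 else - z (0 # replicate (k - 1) 0 @ c))"
    proof (rule Suc.IH)
      fix k' X u v Y assume "c = X @ u # v # Y" "u + v \<in> M"
      then show "z (0 # replicate k' 0 @ X @ (u + v) # Y) = 0" using Suc.prems(1)[of X u v Y "Suc k'"] by simp
    next
      fix k' assume "c \<noteq> []"
      then show "z (0 # replicate k' 0 @ butlast c) = 0" using Suc.prems(2)[of "Suc k'"] by simp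
    qed (use Suc.prems False in auto)
    then show ?thesis by (simp add: l)
  qed
qed simp

text \<open>The entry before the run also absorbs a unit. This makes \<open>k + 1\<close> equal
  faces with alternating signs, and for even \<open>k\<close> one survives.\<close>

lemma inn_units_prefix:
  assumes "\<And>X u v Y. A = X @ u # v # Y \<Longrightarrow> u + v \<in> M \<Longrightarrow> z (X @ (u + v) # Y @ replicate k 0 @ c) = 0"
    and "\<And>k X u v Y. c = X @ u # v # Y \<Longrightarrow> u + v \<in> M \<Longrightarrow> z (A @ replicate k 0 @ X @ (u + v) # Y) = 0"
    and "\<And>k. c \<noteq> [] \<Longrightarrow> z (A @ replicate k 0 @ butlast c) = 0"
    and "set A \<subseteq> M" "set c \<subseteq> M" "0 < k" "even k" "A \<noteq> []"
  shows "inn z (A @ replicate k 0 @ c) = (-1) ^ length A * z (A @ replicate (k - 1) 0 @ c)"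
  using assms
proof (induction A arbitrary: z)
  case (Cons x A)
  obtain l where l: "k = Suc l" using Cons.prems by (cases k) auto
  show ?case
  proof (cases A)
    case Nil
    have "inn (\<lambda>bs. z (x # bs)) (replicate k 0 @ c) = (if even k then 0 else - z (x # replicate (k - 1) 0 @ c))"
      by (rule inn_units) (use Cons.prems Nil in auto)
    then show ?thesis using Nil Cons.prems by (simp add: l)
  next
    case (Cons y A')
    have "inn (\<lambda>bs. z (x # bs)) (A @ replicate k 0 @ c) = (-1) ^ length A * z (x # A @ replicate (k - 1) 0 @ c)"
    proof (rule Cons.IH)
      fix X u v Y assume "A = X @ u # v # Y" "u + v \<in> M"
      then show "z (x # X @ (u + v) # Y @ replicate k 0 @ c) = 0" using Cons.prems(1)[of "x # X" u v Y] by simp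
    next
      fix k' X u v Y assume "c = X @ u # v # Y" "u + v \<in> M"
      then show "z (x # A @ replicate k' 0 @ X @ (u + v) # Y) = 0" using Cons.prems(2)[of X u v Y k'] by simp
    next
      fix k' assume "c \<noteq> []"
      then show "z (x # A @ replicate k' 0 @ butlast c) = 0" using Cons.prems(3)[of k'] by simp
    qed (use Cons.prems Cons in auto)
    moreover have "x + y \<in> M \<Longrightarrow> z ((x + y) # A' @ replicate k 0 @ c) = 0"
      using Cons.prems(1)[of "[]" x y A'] Cons by simp
    ultimately show ?thesis using Cons by simp
  qed
qed simp

text \<open>The incidence of an up-list with its partner is a unit, and all its other down-faces have
  smaller measure: this makes the matching acyclic.\<close>
lemma matched_face:
  fixes L :: "mon \<Rightarrow> 'k::field"
  assumes up: "ups \<rho>" and M: "set \<rho> \<subseteq> M" and L0: "L 0 = 1"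
  obtains s where "s * s = 1"
    "\<And>z. (\<And>\<sigma>. set \<sigma> \<subseteq> M \<Longrightarrow> Suc (length \<sigma>) = length \<rho> \<Longrightarrow> \<not> downs \<sigma> \<or> mu \<sigma> < mu (mg \<rho>) \<Longrightarrow> z \<sigma> = 0)
      \<Longrightarrow> df L z \<rho> = s * z (mg \<rho>)"
  using ups_decomp[OF up]
proof (elim disjE exE conjE)
  fix A a b c
  assume \<rho>: "\<rho> = A @ a # b # c" and crit: "status (b # c) = Critical" and a: "a \<noteq> 0"
    and pc: "piece a (b # c) = None" and mg: "mg \<rho> = A @ (a + b) # c"
  have M': "a \<in> M" "b \<in> M" "set c \<subseteq> M" "set A \<subseteq> M" using M by (auto simp: \<rho>)
  note mp = merge_piece[OF crit M'(1-3) a pc]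
  have c: "status c = Critical" using critE[OF crit] by simp
  have inv0: "noninv a b = 0" using mp(3,6) noninv_pw by metis
  have "a + b \<noteq> 0" using a by (auto simp: fun_eq_iff pt)
  moreover have "a + b \<noteq> b" using a by (auto simp: fun_eq_iff pt)
  ultimately have "status ((a + b) # c) \<noteq> Critical" using c mp(2) by auto
  then have suf: "suf (mg \<rho>) = length c"
    using suf_noncritical[of "(a + b) # c" A] suf_critical[OF c] by (simp add: mg del: status.simps)
  have bad: "bad (mg \<rho>) = bad \<rho>" "deg (mg \<rho>) = deg \<rho>"
    using bad_merge[of A a b c] deg_merge[of A a b c] inv0
    unfolding mg unfolding \<rho> by simp_all
  have upc: "status (a # b # c) = Up" using crit a pc by simp
  have len: "length (mg \<rho>) = length A + length c + 1" by (simp add: mg)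
  show thesis
  proof (rule that)
    show "((-1) ^ Suc (length A)) * ((-1) ^ Suc (length A)) = (1::'k)"
      by (rule minus_one_mult_self)
  next
    fix z :: "mon list \<Rightarrow> 'k"
    assume z: "\<And>\<sigma>. set \<sigma> \<subseteq> M \<Longrightarrow> Suc (length \<sigma>) = length \<rho> \<Longrightarrow> \<not> downs \<sigma> \<or> mu \<sigma> < mu (mg \<rho>) \<Longrightarrow> z \<sigma> = 0"
    have zup: "z \<sigma> = 0" if "set \<sigma> \<subseteq> M" "Suc (length \<sigma>) = length \<rho>" "status \<sigma> = Up" for \<sigma>
      using z that by (auto simp: downs_def)
    have "inn z (A @ a # b # c) = (-1) ^ Suc (length A) * z (A @ (a + b) # c)"
    proof (rule inn_one_face)
      fix X u v Y assume *: "A = X @ u # v # Y" "u + v \<in> M"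
      show "z (X @ (u + v) # Y @ a # b # c) = 0"
        by (rule zup) (use * M' status_app_Up[OF upc, of "X @ (u + v) # Y"] in \<open>auto simp: \<rho> simp del: status.simps\<close>)
    next
      \<comment> \<open>This face keeps all of \<open>b # c\<close> as a critical suffix while the
        partner keeps only \<open>c\<close>; degree and inversions do not grow.\<close>
      fix X u assume *: "A = X @ [u]" "u + a \<in> M"
      have "Suc (length c) \<le> suf (X @ (u + a) # b # c)"
        using suf_app[of "b # c" "X @ [u + a]"] suf_critical[OF crit] by simp
      moreover have "bad (X @ (u + a) # b # c) \<le> bad \<rho>" "deg (X @ (u + a) # b # c) = deg \<rho>"
        using bad_merge[of X u a "b # c"] deg_merge[of X u a "b # c"] by (auto simp: \<rho> *)
      ultimately have "mu (X @ (u + a) # b # c) < mu (mg \<rho>)"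
        by (intro mu_less2) (use bad suf len * in auto)
      then show "z (X @ (u + a) # b # c) = 0"
        by (intro z) (use * M' in \<open>auto simp: \<rho>\<close>)
    next
      fix X u v Y assume *: "b # c = X @ u # v # Y" "u + v \<in> M"
      have "set (X @ u # v # Y) \<subseteq> M" using M'(2,3) *(1) by (metis insert_subset list.simps(15))
      then have "0 < noninv u v" using critical_merge[of X u v Y] crit * by simp
      then have "bad (A @ a # X @ (u + v) # Y) < bad \<rho>" "deg (A @ a # X @ (u + v) # Y) = deg \<rho>"
        using bad_merge[of "A @ a # X" u v Y] deg_merge[of "A @ a # X" u v Y] by (auto simp: \<rho> *)
      then have "mu (A @ a # X @ (u + v) # Y) < mu (mg \<rho>)"
        by (intro mu_less1) (use bad len arg_cong[OF *(1), of length] in auto)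
      then show "z (A @ a # X @ (u + v) # Y) = 0"
        by (intro z) (use * M' \<open>set (X @ u # v # Y) \<subseteq> M\<close> arg_cong[OF *(1), of length] in \<open>auto simp: \<rho>\<close>)
    next
      obtain Y y where Y: "b # c = Y @ [y]" by (metis list.distinct(1) rev_exhaust)
      have "set (b # c) \<subseteq> M" using M' by simp
      then have y: "y \<in> M" "y \<noteq> 0" "set Y \<subseteq> M"
        using critical_nonzero[OF crit, of y] unfolding Y by auto
      have "bad (A @ a # Y) \<le> bad \<rho>" "deg (A @ a # Y) < deg \<rho>"
        using bad_snoc[of "A @ a # Y" y] deg_snoc[OF y(1,2), of "A @ a # Y"] unfolding \<rho> Y by simp_all
      then have "mu (A @ a # Y) < mu (mg \<rho>)"
        by (intro mu_less1) (use bad len arg_cong[OF Y, of length] in auto)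
      then show "z (A @ a # butlast (b # c)) = 0" unfolding Y butlast_snoc
        by (intro z) (use y M' arg_cong[OF Y, of length] in \<open>auto simp: \<rho>\<close>)
    qed (rule mp(1))
    moreover have "z (tl \<rho>) = 0"
    proof (cases A)
      case Nil
      then show ?thesis by (intro z) (use M' crit not_both(3) in \<open>auto simp: \<rho> simp del: status.simps\<close>)
    next
      case (Cons x A')
      then show ?thesis
        by (intro zup) (use M' status_app_Up[OF upc, of A'] in \<open>auto simp: \<rho> simp del: status.simps\<close>)
    qed
    ultimately show "df L z \<rho> = (-1) ^ Suc (length A) * z (mg \<rho>)"
      by (simp add: df_def mg) (simp add: \<rho>)
  qed
next
  fix A k c
  assume \<rho>: "\<rho> = A @ replicate k 0 @ c" and k: "even k" "0 < k" and crit: "status c = Critical"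
    and A: "A \<noteq> [] \<longrightarrow> last A \<noteq> 0" and ev: "status (replicate k 0 @ c) = EvenUnits"
    and mg: "mg \<rho> = A @ replicate (k - 1) 0 @ c"
  have M': "set A \<subseteq> M" "set c \<subseteq> M" using M by (auto simp: \<rho>)
  obtain l where l: "k = Suc (Suc l)" using k by (cases k) (auto elim: oddE)
  have bad: "bad (mg \<rho>) = bad \<rho>" "deg (mg \<rho>) = deg \<rho>"
    using bad_merge[of A 0 0 "replicate l 0 @ c"] deg_merge[of A 0 0 "replicate l 0 @ c"]
    unfolding mg unfolding \<rho> l by simp_all
  have len: "length (mg \<rho>) = length A + k + length c - 1" using k by (simp add: mg)
  show thesis
  proof (rule that)
    show "((-1) ^ length A) * ((-1) ^ length A) = (1::'k)"
      by (rule minus_one_mult_self)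
  next
    fix z :: "mon list \<Rightarrow> 'k"
    assume z: "\<And>\<sigma>. set \<sigma> \<subseteq> M \<Longrightarrow> Suc (length \<sigma>) = length \<rho> \<Longrightarrow> \<not> downs \<sigma> \<or> mu \<sigma> < mu (mg \<rho>) \<Longrightarrow> z \<sigma> = 0"
    have zup: "z \<sigma> = 0" if "set \<sigma> \<subseteq> M" "Suc (length \<sigma>) = length \<rho>" "ups \<sigma>" for \<sigma>
      using z that not_both by auto
    \<comment> \<open>The lemmas on unit runs quantify over all run lengths. Setting
      \<open>z\<close> to zero at other list lengths leaves only the true run to check.\<close>
    define z' where "z' \<sigma> = (if Suc (length \<sigma>) = length \<rho> then z \<sigma> else 0)" for \<sigma>
    have zz': "inn z \<rho> = inn z' \<rho>" by (rule inn_cong) (simp add: z'_def)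
    have c1: "z' (A @ replicate k' 0 @ X @ (u + v) # Y) = 0" if *: "c = X @ u # v # Y" "u + v \<in> M" for k' X u v Y
    proof (cases "k' = k")
      case True
      have "0 < noninv u v" using critical_merge[of X u v Y] crit * M' by simp
      then have "bad (A @ replicate k 0 @ X @ (u + v) # Y) < bad \<rho>" "deg (A @ replicate k 0 @ X @ (u + v) # Y) = deg \<rho>"
        using bad_merge[of "A @ replicate k 0 @ X" u v Y] deg_merge[of "A @ replicate k 0 @ X" u v Y] by (auto simp: \<rho> *)
      then have "mu (A @ replicate k 0 @ X @ (u + v) # Y) < mu (mg \<rho>)"
        by (intro mu_less1) (use bad len * in auto)
      then have "z (A @ replicate k 0 @ X @ (u + v) # Y) = 0"
        by (intro z) (use * M' in \<open>auto simp: \<rho>\<close>)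
      then show ?thesis by (simp add: z'_def True)
    qed (use * in \<open>auto simp: z'_def \<rho>\<close>)
    have c2: "z' (A @ replicate k' 0 @ butlast c) = 0" if ne: "c \<noteq> []" for k'
    proof (cases "k' = k")
      case True
      obtain Y y where Y: "c = Y @ [y]" using ne by (cases c rule: rev_cases) auto
      have y: "y \<in> M" "y \<noteq> 0" "set Y \<subseteq> M"
        using critical_nonzero[OF crit, of y] M'(2) unfolding Y by auto
      have "bad (A @ replicate k 0 @ Y) \<le> bad \<rho>" "deg (A @ replicate k 0 @ Y) < deg \<rho>"
        using bad_snoc[of "A @ replicate k 0 @ Y" y] deg_snoc[OF y(1,2), of "A @ replicate k 0 @ Y"]
        unfolding \<rho> Y by simp_all
      then have "mu (A @ replicate k 0 @ Y) < mu (mg \<rho>)"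
        by (intro mu_less1) (use bad len Y in auto)
      then have "z (A @ replicate k 0 @ Y) = 0"
        by (intro z) (use y M' Y in \<open>auto simp: \<rho>\<close>)
      then show ?thesis by (simp add: z'_def True Y)
    qed (use ne in \<open>auto simp: z'_def \<rho> neq_Nil_conv\<close>)
    show "df L z \<rho> = (-1) ^ length A * z (mg \<rho>)"
    proof (cases "A = []")
      case True
      have "inn z' (replicate k 0 @ c) = (if even k then 0 else - z' (replicate (k - 1) 0 @ c))"
        by (rule inn_units) (use c1 c2 True M' k in auto)
      then have "inn z \<rho> = 0" using True k zz' by (simp add: \<rho>)
      \<comment> \<open>With nothing before the run the inner faces cancel, and the incidence is the
        left outer face with coefficient \<open>L 0 = 1\<close>.\<close>
      moreover have "L (hd \<rho>) * z (tl \<rho>) = z (mg \<rho>)"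
        unfolding mg unfolding \<rho> True l by (simp add: L0)
      ultimately show ?thesis using True by (simp add: df_def)
    next
      case False
      have "inn z' (A @ replicate k 0 @ c) = (-1) ^ length A * z' (A @ replicate (k - 1) 0 @ c)"
      proof (rule inn_units_prefix)
        fix X u v Y assume *: "A = X @ u # v # Y" "u + v \<in> M"
        have "last (X @ (u + v) # Y) \<noteq> 0"
          using A * by (cases "Y = []") (auto simp: fun_eq_iff pt)
        then have "ups ((X @ (u + v) # Y) @ replicate k 0 @ c)"
          using status_app_Even[OF ev] by blast
        then have "z (X @ (u + v) # Y @ replicate k 0 @ c) = 0"
          by (intro zup) (use * M' in \<open>auto simp: \<rho>\<close>)
        then show "z' (X @ (u + v) # Y @ replicate k 0 @ c) = 0" by (simp add: z'_def)
      qed (use c1 c2 M' k False in auto)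
      moreover have "z (tl \<rho>) = 0"
      proof -
        obtain x A' where x: "A = x # A'" using False by (cases A) auto
        show ?thesis
        proof (cases "A' = []")
          case True
          show ?thesis by (intro zup) (use M' ev x True in \<open>auto simp: \<rho> ups_def\<close>)
        next
          case False
          then have "ups (A' @ replicate k 0 @ c)" using status_app_Even[OF ev] A x by auto
          then show ?thesis by (intro zup) (use M' x in \<open>auto simp: \<rho>\<close>)
        qed
      qed
      ultimately show ?thesis using zz' by (simp add: df_def mg z'_def) (use k in \<open>simp add: \<rho>\<close>)
    qed
  qed
qed

section \<open>Solving equations along the matching\<close>

lemma finite_M [simp]: "finite M"
proof -
  have "M \<subseteq> {f. \<forall>i. (i \<in> {..<n} \<longrightarrow> f i \<in> {..<Max (insert 0 (m ` {..<n}))}) \<and> (i \<notin> {..<n} \<longrightarrow> f i = 0)}"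
    by (auto simp: Mon_def intro: less_le_trans)
  then show ?thesis by (rule finite_subset) (intro finite_set_of_finite_funs; simp)
qed

lemma cell_mg: "ups \<rho> \<Longrightarrow> cell \<delta> \<rho> \<Longrightarrow> cell \<delta> (mg \<rho>)"
  using mg_props[of \<rho>] by (auto simp: cell_def)

lemma cell_sp: "downs \<tau> \<Longrightarrow> cell \<delta> \<tau> \<Longrightarrow> cell \<delta> (sp \<tau>)"
  using sp_props[of \<tau>] by (auto simp: cell_def)

text \<open>A triangular system: ordered by the measure of the partner, each equation fixes one
  value of \<open>g\<close>, since the incidence is a unit and the other down-faces are
  smaller.\<close>

lemma ex_down_preimage:
  fixes L :: "mon \<Rightarrow> 'k::field"
  assumes L0: "L 0 = 1"
  obtains g where "supp_in \<delta> d g" "\<And>\<sigma>. g \<sigma> \<noteq> 0 \<Longrightarrow> downs \<sigma>"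
    "\<And>\<rho>. ups \<rho> \<Longrightarrow> cell \<delta> \<rho> \<Longrightarrow> length \<rho> = Suc d \<Longrightarrow> df L g \<rho> = z \<rho>"
proof -
  \<comment> \<open>\<open>ok\<close> packages the conclusion of \<open>matched_face\<close> for all
    cochains at once, so that one sign per list can be chosen.\<close>
  define ok where "ok \<rho> s \<longleftrightarrow> s * s = 1 \<and>
    (\<forall>z. (\<forall>\<sigma>. set \<sigma> \<subseteq> M \<longrightarrow> Suc (length \<sigma>) = length \<rho> \<longrightarrow> \<not> downs \<sigma> \<or> mu \<sigma> < mu (mg \<rho>) \<longrightarrow> z \<sigma> = 0)
      \<longrightarrow> df L z \<rho> = s * z (mg \<rho>))" for \<rho> s
  define sg where "sg \<rho> = (SOME s. ok \<rho> s)" for \<rho>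
  have sg: "ok \<rho> (sg \<rho>)" if \<rho>: "ups \<rho>" "set \<rho> \<subseteq> M" for \<rho>
  proof -
    have "\<exists>s. ok \<rho> s" unfolding ok_def by (rule matched_face[where L = L, OF \<rho> L0]) blast
    then show ?thesis unfolding sg_def by (rule someI_ex)
  qed
  have "\<exists>g. supp_in \<delta> d g \<and> (\<forall>\<sigma>. g \<sigma> \<noteq> 0 \<longrightarrow> downs \<sigma>) \<and>
    (\<forall>\<rho>. ups \<rho> \<longrightarrow> cell \<delta> \<rho> \<longrightarrow> length \<rho> = Suc d \<longrightarrow> mu (mg \<rho>) < N \<longrightarrow> df L g \<rho> = z \<rho>)" for N
  proof (induction N)
    case 0
    show ?case by (rule exI[of _ "\<lambda>_. 0"]) (simp add: supp_in_def)
  next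
    case (Suc N)
    then obtain g where g: "supp_in \<delta> d g" "\<And>\<sigma>. g \<sigma> \<noteq> 0 \<Longrightarrow> downs \<sigma>"
      "\<And>\<rho>. ups \<rho> \<Longrightarrow> cell \<delta> \<rho> \<Longrightarrow> length \<rho> = Suc d \<Longrightarrow> mu (mg \<rho>) < N \<Longrightarrow> df L g \<rho> = z \<rho>" by blast
    \<comment> \<open>The correction lives in measure \<open>N\<close> only, so the equations
      already solved, whose down-faces have smaller measure, do not see it.\<close>
    define h where "h \<sigma> = (if downs \<sigma> \<and> cell \<delta> \<sigma> \<and> length \<sigma> = d \<and> mu \<sigma> = N
      then sg (sp \<sigma>) * (z (sp \<sigma>) - df L g (sp \<sigma>)) else 0)" for \<sigma>
    define g' where "g' \<sigma> = 1 * g \<sigma> + h \<sigma>" for \<sigma>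
    have "df L g' \<rho> = z \<rho>" if \<rho>: "ups \<rho>" "cell \<delta> \<rho>" "length \<rho> = Suc d" "mu (mg \<rho>) < Suc N" for \<rho>
    proof -
      have M: "set \<rho> \<subseteq> M" using \<rho> by (simp add: cell_def)
      note mg = mg_props[OF \<rho>(1) M] and s = sg[OF \<rho>(1) M, unfolded ok_def]
      have dn: "downs (mg \<rho>)" using mg by (auto simp: downs_def split: if_splits)
      have "df L g' \<rho> = df L g \<rho> + df L h \<rho>" unfolding g'_def df_lin by simp
      also have "df L h \<rho> = sg \<rho> * h (mg \<rho>)"
        using s \<rho>(4) by (auto simp: h_def)
      also have "df L g \<rho> + sg \<rho> * h (mg \<rho>) = z \<rho>"
      proof (cases "mu (mg \<rho>) = N")
        case True
        then have "h (mg \<rho>) = sg \<rho> * (z \<rho> - df L g \<rho>)"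
          using dn mg cell_mg \<rho> by (simp add: h_def)
        moreover have "sg \<rho> * (sg \<rho> * x) = x" for x using s by (simp add: mult.assoc[symmetric])
        ultimately have "sg \<rho> * h (mg \<rho>) = z \<rho> - df L g \<rho>" by (simp only:)
        then show ?thesis by simp
      next
        case False
        then show ?thesis using g(3)[of \<rho>] \<rho> by (simp add: h_def)
      qed
      finally show ?thesis .
    qed
    moreover have "supp_in \<delta> d g'" "\<And>\<sigma>. g' \<sigma> \<noteq> 0 \<Longrightarrow> downs \<sigma>"
      using g(1,2) by (auto simp: supp_in_def g'_def h_def split: if_splits)
    ultimately show ?case by blast
  qed note ex = this
  define N where "N = Suc (Max (insert 0 (mu ` {\<sigma>. set \<sigma> \<subseteq> M \<and> length \<sigma> = d})))"
  have N: "mu \<sigma> < N" if "set \<sigma> \<subseteq> M" "length \<sigma> = d" for \<sigma>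
    unfolding N_def using that finite_lists_length_eq[OF finite_M, of d]
    by (intro le_imp_less_Suc Max_ge) auto
  obtain g where g: "supp_in \<delta> d g" "\<And>\<sigma>. g \<sigma> \<noteq> 0 \<Longrightarrow> downs \<sigma>"
    "\<And>\<rho>. ups \<rho> \<Longrightarrow> cell \<delta> \<rho> \<Longrightarrow> length \<rho> = Suc d \<Longrightarrow> mu (mg \<rho>) < N \<Longrightarrow> df L g \<rho> = z \<rho>"
    using ex[of N] by blast
  show thesis
  proof (rule that[OF g(1,2)])
    fix \<rho> assume "ups \<rho>" "cell \<delta> \<rho>" "length \<rho> = Suc d"
    then show "df L g \<rho> = z \<rho>"
      using g(3) N[of "mg \<rho>"] mg_props[of \<rho>] by (auto simp: cell_def)
  qed
qed

text \<open>Once \<open>y\<close> vanishes in smaller measure, the cocycle condition at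
  \<open>sp \<sigma>\<close> reduces to a unit times \<open>y \<sigma>\<close>.\<close>

lemma cocycle_eq_0:
  fixes L :: "mon \<Rightarrow> 'k::field"
  assumes L0: "L 0 = 1" and y: "cocyc \<delta> L d y" and nd: "\<And>\<sigma>. \<not> downs \<sigma> \<Longrightarrow> y \<sigma> = 0"
  shows "y \<sigma> = 0"
proof (induction "mu \<sigma>" arbitrary: \<sigma> rule: less_induct)
  case less
  show ?case
  proof (rule ccontr)
    assume nz: "y \<sigma> \<noteq> 0"
    then have \<sigma>: "downs \<sigma>" "cell \<delta> \<sigma>" "length \<sigma> = d"
      using nd y by (auto simp: cocyc_def supp_in_def)
    then have M: "set \<sigma> \<subseteq> M" by (simp add: cell_def)
    note sp = sp_props[OF \<sigma>(1) M]
    have up: "ups (sp \<sigma>)" using sp by (auto simp: ups_def split: if_splits)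
    obtain s where s: "s * s = (1::'k)"
      "\<And>z. (\<And>\<tau>. set \<tau> \<subseteq> M \<Longrightarrow> Suc (length \<tau>) = length (sp \<sigma>) \<Longrightarrow> \<not> downs \<tau> \<or> mu \<tau> < mu (mg (sp \<sigma>)) \<Longrightarrow> z \<tau> = 0)
      \<Longrightarrow> df L z (sp \<sigma>) = s * z (mg (sp \<sigma>))"
      using matched_face[where L = L, OF up _ L0] sp by metis
    have "df L y (sp \<sigma>) = s * y (mg (sp \<sigma>))"
      by (rule s(2)) (use nd less sp in auto)
    moreover have "df L y (sp \<sigma>) = 0"
    proof -
      have "dd \<delta> L d y (sp \<sigma>) = 0" using y by (simp add: cocyc_def)
      then show ?thesis using cell_sp[OF \<sigma>(1,2)] sp \<sigma>(3) by (simp add: dd_def)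
    qed
    ultimately show False using nz s(1) sp by auto
  qed
qed

lemma dd_diff: "dd \<delta> L d (\<lambda>as. z as - w as) as = dd \<delta> L d z as - dd \<delta> L d w as"
  unfolding dd_def[of _ _ _ _ as] by (simp add: df_diff)

lemma cocyc_sub_dd:
  assumes L: "\<And>a b. L (a + b) = L a * L b" and z: "cocyc \<delta> L (Suc d) z" and g: "supp_in \<delta> d g"
  shows "cocyc \<delta> L (Suc d) (\<lambda>as. z as - dd \<delta> L d g as)"
proof -
  have "dd \<delta> L (Suc d) (\<lambda>as. z as - dd \<delta> L d g as) as
      = dd \<delta> L (Suc d) z as - dd \<delta> L (Suc d) (dd \<delta> L d g) as" for as
    by (rule dd_diff)
  moreover have "supp_in \<delta> (Suc d) (\<lambda>as. z as - dd \<delta> L d g as)"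
    unfolding supp_in_def
  proof (intro allI impI)
    fix as assume "z as - dd \<delta> L d g as \<noteq> 0"
    then have "z as \<noteq> 0 \<or> dd \<delta> L d g as \<noteq> 0" by auto
    then show "cell \<delta> as \<and> length as = Suc d"
      using z supp_in_dd[of \<delta> d L g] unfolding supp_in_def cocyc_def by blast
  qed
  ultimately show ?thesis using z dd_dd[OF L g] by (auto simp: cocyc_def fun_eq_iff)
qed

text \<open>Correct \<open>z\<close> on up-lists by a cochain carried by down-lists. If the
  difference also vanishes on critical lists, it is a cocycle carried by down-lists, hence
  zero.\<close>

lemma coboundary_criterion:
  fixes L :: "mon \<Rightarrow> 'k::field"
  assumes L: "\<And>a b. L (a + b) = L a * L b" "L 0 = 1" and z: "cocyc \<delta> L (Suc d) z"
    and crit: "\<And>g \<sigma>. supp_in \<delta> d g \<Longrightarrow> (\<And>\<tau>. g \<tau> \<noteq> 0 \<Longrightarrow> downs \<tau>) \<Longrightarrow>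
      (\<And>\<tau>. ups \<tau> \<Longrightarrow> z \<tau> = dd \<delta> L d g \<tau>) \<Longrightarrow> status \<sigma> = Critical \<Longrightarrow> cell \<delta> \<sigma> \<Longrightarrow> length \<sigma> = Suc d \<Longrightarrow>
      z \<sigma> = dd \<delta> L d g \<sigma>"
  obtains g where "supp_in \<delta> d g" "z = dd \<delta> L d g"
proof -
  obtain g where g: "supp_in \<delta> d g" "\<And>\<sigma>. g \<sigma> \<noteq> 0 \<Longrightarrow> downs \<sigma>"
    "\<And>\<rho>. ups \<rho> \<Longrightarrow> cell \<delta> \<rho> \<Longrightarrow> length \<rho> = Suc d \<Longrightarrow> df L g \<rho> = z \<rho>"
    using ex_down_preimage[where L = L, OF L(2), of \<delta> d z] by metis
  have zs: "z \<tau> = 0" if "\<not> (cell \<delta> \<tau> \<and> length \<tau> = Suc d)" for \<tau>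
    using z that by (auto simp: cocyc_def supp_in_def)
  have up: "z \<tau> = dd \<delta> L d g \<tau>" if "ups \<tau>" for \<tau>
    using g(3)[OF that] zs by (auto simp: dd_def)
  have cr: "z \<sigma> = dd \<delta> L d g \<sigma>" if "status \<sigma> = Critical" for \<sigma>
    using crit[OF g(1,2) up that] zs by (auto simp: dd_def)
  have "z \<sigma> - dd \<delta> L d g \<sigma> = 0" for \<sigma>
    by (rule cocycle_eq_0[OF L(2) cocyc_sub_dd[OF L(1) z g(1)]]) (use up cr status_cases in auto)
  then have "z = dd \<delta> L d g" by (simp add: fun_eq_iff)
  then show thesis using that g(1) by blast
qed

end

subsection \<open>The minimal resolution\<close>

lemma antisym_double_sum:
  fixes A :: "nat \<Rightarrow> nat \<Rightarrow> 'a::comm_ring"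
  assumes "\<And>i. i < n \<Longrightarrow> A i i = 0" "\<And>i k. i < n \<Longrightarrow> k < n \<Longrightarrow> i \<noteq> k \<Longrightarrow> A i k = - A k i"
  shows "(\<Sum>i<n. \<Sum>k<n. A i k) = 0"
  using assms
proof (induction n)
  case 0
  show ?case by simp
next
  case (Suc n)
  have "(\<Sum>k<n. A n k) = (\<Sum>k<n. - A k n)"
    by (rule sum.cong) (simp_all only: lessThan_iff, rule Suc.prems(2), simp_all)
  moreover have "(\<Sum>i<n. \<Sum>k<n. A i k) = 0"
    by (rule Suc.IH; rule Suc.prems; simp)
  moreover have "A n n = 0" by (rule Suc.prems) simp
  ultimately show ?case by (simp add: sum.distrib sum_negf)
qed

text \<open>One more letter times the truncated norm: exponents shift by one and the term reaching
  \<open>x^m\<close> drops out.\<close>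

lemma sum_shifted:
  fixes Z :: "nat \<Rightarrow> 'a::ab_group_add"
  assumes "2 \<le> m"
  shows "(\<Sum>j\<in>{1..<m}. if j + 1 < m then Z (j + 1) else 0) = (\<Sum>j\<in>{1..<m}. Z j) - Z 1"
proof -
  obtain k where m: "m = Suc k" "1 \<le> k" using assms by (cases m) auto
  have "(\<Sum>j\<in>{1..<Suc k}. if j + 1 < m then Z (j + 1) else 0) = (\<Sum>j\<in>{1..<k}. if j + 1 < m then Z (j + 1) else 0)"
    using m by (subst sum.atLeastLessThan_Suc) auto
  also have "\<dots> = (\<Sum>j\<in>{1..<k}. Z (Suc j))"
    by (rule sum.cong) (auto simp: m)
  also have "\<dots> = (\<Sum>j\<in>{Suc 1..<Suc k}. Z j)"
    by (rule sum.shift_bounds_Suc_ivl[symmetric])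
  also have "\<dots> = (\<Sum>j\<in>{1..<Suc k}. Z j) - Z 1"
    using m by (subst (2) sum.atLeast_Suc_lessThan) auto
  finally show ?thesis by (simp add: m)
qed

definition dn :: "mon \<Rightarrow> nat \<Rightarrow> mon" where
  "dn f i = f(i := f i - 1)"

lemma dn_apply: "dn f i k = (if k = i then f i - 1 else f k)"
  by (simp add: dn_def)

lemma dn_commute: "dn (dn f i) k = dn (dn f k) i"
  by (auto simp: dn_def fun_eq_iff)

definition eps :: "mon \<Rightarrow> nat \<Rightarrow> 'k::field" where
  "eps f i = (-1) ^ (\<Sum>k<i. f k)"

lemma sum_dn: "i \<in> A \<Longrightarrow> finite A \<Longrightarrow> 0 < f i \<Longrightarrow> Suc (\<Sum>k\<in>A. dn f i k) = (\<Sum>k\<in>A. f k)"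
proof -
  assume i: "i \<in> A" "finite A" "0 < f i"
  have "(\<Sum>k\<in>A - {i}. dn f i k) = (\<Sum>k\<in>A - {i}. f k)" by (rule sum.cong) (auto simp: dn_apply)
  moreover have "(\<Sum>k\<in>A. f k) = f i + (\<Sum>k\<in>A - {i}. f k)" using i by (intro sum.remove) auto
  moreover have "(\<Sum>k\<in>A. dn f i k) = dn f i i + (\<Sum>k\<in>A - {i}. dn f i k)" using i by (intro sum.remove) auto
  moreover have "dn f i i = f i - 1" by (simp add: dn_apply)
  ultimately show ?thesis using i(3) by linarith
qed

lemma eps_dn: "0 < f k \<Longrightarrow> eps (dn f k) i = (if k < i then - eps f i else eps f i)"
proof (cases "k < i")
  case True
  assume "0 < f k"
  then have "(\<Sum>l<i. f l) = Suc (\<Sum>l<i. dn f k l)" using sum_dn[of k "{..<i}" f] True by simp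
  then show ?thesis using True unfolding eps_def by (simp only: if_True power_Suc) simp
next
  case False
  then have "(\<Sum>l<i. dn f k l) = (\<Sum>l<i. f l)" by (intro sum.cong) (auto simp: dn_apply)
  then show ?thesis using False unfolding eps_def by (simp only: if_False)
qed

lemma eps_sq: "eps f i * (eps f i * x) = (x :: 'k::field)"
  unfolding eps_def mult.assoc[symmetric] minus_one_mult_self by simp

text \<open>Zero where \<open>dn\<close> would lower a zero entry, so that sums may run over all
  directions.\<close>

definition ew :: "mon \<Rightarrow> nat \<Rightarrow> 'k::field" where
  "ew f i = (if f i = 0 then 0 else eps f i)"

lemma weighted_sum_lin:
  fixes w :: "'i \<Rightarrow> 'k::comm_ring"
  shows "(\<Sum>k\<in>K. w k * (\<Sum>l\<in>A k. c * a k l - b k l + e k l))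
    = c * (\<Sum>k\<in>K. w k * (\<Sum>l\<in>A k. a k l)) - (\<Sum>k\<in>K. w k * (\<Sum>l\<in>A k. b k l)) + (\<Sum>k\<in>K. w k * (\<Sum>l\<in>A k. e k l))"
proof -
  have "w k * (\<Sum>l\<in>A k. c * a k l - b k l + e k l) =
    c * (w k * (\<Sum>l\<in>A k. a k l)) - w k * (\<Sum>l\<in>A k. b k l) + w k * (\<Sum>l\<in>A k. e k l)" for k
  proof -
    have *: "(\<Sum>l\<in>A k. c * a k l - b k l + e k l) = c * (\<Sum>l\<in>A k. a k l) - (\<Sum>l\<in>A k. b k l) + (\<Sum>l\<in>A k. e k l)"
      by (simp only: sum.distrib sum_subtractf sum_distrib_left)
    show ?thesis unfolding * by (simp only: algebra_simps)
  qed
  then show ?thesis by (simp add: sum.distrib sum_subtractf sum_distrib_left)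
qed

lemma weighted_sum_swap:
  fixes w :: "'i \<Rightarrow> 'k::comm_ring"
  shows "t * (\<Sum>k\<in>K. w k * P k) + (\<Sum>j\<in>A. \<Sum>k\<in>K. w k * R j k) = (\<Sum>k\<in>K. w k * (t * P k + (\<Sum>j\<in>A. R j k)))"
proof -
  have "w k * (t * P k + (\<Sum>j\<in>A. R j k)) = t * (w k * P k) + (\<Sum>j\<in>A. w k * R j k)" for k
    by (simp only: sum_distrib_left[symmetric] distrib_left mult.left_commute)
  then have "(\<Sum>k\<in>K. w k * (t * P k + (\<Sum>j\<in>A. R j k))) = t * (\<Sum>k\<in>K. w k * P k) + (\<Sum>k\<in>K. \<Sum>j\<in>A. w k * R j k)"
    by (simp add: sum.distrib sum_distrib_left)
  also have "(\<Sum>k\<in>K. \<Sum>j\<in>A. w k * R j k) = (\<Sum>j\<in>A. \<Sum>k\<in>K. w k * R j k)" by (rule sum.swap)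
  finally show ?thesis ..
qed

lemma sum_exchange:
  fixes s t :: "'k::comm_ring"
  shows "t * (\<Sum>l\<in>B. y l) + (\<Sum>j\<in>A. s * x j - (\<Sum>l\<in>B. r j l)) = s * (\<Sum>j\<in>A. x j) + (\<Sum>l\<in>B. t * y l - (\<Sum>j\<in>A. r j l))"
proof -
  have "(\<Sum>j\<in>A. \<Sum>l\<in>B. r j l) = (\<Sum>l\<in>B. \<Sum>j\<in>A. r j l)" by (rule sum.swap)
  then show ?thesis by (simp add: sum_subtractf sum_distrib_left)
qed

context exponent_box
begin

text \<open>The minimal bimodule resolution has one generator \<open>e\<^sub>f\<close> for each \<open>f\<close>, of multidegree \<open>phi f\<close>. In
  direction \<open>i\<close> its differential is a commutator with \<open>x\<^sub>i\<close> if \<open>f i\<close> is odd and a norm if \<open>f i\<close> is even;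
  on cochains it becomes multiplication by \<open>kap\<close>. \<open>J\<close> is composition with the chain map to the bar
  resolution that the contraction \<open>a[b|...] \<mapsto> [a|b|...]\<close> defines recursively; \<open>exps\<close> lists the left
  factors which it puts in front, and \<open>eps\<close> is the Koszul sign.\<close>
definition exps :: "nat \<Rightarrow> nat \<Rightarrow> nat set" where
  "exps i e = (if odd e then {1} else {1..<m i})"

definition tot :: "mon \<Rightarrow> nat" where
  "tot f = (\<Sum>i<n. f i)"

definition phi :: "mon \<Rightarrow> mon" where
  "phi f = (\<lambda>i. if i < n then (f i div 2) * m i + f i mod 2 else 0)"

definition kap :: "(mon \<Rightarrow> 'k::field) \<Rightarrow> nat \<Rightarrow> nat \<Rightarrow> 'k" where
  "kap L i e = (if odd e then L (pw i 1) - 1 else (\<Sum>j<m i. L (pw i 1) ^ j))"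

primrec J :: "nat \<Rightarrow> (mon list \<Rightarrow> 'k::field) \<Rightarrow> mon \<Rightarrow> 'k" where
  "J 0 z f = z []"
| "J (Suc d) z f = (\<Sum>i<n.
     ew f i * (\<Sum>j\<in>exps i (f i). J d (\<lambda>as. z (pw i j # as)) (dn f i)))"

lemma tot_dn: "i < n \<Longrightarrow> 0 < f i \<Longrightarrow> Suc (tot (dn f i)) = tot f"
  unfolding tot_def by (rule sum_dn) auto

lemma J_lin: "J d (\<lambda>as. c * z as + w as) f = c * J d z f + J d w f"
proof (induction d arbitrary: z w f)
  case (Suc d)
  show ?case
    unfolding J.simps Suc.IH using weighted_sum_lin[where b = "\<lambda>_ _. 0"] by simp
qed simp

lemma J_0 [simp]: "J d (\<lambda>_. 0) f = 0"
  by (induction d arbitrary: f) auto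

lemma J_cmult: "J d (\<lambda>as. c * z as) f = c * J d z f"
  using J_lin[of d c z "\<lambda>_. 0" f] by simp

lemma J_add: "J d (\<lambda>as. z as + w as) f = J d z f + J d w f"
  using J_lin[of d 1 z w f] by simp

lemma J_diff: "J d (\<lambda>as. z as - w as) f = J d z f - J d w f"
  using J_lin[of d "-1" w z f] by simp

lemma J_sum: "finite S \<Longrightarrow> J d (\<lambda>as. \<Sum>s\<in>S. z s as) f = (\<Sum>s\<in>S. J d (z s) f)"
  by (induction S rule: finite_induct) (auto simp: J_add)

lemma L_pw:
  assumes L: "\<And>a b. L (a + b) = L a * L b" "L 0 = 1"
  shows "L (pw i j) = L (pw i 1) ^ j"
proof (induction j)
  case 0
  have "pw i 0 = 0" by simp
  show ?case unfolding \<open>pw i 0 = 0\<close> using L by simp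
next
  case (Suc j)
  have "pw i (Suc j) = pw i 1 + pw i j" by (simp add: pw_add)
  then show ?case using Suc L by simp
qed

text \<open>The left factors in \<open>exps\<close> omit the constant term of \<open>kap\<close>,
  which is the \<open>- 1\<close> of the commutator or the \<open>1\<close> of the norm.\<close>

lemma sum_exps:
  assumes L: "\<And>a b. L (a + b) = L a * L b" "L 0 = 1" and "i < n"
  shows "(\<Sum>j\<in>exps i e. L (pw i j)) = kap L i e + (if odd e then 1 else - 1)"
proof (cases "odd e")
  case False
  have "{..<m i} = insert 0 {1..<m i}" using m_pos[OF assms(3)] by auto
  then have "(\<Sum>j<m i. L (pw i 1) ^ j) = 1 + (\<Sum>j\<in>{1..<m i}. L (pw i 1) ^ j)" by simp
  moreover have "(\<Sum>j\<in>{1..<m i}. L (pw i j)) = (\<Sum>j\<in>{1..<m i}. L (pw i 1) ^ j)"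
    by (rule sum.cong[OF refl]) (rule L_pw[OF L])
  ultimately show ?thesis using False by (simp add: exps_def kap_def)
qed (simp add: exps_def kap_def)

lemma pw_add_in_M: "i < n \<Longrightarrow> pw i j + pw i l \<in> M \<longleftrightarrow> j + l < m i"
  using M_less[of "pw i (j + l)" i] pw_in_M[of i "j + l"] by (auto simp: pw_add pw_apply)

text \<open>The differential of the tail contains the left face of the tail, which does not occur in
  the whole list; it is taken back and replaced by the merge with \<open>a\<close>.\<close>

lemma J_df_Cons:
  fixes L :: "mon \<Rightarrow> 'k::field"
  shows "J (Suc d) (\<lambda>as. df L z (a # as)) g = L a * J (Suc d) z g - J (Suc d) (df L (\<lambda>as. z (a # as))) g
    + (\<Sum>k<n. ew g k * (\<Sum>l\<in>exps k (g k).
        L (pw k l) * J d (\<lambda>as. z (a # as)) (dn g k)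
        - (if a + pw k l \<in> M then J d (\<lambda>as. z ((a + pw k l) # as)) (dn g k) else 0)))"
proof -
  have *: "J d (\<lambda>as. df L z (a # b # as)) h = L a * J d (\<lambda>as. z (b # as)) h - J d (\<lambda>as. df L (\<lambda>as. z (a # as)) (b # as)) h
      + (L b * J d (\<lambda>as. z (a # as)) h - (if a + b \<in> M then J d (\<lambda>as. z ((a + b) # as)) h else 0))" for b h
  proof -
    have "J d (\<lambda>as. df L z (a # b # as)) h = J d (\<lambda>as. L a * z (b # as) - df L (\<lambda>as. z (a # as)) (b # as)
      + (L b * z (a # as) - (if a + b \<in> M then z ((a + b) # as) else 0))) h"
      by (rule arg_cong[where f = "\<lambda>z. J d z h"]) (auto simp: df_def fun_eq_iff)
    also have "\<dots> = L a * J d (\<lambda>as. z (b # as)) h - J d (\<lambda>as. df L (\<lambda>as. z (a # as)) (b # as)) h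
      + (L b * J d (\<lambda>as. z (a # as)) h - J d (\<lambda>as. if a + b \<in> M then z ((a + b) # as) else 0) h)"
      by (simp only: J_add J_diff J_cmult)
    finally show ?thesis by simp
  qed
  show ?thesis
    unfolding J.simps * by (rule weighted_sum_lin)
qed

text \<open>The chain map property. Beyond the terms with \<open>kap\<close>, every term has two
  directions lowered. Swapping different directions reverses the Koszul sign; lowering one direction
  twice telescopes, as commutator and norm multiply to zero.\<close>

lemma J_df:
  fixes L :: "mon \<Rightarrow> 'k::field"
  assumes L: "\<And>a b. L (a + b) = L a * L b" "L 0 = 1" and f: "tot f = Suc d"
  shows "J (Suc d) (df L z) f = (\<Sum>i<n. ew f i * (kap L i (f i) * J d z (dn f i)))"
  using f
proof (induction d arbitrary: z f)
  case 0
  have 1: "f i = 1" if "i < n" "f i \<noteq> 0" for i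
    using 0 member_le_sum[of i "{..<n}" f] that by (auto simp: tot_def)
  show ?case unfolding J.simps
  proof (rule sum.cong)
    fix i assume "i \<in> {..<n}"
    then show "ew f i * (\<Sum>j\<in>exps i (f i). df L z [pw i j]) = ew f i * (kap L i (f i) * z [])"
      using 1[of i] by (cases "f i = 0") (simp_all add: ew_def exps_def kap_def df_def left_diff_distrib)
  qed simp
next
  case (Suc d)
  \<comment> \<open>The constant by which the sum over \<open>exps\<close> exceeds
    \<open>kap\<close>.\<close>
  define tau :: "nat \<Rightarrow> 'k" where "tau e = (if odd e then 1 else - 1)" for e
  define Z where "Z a i k = J d (\<lambda>as. z (a # as)) (dn (dn f i) k)" for a i k
  define R where "R i k a = tau (dn f i k) * Z a i k
    - (\<Sum>l\<in>exps k (dn f i k). if a + pw k l \<in> M then Z (a + pw k l) i k else 0)" for i k a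
  define Q where "Q i k = tau (f i) * (\<Sum>l\<in>exps k (dn f i k). Z (pw k l) i k)
    + (\<Sum>j\<in>exps i (f i). R i k (pw i j))" for i k
  define X where "X i = J (Suc d) z (dn f i)" for i
  have inner: "J (Suc d) (\<lambda>as. df L z (a # as)) (dn f i) = L a * X i + (\<Sum>k<n. ew (dn f i) k * R i k a)"
    if i: "i < n" "f i \<noteq> 0" for a i
  proof -
    have "tot (dn f i) = Suc d" using tot_dn[of i f] i Suc.prems by simp
    note IH = Suc.IH[OF this, of "\<lambda>as. z (a # as)"]
    have *: "(\<Sum>l\<in>exps k (dn f i k). L (pw k l) * Z a i k - (if a + pw k l \<in> M then Z (a + pw k l) i k else 0))
      = kap L k (dn f i k) * Z a i k + R i k a" if "k < n" for k
      unfolding R_def using sum_exps[OF L that, of "dn f i k"]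
      by (simp add: sum_subtractf sum_distrib_right[symmetric] tau_def distrib_right left_diff_distrib)
    have "(\<Sum>k<n. ew (dn f i) k * (\<Sum>l\<in>exps k (dn f i k). L (pw k l) * Z a i k
          - (if a + pw k l \<in> M then Z (a + pw k l) i k else 0)))
      = (\<Sum>k<n. ew (dn f i) k * (kap L k (dn f i k) * Z a i k)) + (\<Sum>k<n. ew (dn f i) k * R i k a)"
      unfolding sum.distrib[symmetric] by (rule sum.cong) (simp_all add: * distrib_left)
    then show ?thesis
      unfolding J_df_Cons IH Z_def[symmetric] X_def[symmetric] by simp
  qed
  have outer: "(\<Sum>j\<in>exps i (f i). J (Suc d) (\<lambda>as. df L z (pw i j # as)) (dn f i)) - kap L i (f i) * X i
     = (\<Sum>k<n. ew (dn f i) k * Q i k)" if i: "i < n" "f i \<noteq> 0" for i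
  proof -
    have "(\<Sum>j\<in>exps i (f i). J (Suc d) (\<lambda>as. df L z (pw i j # as)) (dn f i)) - kap L i (f i) * X i
      = tau (f i) * X i + (\<Sum>j\<in>exps i (f i). \<Sum>k<n. ew (dn f i) k * R i k (pw i j))"
      unfolding inner[OF i] using sum_exps[OF L i(1), of "f i"]
      by (simp add: sum.distrib sum_distrib_right[symmetric] tau_def distrib_right left_diff_distrib)
    also have "\<dots> = (\<Sum>k<n. ew (dn f i) k * Q i k)"
    proof -
      have X: "X i = (\<Sum>k<n. ew (dn f i) k * (\<Sum>l\<in>exps k (dn f i k). Z (pw k l) i k))"
        unfolding X_def J.simps Z_def ..
      show ?thesis unfolding X Q_def weighted_sum_swap ..
    qed
    finally show ?thesis .
  qed
  have "J (Suc (Suc d)) (df L z) f - (\<Sum>i<n. ew f i * (kap L i (f i) * X i))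
    = (\<Sum>i<n. ew f i * (\<Sum>k<n. ew (dn f i) k * Q i k))"
    unfolding J.simps(2)[of "Suc d"] sum_subtractf[symmetric] right_diff_distrib[symmetric]
  proof (rule sum.cong)
    fix i assume "i \<in> {..<n}"
    then show "ew f i * ((\<Sum>j\<in>exps i (f i). J (Suc d) (\<lambda>as. df L z (pw i j # as)) (dn f i)) - kap L i (f i) * X i)
      = ew f i * (\<Sum>k<n. ew (dn f i) k * Q i k)"
      using outer[of i] by (cases "f i = 0") (simp_all add: ew_def[of f] del: J.simps)
  qed simp
  also have "\<dots> = (\<Sum>i<n. \<Sum>k<n. ew f i * ew (dn f i) k * Q i k)"
    by (simp add: sum_distrib_left mult.assoc)
  also have "\<dots> = 0"
  proof (rule antisym_double_sum)
    fix i assume i: "i < n"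
    show "ew f i * ew (dn f i) i * Q i i = 0"
    proof (cases "f i \<le> 1")
      case False
      then have par: "odd (f i - 1) \<longleftrightarrow> even (f i)" by auto
      note tele = sum_shifted[OF m2[OF i], of "\<lambda>s. Z (pw i s) i i"]
      have tele': "(\<Sum>j\<in>{1..<m i}. if 1 + j < m i then Z (pw i (1 + j)) i i else 0)
        = (\<Sum>j\<in>{1..<m i}. Z (pw i j) i i) - Z (pw i 1) i i"
        using tele by (simp only: add.commute[of _ 1])
      have "Q i i = 0"
      proof (cases "even (f i)")
        case True
        then have e: "exps i (dn f i i) = {1}" "exps i (f i) = {1..<m i}" "tau (f i) = - 1" "tau (dn f i i) = 1"
          using par by (simp_all add: exps_def tau_def dn_apply)
        have R: "R i i (pw i j) = Z (pw i j) i i - (if j + 1 < m i then Z (pw i (j + 1)) i i else 0)" for j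
          unfolding R_def e unfolding pw_add_in_M[OF i] unfolding pw_add by simp
        show ?thesis unfolding Q_def e R sum_subtractf tele by simp
      next
        case False
        then have e: "exps i (dn f i i) = {1..<m i}" "exps i (f i) = {1}" "tau (f i) = 1" "tau (dn f i i) = - 1"
          using par by (simp_all add: exps_def tau_def dn_apply)
        have R: "R i i (pw i 1) = - Z (pw i 1) i i - ((\<Sum>j\<in>{1..<m i}. Z (pw i j) i i) - Z (pw i 1) i i)"
          unfolding R_def e unfolding pw_add_in_M[OF i] unfolding pw_add tele' by simp
        have "Q i i = (\<Sum>j\<in>{1..<m i}. Z (pw i j) i i) + R i i (pw i 1)"
          unfolding Q_def e by simp
        then show ?thesis unfolding R by simp
      qed
      then show ?thesis by simp
    qed (auto simp: ew_def dn_apply)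
  next
    fix i k assume ik: "i < n" "k < n" "i \<noteq> k"
    have Zs: "Z a i k = Z a k i" for a by (simp add: Z_def dn_commute)
    have f: "dn f i k = f k" "dn f k i = f i" using ik by (auto simp: dn_apply)
    have "Q i k = Q k i"
      unfolding Q_def R_def f sum_exchange[of "tau (f i)"] Zs add.commute[of "pw k _"] ..
    moreover have "ew f i * ew (dn f i) k = - (ew f k * ew (dn f k) i :: 'k)"
      using ik by (auto simp: ew_def f eps_dn)
    ultimately show "ew f i * ew (dn f i) k * Q i k = - (ew f k * ew (dn f k) i * Q k i)" by simp
  qed
  finally show ?case by (simp add: X_def)
qed

text \<open>The word \<open>crt d f\<close> is the only critical list that occurs in the image of \<open>e\<^sub>f\<close> under the chain map;
  all others are \<open>Up\<close>.\<close>
definition top_exp :: "nat \<Rightarrow> nat \<Rightarrow> nat" where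
  "top_exp i e = (if odd e then 1 else m i - 1)"

primrec crt :: "nat \<Rightarrow> mon \<Rightarrow> mon list" where
  "crt 0 f = []"
| "crt (Suc d) f = pw (mi f) (top_exp (mi f) (f (mi f))) # crt d (dn f (mi f))"

definition fs :: "nat \<Rightarrow> mon set" where
  "fs d = {f. tot f = d \<and> (\<forall>i\<ge>n. f i = 0)}"

lemma dn_fs: "f \<in> fs (Suc d) \<Longrightarrow> i < n \<Longrightarrow> 0 < f i \<Longrightarrow> dn f i \<in> fs d"
  using tot_dn[of i f] by (auto simp: fs_def dn_apply)

lemma fs_0: "f \<in> fs 0 \<longleftrightarrow> f = 0"
proof -
  have "f = 0" if "f \<in> fs 0"
  proof
    fix i show "f i = 0 i" using that by (cases "i < n") (auto simp: fs_def tot_def pt)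
  qed
  then show ?thesis by (auto simp: fs_def tot_def pt)
qed

lemma fs_Suc_mi:
  assumes "f \<in> fs (Suc d)"
  shows "mi f < n" "0 < f (mi f)"
proof -
  have "f \<noteq> 0" using assms by (auto simp: fs_def tot_def pt)
  then show p: "0 < f (mi f)" by (rule mi_pos)
  show "mi f < n"
  proof (rule ccontr)
    assume "\<not> mi f < n"
    then have "f (mi f) = 0" using assms unfolding fs_def by auto
    then show False using p by simp
  qed
qed

lemma top_exp_pos: "i < n \<Longrightarrow> 0 < top_exp i e" "i < n \<Longrightarrow> top_exp i e < m i"
  using m2[of i] by (auto simp: top_exp_def)

lemma exps_bounds: "i < n \<Longrightarrow> j \<in> exps i e \<Longrightarrow> 0 < j \<and> j \<le> top_exp i e \<and> j < m i"
  using m2[of i] by (auto simp: exps_def top_exp_def split: if_splits)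

lemma top_exp_in: "i < n \<Longrightarrow> top_exp i e \<in> exps i e"
  using m2[of i] by (auto simp: exps_def top_exp_def)

lemma finite_exps: "finite (exps i e)"
  by (simp add: exps_def)

text \<open>The smallest direction with the largest exponent extends the Anick chain by one
  obstruction; every other left factor can be merged with the chain behind it.\<close>

lemma status_word:
  assumes f: "f \<in> fs (Suc d)" and i: "i < n" "0 < f i" and j: "j \<in> exps i (f i)"
    and crit: "status (crt d (dn f i)) = Critical"
  shows "status (pw i j # crt d (dn f i)) = (if i = mi f \<and> j = top_exp i (f i) then Critical else Up)"
proof -
  note jb = exps_bounds[OF i(1) j]
  have "piece (pw i j) (crt d (dn f i)) = (if i = mi f \<and> j = top_exp i (f i) then Some (pw i j) else None)"
  proof (cases d)
    case 0
    have one: "f k = (if k = i then 1 else 0)" for k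
    proof -
      have "dn f i \<in> fs 0" using dn_fs[OF f i] 0 by simp
      then have "dn f i = 0" by (simp add: fs_0)
      then have "dn f i k = 0" by (simp add: pt)
      then show ?thesis using i(2) by (auto simp: dn_apply split: if_splits)
    qed
    then have "mi f = i" by (intro mi_eqI) auto
    moreover have "j = 1" using j one by (simp add: exps_def)
    ultimately show ?thesis using 0 one by (simp add: piece_def top_exp_def)
  next
    case (Suc d')
    define g where "g = dn f i"
    define p where "p = mi g"
    define s where "s = top_exp p (g p)"
    have g: "g \<in> fs (Suc d')" using dn_fs[OF f i] Suc by (simp add: g_def)
    have p: "p < n" "0 < g p" using fs_Suc_mi[OF g] by (auto simp: p_def)
    have s: "0 < s" using top_exp_pos[OF p(1)] by (simp add: s_def)
    have crt: "crt d g = pw p s # crt d' (dn g p)" by (simp add: Suc p_def s_def)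
    have piece: "piece (pw i j) (crt d g) = (if i < p then Some (pw i 1)
        else if s = 1 then (if pw i j p = m p - 1 then Some (pw p (m p - 1)) else None)
        else if i = p then Some (pw i 1) else None)"
      using jb s by (simp add: crt piece_def pw_apply)
    have m2p: "2 \<le> m p" using m2[OF p(1)] .
    have "piece (pw i j) (crt d g) = (if i = mi f \<and> j = top_exp i (f i) then Some (pw i j) else None)"
    proof (cases "i = mi f")
      case True
      have low: "k < i \<Longrightarrow> g k = 0" for k using below_mi[of k f] True by (simp add: g_def dn_apply)
      then have "i \<le> p" using p(2) by (metis linorder_not_less less_numeral_extra(3))
      show ?thesis
      proof (cases "i < p")
        case True': True
        then have "g i = 0" using below_mi[of i g] by (simp add: p_def)
        then have "f i = 1" using i(2) by (simp add: g_def dn_apply)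
        then have "j = 1" "top_exp i (f i) = 1" using j by (auto simp: exps_def top_exp_def)
        then show ?thesis using True True' piece by simp
      next
        case False
        then have ip: "i = p" using \<open>i \<le> p\<close> by simp
        have gi: "g i = f i - 1" "0 < g i" using p(2) by (auto simp: g_def dn_apply ip)
        show ?thesis
        proof (cases "odd (f i)")
          case odd: True
          then have "j = 1" "top_exp i (f i) = 1" "s = m i - 1"
            using j gi by (auto simp: exps_def top_exp_def s_def ip[symmetric])
          then show ?thesis using True piece ip by (simp add: pw_apply)
        next
          case even: False
          then have "s = 1" "top_exp i (f i) = m i - 1"
            using gi by (auto simp: top_exp_def s_def ip[symmetric])
          then show ?thesis using True piece ip by (simp add: pw_apply)
        qed
      qed
    next
      case False
      then have "mi f < i" using mi_le[of f i] i(2) by simp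
      moreover have "p \<le> mi f"
        unfolding p_def by (rule mi_le) (use fs_Suc_mi[OF f] False in \<open>auto simp: g_def dn_apply\<close>)
      ultimately have "p < i" by simp
      then show ?thesis using False piece m2p by (simp add: pw_apply)
    qed
    then show ?thesis by (simp only: g_def)
  qed
  then show ?thesis using crit jb by simp
qed

lemma crt_props: "f \<in> fs d \<Longrightarrow> status (crt d f) = Critical \<and> set (crt d f) \<subseteq> M \<and> length (crt d f) = d"
proof (induction d arbitrary: f)
  case (Suc d)
  note f = fs_Suc_mi[OF Suc.prems]
  have IH: "status (crt d (dn f (mi f))) = Critical \<and> set (crt d (dn f (mi f))) \<subseteq> M \<and> length (crt d (dn f (mi f))) = d"
    by (rule Suc.IH[OF dn_fs[OF Suc.prems f]])
  then show ?case
    using status_word[OF Suc.prems f top_exp_in[OF f(1)]] pw_in_M[OF f(1) top_exp_pos(2)[OF f(1)]]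
    by (simp del: status.simps)
qed simp

text \<open>A leading term argument: words of the image other than \<open>crt d f\<close> are
  \<open>Up\<close>. The coefficient is 1 because the Koszul sign at the smallest direction counts
  only zero entries.\<close>

lemma J_eq_crt:
  assumes "f \<in> fs d" "\<And>w. status w = Up \<Longrightarrow> set w \<subseteq> M \<Longrightarrow> z w = 0"
  shows "J d z f = z (crt d f)"
  using assms
proof (induction d arbitrary: z f)
  case (Suc d)
  define p where "p = mi f"
  have f: "p < n" "0 < f p" using fs_Suc_mi[OF Suc.prems(1)] by (auto simp: p_def)
  have inner: "J d (\<lambda>as. z (pw i j # as)) (dn f i) = (if i = p \<and> j = top_exp i (f i) then z (crt (Suc d) f) else 0)"
    if i: "i < n" "0 < f i" and j: "j \<in> exps i (f i)" for i j
  proof -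
    have pM: "pw i j \<in> M" using exps_bounds[OF i(1) j] pw_in_M[OF i(1)] by simp
    note dn = dn_fs[OF Suc.prems(1) i]
    have "J d (\<lambda>as. z (pw i j # as)) (dn f i) = z (pw i j # crt d (dn f i))"
      by (rule Suc.IH[OF dn]) (use Suc.prems(2) pM in auto)
    moreover have "z (pw i j # crt d (dn f i)) = 0" if "\<not> (i = p \<and> j = top_exp i (f i))"
      using status_word[OF Suc.prems(1) i j] crt_props[OF dn] that pM
      by (intro Suc.prems(2)) (auto simp: p_def simp del: status.simps)
    ultimately show ?thesis by (auto simp: p_def)
  qed
  have "J (Suc d) z f = (\<Sum>i<n. if i = p then ew f p * z (crt (Suc d) f) else 0)"
    unfolding J.simps
  proof (rule sum.cong)
    fix i assume "i \<in> {..<n}"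
    then have i: "i < n" by simp
    show "ew f i * (\<Sum>j\<in>exps i (f i). J d (\<lambda>as. z (pw i j # as)) (dn f i)) = (if i = p then ew f p * z (crt (Suc d) f) else 0)"
    proof (cases "f i = 0")
      case True
      then show ?thesis using f by (auto simp: ew_def)
    next
      case False
      then have "(\<Sum>j\<in>exps i (f i). J d (\<lambda>as. z (pw i j # as)) (dn f i))
        = (\<Sum>j\<in>exps i (f i). if j = top_exp i (f i) then (if i = p then z (crt (Suc d) f) else 0) else 0)"
        by (intro sum.cong) (auto simp: inner i simp del: crt.simps)
      also have "\<dots> = (if i = p then z (crt (Suc d) f) else 0)"
        using top_exp_in[OF i, of "f i"] finite_exps by (simp del: crt.simps)
      finally show ?thesis by simp
    qed
  qed simp
  also have "\<dots> = ew f p * z (crt (Suc d) f)" using f by (simp del: crt.simps)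
  also have "ew f p = (1 :: 'a)"
    using f below_mi[of _ f] by (simp add: ew_def eps_def p_def)
  finally show ?case by simp
qed simp

section \<open>Degrees of generators and enumeration of critical lists\<close>

lemma phi_dn:
  assumes "i < n" "0 < f i"
  shows "phi f = pw i (top_exp i (f i)) + phi (dn f i)"
proof
  fix k
  show "phi f k = (pw i (top_exp i (f i)) + phi (dn f i)) k"
  proof (cases "k = i")
    case True
    show ?thesis
    proof (cases "odd (f i)")
      case odd: True
      then obtain t where "f i = Suc (2 * t)" by (auto elim: oddE)
      then show ?thesis using True assms by (simp add: phi_def pt pw_apply dn_apply top_exp_def)
    next
      case False
      then obtain t where "f i = 2 * t" by (auto elim: evenE)
      then obtain u where u: "f i = Suc (Suc (2 * u))" using assms(2) by (cases t) auto
      then show ?thesis using True assms m_pos[of i] by (simp add: phi_def pt pw_apply dn_apply top_exp_def)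
    qed
  qed (simp add: phi_def pt pw_apply dn_apply)
qed

lemma sum_list_crt: "f \<in> fs d \<Longrightarrow> sum_list (crt d f) = phi f"
proof (induction d arbitrary: f)
  case 0
  then have "f = 0" by (simp add: fs_0)
  then show ?case by (auto simp: phi_def fun_eq_iff pt)
next
  case (Suc d)
  note f = fs_Suc_mi[OF Suc.prems]
  show ?case using Suc.IH[OF dn_fs[OF Suc.prems f]] phi_dn[of "mi f" f, OF f] by simp
qed

text \<open>Division by \<open>m i\<close> recovers \<open>f i div 2\<close> and
  \<open>f i mod 2\<close>, since the latter is below 2 and hence below \<open>m i\<close>.\<close>

lemma phi_inj:
  assumes "f \<in> fs d" "g \<in> fs d'" "phi f = phi g"
  shows "f = g"
proof
  fix i
  show "f i = g i"
  proof (cases "i < n")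
    case True
    have eq: "(f i div 2) * m i + f i mod 2 = (g i div 2) * m i + g i mod 2"
      using fun_cong[OF assms(3), of i] True by (simp add: phi_def)
    have lt: "f i mod 2 < m i" "g i mod 2 < m i" using m2[OF True] by (auto intro: less_le_trans[of _ 2])
    have "f i div 2 = g i div 2" using arg_cong[OF eq, of "\<lambda>x. x div m i"] lt by simp
    moreover have "f i mod 2 = g i mod 2" using arg_cong[OF eq, of "\<lambda>x. x mod m i"] lt by simp
    ultimately show ?thesis by (metis mult_div_mod_eq)
  qed (use assms in \<open>auto simp: fs_def\<close>)
qed

lemma crt_inj: "f \<in> fs d \<Longrightarrow> g \<in> fs d \<Longrightarrow> crt d f = crt d g \<Longrightarrow> f = g"
  using sum_list_crt phi_inj by metis

text \<open>Prepending \<open>a\<close> to the chain of \<open>g\<close> raises \<open>g\<close> in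
  the direction \<open>mi a\<close>; the cases of \<open>piece\<close> match the parity of the new
  entry.\<close>

lemma critical_eq_crt:
  assumes "status as = Critical" "set as \<subseteq> M"
  shows "\<exists>f \<in> fs (length as). as = crt (length as) f"
  using assms
proof (induction as)
  case Nil
  show ?case by (simp add: fs_0)
next
  case (Cons a as)
  note cr = critE[OF Cons.prems(1)]
  obtain g where g: "g \<in> fs (length as)" "as = crt (length as) g" using Cons cr(1) by auto
  define p where "p = mi a"
  have aM: "a \<in> M" "set as \<subseteq> M" using Cons.prems by auto
  have p: "p < n" using mi_less[OF aM(1) cr(2)] by (simp add: p_def)
  define f where "f = g(p := Suc (g p))"
  have dnf: "dn f p = g" by (auto simp: f_def dn_def)
  have ff: "f \<in> fs (Suc (length as))"
    using g(1) tot_dn[of p f] p dnf by (auto simp: fs_def f_def)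
  have "mi f = p \<and> a = pw p (top_exp p (f p))"
  proof (cases as)
    case Nil
    then have "g = 0" using g by (simp add: fs_0)
    then have "f p = 1" "mi f = p" by (auto simp: f_def pt intro!: mi_eqI)
    moreover have "a = pw p 1" using cr(3) Nil by (simp add: piece_def p_def)
    ultimately show ?thesis by (simp add: top_exp_def)
  next
    case (Cons b as')
    then obtain d where d: "length as = Suc d" by simp
    have g': "g \<in> fs (Suc d)" using g d by simp
    define p' where "p' = mi g"
    define s where "s = top_exp p' (g p')"
    have p': "p' < n" "0 < g p'" using fs_Suc_mi[OF g'] by (auto simp: p'_def)
    have b: "b = pw p' s" using g(2) Cons d by (simp add: p'_def s_def)
    have s: "0 < s" using top_exp_pos[OF p'(1)] by (simp add: s_def)
    have mb: "mi b = p'" and bs: "b p' = s" using s by (simp_all add: b pw_apply)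
    have pc: "(if p < p' then Some (pw p 1)
        else if s = 1 then (if a p' = m p' - 1 then Some (pw p' (m p' - 1)) else None)
        else if p = p' then Some (pw p 1) else None) = Some a"
      using cr(3) unfolding piece_def Cons list.case mb bs p_def[symmetric] .
    have m2p: "2 \<le> m p'" using m2[OF p'(1)] .
    consider (1) "p < p'" "a = pw p 1" | (2) "\<not> p < p'" "s = 1" "a = pw p' (m p' - 1)"
      | (3) "s \<noteq> 1" "p = p'" "a = pw p 1"
      using pc by (auto split: if_splits)
    then show ?thesis
    proof cases
      case 1
      have g0: "k < p' \<Longrightarrow> g k = 0" for k using below_mi[of k g] by (simp add: p'_def)
      have "f p = 1" using g0 1(1) by (simp add: f_def)
      moreover have "mi f = p" by (rule mi_eqI) (use g0 1(1) in \<open>auto simp: f_def\<close>)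
      ultimately show ?thesis using 1(2) by (simp add: top_exp_def)
    next
      case 2
      have pp: "p = p'" using mi_pw[of "m p' - 1" p'] m2p unfolding p_def 2(3) by simp
      have g0: "k < p' \<Longrightarrow> g k = 0" for k using below_mi[of k g] by (simp add: p'_def)
      have "mi f = p" by (rule mi_eqI) (use g0 pp in \<open>auto simp: f_def\<close>)
      moreover have "top_exp p (f p) = m p' - 1"
        using 2(2) unfolding s_def top_exp_def f_def pp by (auto split: if_splits)
      ultimately show ?thesis using 2(3) pp by simp
    next
      case 3
      have g0: "k < p' \<Longrightarrow> g k = 0" for k using below_mi[of k g] by (simp add: p'_def)
      have "mi f = p" by (rule mi_eqI) (use g0 3(2) in \<open>auto simp: f_def\<close>)
      moreover have "top_exp p (f p) = 1"
        using 3(1) unfolding s_def top_exp_def f_def 3(2) by (auto split: if_splits)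
      ultimately show ?thesis using 3(3) by simp
    qed
  qed
  then have "a # as = crt (Suc (length as)) f" using g(2) dnf by simp
  then show ?case using ff unfolding length_Cons by blast
qed

lemma J_cong:
  assumes "\<And>w. set w \<subseteq> M \<Longrightarrow> length w = d \<Longrightarrow> sum_list w \<le> phi f \<Longrightarrow> z w = z' w"
  shows "J d z f = J d z' f"
  using assms
proof (induction d arbitrary: z z' f)
  case 0
  show ?case using 0[of "[]"] by (simp add: pt)
next
  case (Suc d)
  show ?case unfolding J.simps
  proof (rule sum.cong)
    fix i assume "i \<in> {..<n}"
    then have i: "i < n" by simp
    show "ew f i * (\<Sum>j\<in>exps i (f i). J d (\<lambda>as. z (pw i j # as)) (dn f i))
      = ew f i * (\<Sum>j\<in>exps i (f i). J d (\<lambda>as. z' (pw i j # as)) (dn f i))"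
    proof (cases "f i = 0")
      case False
      have "J d (\<lambda>as. z (pw i j # as)) (dn f i) = J d (\<lambda>as. z' (pw i j # as)) (dn f i)" if j: "j \<in> exps i (f i)" for j
      proof (rule Suc.IH)
        note jb = exps_bounds[OF i j]
        fix w assume w: "set w \<subseteq> M" "length w = d" "sum_list w \<le> phi (dn f i)"
        have "pw i j \<le> pw i (top_exp i (f i))" using jb by (auto simp: pw_apply le_fun_def)
        then have "pw i j + sum_list w \<le> phi f"
          unfolding phi_dn[of i f, OF i neq0_conv[THEN iffD1, OF False]] using w(3) by (rule mon_add_mono)
        then show "z (pw i j # w) = z' (pw i j # w)"
          using w jb pw_in_M[OF i] by (intro Suc.prems) auto
      qed
      then show ?thesis by simp
    qed (simp add: ew_def)
  qed simp
qed

subsection \<open>Cohomology in a fixed multidegree\<close>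

lemma win_beyond: "win \<delta> (phi f) \<Longrightarrow> n \<le> i \<Longrightarrow> \<delta> i = 0"
  unfolding win_def by (auto dest!: spec[of _ i] simp: phi_def)

lemma J_dd:
  fixes L :: "mon \<Rightarrow> 'k::field"
  assumes L: "\<And>a b. L (a + b) = L a * L b" "L 0 = 1" and z: "supp_in \<delta> d z"
    and f: "f \<in> fs (Suc d)" "win \<delta> (phi f)"
  shows "J (Suc d) (dd \<delta> L d z) f = (\<Sum>i<n. ew f i * (kap L i (f i) * J d z (dn f i)))"
proof -
  have "J (Suc d) (dd \<delta> L d z) f = J (Suc d) (df L z) f"
  proof (rule J_cong)
    fix w assume w: "set w \<subseteq> M" "length w = Suc d" "sum_list w \<le> phi f"
    show "dd \<delta> L d z w = df L z w"
    proof (rule df_eq_dd[OF z w(1,2)])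
      fix i
      show "n \<le> i \<Longrightarrow> \<delta> i = 0" using win_beyond[OF f(2)] .
      assume i: "i < n"
      have "int (phi f i) + \<delta> i < int (m i)" using f(2) i by (auto simp: win_def)
      moreover have "sum_list w i \<le> phi f i" using w(3) by (simp add: le_fun_def)
      ultimately show "int (sum_list w i) + \<delta> i < int (m i)" by linarith
    qed
  qed
  also have "\<dots> = (\<Sum>i<n. ew f i * (kap L i (f i) * J d z (dn f i)))"
    by (rule J_df[OF L]) (use f in \<open>simp add: fs_def\<close>)
  finally show ?thesis .
qed

lemma J_below_window:
  assumes "supp_in \<delta> d z" "i < n" "int (phi f i) + \<delta> i < 0"
  shows "J d z f = 0"
proof -
  have "J d z f = J d (\<lambda>_. 0) f"
  proof (rule J_cong)
    fix w assume "sum_list w \<le> phi f"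
    then have "int (sum_list w i) + \<delta> i < 0" using assms(3) by (auto simp: le_fun_def dest!: spec[of _ i])
    then have "\<not> cell \<delta> w" using assms(2) by (auto simp: cell_def win_def intro!: exI[of _ i])
    then show "z w = 0" using assms(1) by (auto simp: supp_in_def)
  qed
  then show ?thesis by simp
qed

text \<open>After correction on up-lists, \<open>J\<close> reads off the critical values of the
  difference. The correcting cochain is carried by down-lists, so \<open>J\<close> kills it, and by
  the chain map property also its differential.\<close>

lemma coboundary_if_J_zero:
  fixes L :: "mon \<Rightarrow> 'k::field"
  assumes L: "\<And>a b. L (a + b) = L a * L b" "L 0 = 1" and z: "cocyc \<delta> L (Suc d) z"
    and J0: "\<And>f. f \<in> fs (Suc d) \<Longrightarrow> win \<delta> (phi f) \<Longrightarrow> J (Suc d) z f = 0"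
  shows "\<exists>g. supp_in \<delta> d g \<and> z = dd \<delta> L d g"
proof (rule coboundary_criterion[where L = L, OF L z])
  fix g \<sigma>
  assume g: "supp_in \<delta> d g" "\<And>\<tau>. g \<tau> \<noteq> 0 \<Longrightarrow> downs \<tau>" and up: "\<And>\<tau>. ups \<tau> \<Longrightarrow> z \<tau> = dd \<delta> L d g \<tau>"
    and \<sigma>: "status \<sigma> = Critical" "cell \<delta> \<sigma>" "length \<sigma> = Suc d"
  obtain f where f: "f \<in> fs (Suc d)" "\<sigma> = crt (Suc d) f"
    using critical_eq_crt[OF \<sigma>(1)] \<sigma> by (auto simp: cell_def)
  have w: "win \<delta> (phi f)" using \<sigma>(2) sum_list_crt[OF f(1)] f(2) by (simp add: cell_def)
  have Jg: "J d g h = 0" if h: "h \<in> fs d" for h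
  proof -
    have "J d g h = g (crt d h)" by (rule J_eq_crt[OF h]) (use g(2) in \<open>force simp: downs_def\<close>)
    then show ?thesis using g(2)[of "crt d h"] crt_props[OF h] not_both(3) by auto
  qed
  have "J (Suc d) (dd \<delta> L d g) f = 0"
    unfolding J_dd[OF L g(1) f(1) w]
    by (rule sum.neutral) (auto simp: ew_def Jg[OF dn_fs[OF f(1)]])
  moreover have "J (Suc d) (\<lambda>\<tau>. z \<tau> - dd \<delta> L d g \<tau>) f = z \<sigma> - dd \<delta> L d g \<sigma>"
    unfolding f(2) by (rule J_eq_crt[OF f(1)]) (use up in \<open>auto simp: ups_def\<close>)
  ultimately show "z \<sigma> = dd \<delta> L d g \<sigma>" using J0[OF f(1) w] by (simp add: J_diff)
qed blast

text \<open>In direction \<open>i\<close> the generators that contribute to a fixed multidegree come in one pair \<open>p, Suc p\<close>,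
  except when \<open>\<delta> i\<close> is maximal, where \<open>f i = 0\<close> stands alone. A nonzero coefficient \<open>kap\<close> then
  contracts the complex.\<close>
lemma window_exponents:
  assumes "i < n" "\<delta> \<noteq> int (m i) - 1"
  defines "F \<equiv> \<lambda>e. 0 \<le> int (e div 2 * m i + e mod 2) + \<delta> \<and> int (e div 2 * m i + e mod 2) + \<delta> < int (m i)"
  shows "\<exists>p. (\<forall>e. F e \<longrightarrow> e = p \<or> e = Suc p) \<and> F p = F (Suc p)"
proof -
  define h where "h e = e div 2 * m i + e mod 2" for e :: nat
  have m: "2 \<le> m i" using m2 assms(1) by simp
  have F: "F e \<longleftrightarrow> 0 \<le> int (h e) + \<delta> \<and> int (h e) + \<delta> < int (m i)" for e by (simp add: F_def h_def)
  have h2: "h (Suc (Suc e)) = h e + m i" for e by (simp add: h_def)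
  have hs: "h e < h (Suc e)" for e
    using m by (cases "even e") (auto simp: h_def elim!: evenE oddE)
  have hmono: "e \<le> e' \<Longrightarrow> h e \<le> h e'" for e e' by (rule lift_Suc_mono_le[of h]) (use hs less_imp_le in auto)
  show ?thesis
  proof (cases "\<exists>e. 0 \<le> int (h e) + \<delta>")
    case True
    define p where "p = (LEAST e. 0 \<le> int (h e) + \<delta>)"
    have p: "0 \<le> int (h p) + \<delta>" unfolding p_def using True by (rule LeastI_ex)
    have low: "0 \<le> int (h e) + \<delta> \<Longrightarrow> p \<le> e" for e unfolding p_def by (rule Least_le)
    have "e = p \<or> e = Suc p" if "F e" for e
    proof (rule ccontr)
      assume "\<not> (e = p \<or> e = Suc p)"
      then have "Suc (Suc p) \<le> e" using low[of e] that by (auto simp: F)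
      then have "h p + m i \<le> h e" using hmono h2[of p] by metis
      then show False using that p by (auto simp: F)
    qed
    moreover have "F p = F (Suc p)"
    proof (cases p)
      case 0
      have "h 0 = 0" "h 1 = 1" by (simp_all add: h_def)
      then show ?thesis using p assms(2) 0 by (auto simp: F)
    next
      case (Suc q)
      have "int (h q) + \<delta> < 0" using low[of q] Suc by force
      then have "int (h (Suc p)) + \<delta> < int (m i)" using h2[of q] Suc by simp
      moreover have "h p < h (Suc p)" by (rule hs)
      ultimately show ?thesis using p by (auto simp: F)
    qed
    ultimately show ?thesis by blast
  qed (auto simp: F)
qed

text \<open>The contraction divides by \<open>kap\<close> while passing from exponent
  \<open>Suc p\<close> to \<open>p\<close> in direction \<open>i\<close>. The resulting small
  cochain is lifted to the bar complex by placing its values on critical lists.\<close>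

lemma coboundary_off_diagonal:
  fixes L :: "mon \<Rightarrow> 'k::field"
  assumes L: "\<And>a b. L (a + b) = L a * L b" "L 0 = 1" and z: "cocyc \<delta> L d z"
    and i: "i < n" "\<delta> i \<noteq> int (m i) - 1" and kap: "\<And>e. 0 < e \<Longrightarrow> kap L i e \<noteq> 0"
  shows "if d = 0 then z = (\<lambda>_. 0) else \<exists>g. supp_in \<delta> (d - 1) g \<and> z = dd \<delta> L (d - 1) g"
proof -
  have zs: "supp_in \<delta> d z" and dz: "dd \<delta> L d z = (\<lambda>_. 0)" using z by (auto simp: cocyc_def)
  define F where "F e \<longleftrightarrow> 0 \<le> int (e div 2 * m i + e mod 2) + \<delta> i \<and> int (e div 2 * m i + e mod 2) + \<delta> i < int (m i)" for e
  obtain p where p: "\<And>e. F e \<Longrightarrow> e = p \<or> e = Suc p" "F p = F (Suc p)"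
    using window_exponents[OF i] unfolding F_def by blast
  define G where "G f = J d z f" for f
  define up where "up f = f(i := Suc (f i))" for f :: mon
  have dn_up: "dn (up f) i = f" for f by (auto simp: dn_def up_def)
  have up_dn: "0 < f i \<Longrightarrow> up (dn f i) = f" for f by (auto simp: dn_def up_def)
  have up_fs: "up f \<in> fs (Suc e) \<longleftrightarrow> f \<in> fs e" for f e
    using tot_dn[of i "up f"] i(1) dn_up[of f] by (auto simp: fs_def up_def)
  have winF: "win \<delta> (phi f) \<Longrightarrow> F (f i)" for f
    using i(1) unfolding win_def F_def by (auto simp: phi_def dest!: spec[of _ i])
  have win_upd: "win \<delta> (phi f) \<Longrightarrow> F e \<Longrightarrow> win \<delta> (phi (f(i := e)))" for f e
  proof -
    assume a: "win \<delta> (phi f)" "F e"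
    have "phi (f(i := e)) k = (if k = i then e div 2 * m i + e mod 2 else phi f k)" for k
      using i(1) by (simp add: phi_def)
    then show ?thesis using a i(1) unfolding win_def F_def by simp
  qed
  have win_up: "win \<delta> (phi (up f))" if "win \<delta> (phi f)" "f i = p" for f
    unfolding up_def using win_upd[OF that(1)] winF[OF that(1)] p(2) that(2) by simp
  have cycle: "0 = (\<Sum>k<n. ew f k * (kap L k (f k) * G (dn f k)))" if "f \<in> fs (Suc d)" "win \<delta> (phi f)" for f
    using J_dd[OF L zs that] dz by (simp add: G_def)
  show ?thesis
  proof (cases d)
    case 0
    have "z w = 0" for w
    proof (rule ccontr)
      assume "z w \<noteq> 0"
      then have w: "cell \<delta> w" "w = []" using zs 0 by (auto simp: supp_in_def)
      have z0: "phi 0 = 0" by (auto simp: phi_def pt fun_eq_iff)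
      have win0: "win \<delta> (phi 0)" using w unfolding z0 by (simp add: cell_def)
      then have p0: "p = 0" using winF[OF win0] p(1)[of 0] by (auto simp: pt)
      \<comment> \<open>In degree 0 the cocycle condition at the generator \<open>up 0\<close> has a
        single term, a unit times \<open>G 0\<close>.\<close>
      have "up 0 \<in> fs (Suc d)" using up_fs[of 0 d] 0 fs_0 by simp
      moreover have "win \<delta> (phi (up 0))" using win_up[OF win0] p0 by (simp add: pt)
      ultimately have "0 = (\<Sum>k<n. ew (up 0) k * (kap L k (up 0 k) * G (dn (up 0) k)))" by (rule cycle)
      also have "\<dots> = (\<Sum>k<n. if k = i then ew (up 0) i * (kap L i 1 * G 0) else 0)"
      proof (rule sum.cong)
        fix k
        have "up 0 k = (if k = i then 1 else 0)" by (simp add: up_def pt)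
        then show "ew (up 0) k * (kap L k (up 0 k) * G (dn (up 0) k)) = (if k = i then ew (up 0) i * (kap L i 1 * G 0) else 0)"
          using dn_up[of 0] by (cases "k = i") (simp_all add: ew_def)
      qed simp
      also have "\<dots> = ew (up 0) i * (kap L i 1 * G 0)" using i(1) by simp
      finally have "G 0 = 0" using kap[of 1] by (auto simp: ew_def eps_def up_def)
      then show False using \<open>z w \<noteq> 0\<close> w 0 by (simp add: G_def)
    qed
    then show ?thesis using 0 by auto
  next
    case (Suc e)
    \<comment> \<open>\<open>g\<close> is the contraction applied to \<open>G\<close>. The bar
      cochain \<open>z'\<close> realises it: \<open>J\<close> evaluates a cochain carried by
      critical lists at \<open>crt e h\<close>.\<close>
    define g where "g h = (if h i = p then eps (up h) i * (inverse (kap L i (Suc p)) * G (up h)) else 0)" for h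
    define z' where "z' w = (if \<exists>h\<in>fs e. win \<delta> (phi h) \<and> w = crt e h then g (inv_into (fs e) (crt e) w) else 0)" for w
    have inj: "inj_on (crt e) (fs e)" by (auto intro!: inj_onI crt_inj)
    have z's: "supp_in \<delta> e z'"
      unfolding supp_in_def
    proof (intro allI impI)
      fix w assume "z' w \<noteq> 0"
      then obtain h where h: "h \<in> fs e" "win \<delta> (phi h)" "w = crt e h" by (auto simp: z'_def split: if_splits)
      then show "cell \<delta> w \<and> length w = e" using crt_props[OF h(1)] sum_list_crt[OF h(1)] by (simp add: cell_def)
    qed
    have Jz': "J e z' h = (if win \<delta> (phi h) then g h else 0)" if h: "h \<in> fs e" for h
    proof -
      have "J e z' h = z' (crt e h)"
        by (rule J_eq_crt[OF h]) (auto simp: z'_def dest!: crt_props)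
      also have "\<dots> = (if win \<delta> (phi h) then g h else 0)"
        using h inj crt_inj[OF h] by (auto simp: z'_def inv_into_f_f)
      finally show ?thesis .
    qed
    have main: "G f = (\<Sum>k<n. ew f k * (kap L k (f k) * J e z' (dn f k)))" if f: "f \<in> fs d" "win \<delta> (phi f)" for f
    proof -
      have dnf: "dn f k \<in> fs e" if "k < n" "f k \<noteq> 0" for k using dn_fs[of f e k] f Suc that by simp
      have pc: "f i = p \<or> f i = Suc p" using p(1)[OF winF[OF f(2)]] .
      show ?thesis
      proof (cases "f i = p")
        case False
        then have fi: "f i = Suc p" using pc by simp
        have "(\<Sum>k<n. ew f k * (kap L k (f k) * J e z' (dn f k))) = (\<Sum>k<n. if k = i then G f else 0)"
        proof (rule sum.cong)
          fix k assume "k \<in> {..<n}"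
          then have k: "k < n" by simp
          show "ew f k * (kap L k (f k) * J e z' (dn f k)) = (if k = i then G f else 0)"
          proof (cases "k = i")
            case True
            have "F p" using winF[OF f(2)] fi p(2) by simp
            then have "win \<delta> (phi (dn f i))" using win_upd[OF f(2), of p] fi by (simp add: dn_def)
            then have "J e z' (dn f i) = eps f i * (inverse (kap L i (Suc p)) * G f)"
              using Jz'[OF dnf[OF i(1)]] fi up_dn[of f] by (simp add: g_def dn_apply)
            then show ?thesis using True fi kap[of "Suc p"] by (simp add: ew_def eps_sq mult.left_commute[of "kap L i (Suc p)"])
          next
            case False
            then show ?thesis using Jz'[OF dnf[OF k]] fi by (auto simp: ew_def g_def dn_apply)
          qed
        qed simp
        then show ?thesis using i(1) by simp
      next
        case True
        \<comment> \<open>For \<open>f i = p\<close> direction \<open>i\<close> contributes nothing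
          to the sum; the cocycle condition at \<open>up f\<close> turns the other directions into
          \<open>G f\<close>.\<close>
        note wu = win_up[OF f(2) True]
        have ufs: "up f \<in> fs (Suc d)" using up_fs f by simp
        define c where "c = inverse (kap L i (Suc p)) * eps (up f) i"
        have "ew f k * (kap L k (f k) * J e z' (dn f k)) = (if k = i then 0 else - c * (ew (up f) k * (kap L k (up f k) * G (dn (up f) k))))"
          if k: "k < n" for k
        proof (cases "k = i \<or> f k = 0")
          case T: True
          then show ?thesis
          proof
            assume "k = i"
            then show ?thesis using Jz'[OF dnf[OF k]] True by (auto simp: ew_def g_def dn_apply)
          next
            assume "f k = 0"
            then show ?thesis by (auto simp: ew_def up_def)
          qed
        next
          case F: False
          then have k': "k \<noteq> i" "0 < f k" by auto
          have comm: "up (dn f k) = dn (up f) k" using k' by (auto simp: up_def dn_def fun_eq_iff)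
          have dni: "dn f k i = p" using True k' by (simp add: dn_apply)
          have J: "J e z' (dn f k) = eps (dn (up f) k) i * (inverse (kap L i (Suc p)) * G (dn (up f) k))"
          proof (cases "win \<delta> (phi (dn f k))")
            case True
            then show ?thesis using Jz'[OF dnf[OF k]] k' dni comm by (simp add: g_def)
          next
            case False
            \<comment> \<open>Lowering direction \<open>k\<close> can leave the window only
              downwards, where \<open>J d z\<close> is zero.\<close>
            have "phi (dn f k) j = phi f j" if "j \<noteq> k" for j using that by (simp add: phi_def dn_apply)
            moreover have "phi (dn f k) k \<le> phi f k" using phi_dn[of k f, OF k k'(2)] by (simp add: pt)
            ultimately have neg: "int (phi (dn f k) k) + \<delta> k < 0"
              using False f(2) k unfolding win_def by (smt (verit) of_nat_le_iff)
            have "phi (dn (up f) k) k = phi (dn f k) k" using k' by (simp add: phi_def dn_apply up_def)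
            then have "G (dn (up f) k) = 0" unfolding G_def using J_below_window[OF zs k] neg by simp
            then show ?thesis using Jz'[OF dnf[OF k]] False k' by simp
          qed
          have e1: "eps (dn (up f) k) i = (if k < i then - eps (up f) i else eps (up f) i :: 'k)"
            by (rule eps_dn) (use k' in \<open>simp add: up_def\<close>)
          have e2: "eps f k = (if i < k then - eps (up f) k else eps (up f) k :: 'k)"
            using eps_dn[of "up f" i k] dn_up[of f] by (simp add: up_def)
          have "up f k = f k" using k' by (simp add: up_def)
          then show ?thesis using k' unfolding J e1 c_def ew_def e2 by auto
        qed
        then have "(\<Sum>k<n. ew f k * (kap L k (f k) * J e z' (dn f k)))
          = (\<Sum>k<n. if k = i then 0 else - c * (ew (up f) k * (kap L k (up f k) * G (dn (up f) k))))"
          by (intro sum.cong) auto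
        also have "\<dots> = - c * (\<Sum>k\<in>{..<n} - {i}. ew (up f) k * (kap L k (up f k) * G (dn (up f) k)))"
          unfolding sum_distrib_left by (rule sum.mono_neutral_cong_right) auto
        also have "(\<Sum>k\<in>{..<n} - {i}. ew (up f) k * (kap L k (up f k) * G (dn (up f) k))) = - (ew (up f) i * (kap L i (Suc p) * G f))"
          using cycle[OF ufs wu] i(1) sum.remove[of "{..<n}" i "\<lambda>k. ew (up f) k * (kap L k (up f k) * G (dn (up f) k))"] True
          by (simp add: dn_up up_def[of f, THEN fun_cong, of i] eq_neg_iff_add_eq_0 add.commute)
        also have "- c * - (ew (up f) i * (kap L i (Suc p) * G f)) = G f"
        proof -
          have "ew (up f) i = (eps (up f) i :: 'k)" by (simp add: ew_def up_def)
          moreover have "eps (up f) i * eps (up f) i = (1 :: 'k)" using eps_sq[of "up f" i 1] by simp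
          ultimately show ?thesis using kap[of "Suc p"]
            by (simp add: c_def mult.assoc mult.left_commute[of "eps (up f) i" "kap L i (Suc p)"] eps_sq)
        qed
        finally show ?thesis ..
      qed
    qed
    have "cocyc \<delta> L (Suc e) (\<lambda>as. z as - dd \<delta> L e z' as)"
      by (rule cocyc_sub_dd[OF L(1) _ z's]) (use z Suc in simp)
    then have "\<exists>g. supp_in \<delta> e g \<and> (\<lambda>as. z as - dd \<delta> L e z' as) = dd \<delta> L e g"
    proof (rule coboundary_if_J_zero[OF L])
      fix f assume f: "f \<in> fs (Suc e)" "win \<delta> (phi f)"
      show "J (Suc e) (\<lambda>as. z as - dd \<delta> L e z' as) f = 0"
        unfolding J_diff J_dd[OF L z's f] using main[of f] f Suc by (simp add: G_def)
    qed
    then obtain g where g: "supp_in \<delta> e g" "\<And>as. z as - dd \<delta> L e z' as = dd \<delta> L e g as"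
      by (metis (no_types, lifting))
    have "dd \<delta> L e (\<lambda>as. g as - (- z' as)) as = z as" for as
    proof -
      have "dd \<delta> L e (\<lambda>as. - z' as) as = - dd \<delta> L e z' as"
        using dd_diff[of \<delta> L e "\<lambda>_. 0" z' as] by (simp add: dd_def)
      then show ?thesis unfolding dd_diff g(2)[symmetric] by simp
    qed
    moreover have "supp_in \<delta> e (\<lambda>as. g as - (- z' as))"
      using g(1) z's unfolding supp_in_def by (metis add.right_neutral add_uminus_conv_diff minus_minus)
    ultimately show ?thesis using Suc by (auto intro!: exI[of _ "\<lambda>as. g as - (- z' as)"])
  qed
qed

end

subsection \<open>Splitting the Hochschild complex by multidegree\<close>

locale quantum_box = exponent_box n m for n m +
  fixes q :: "nat \<Rightarrow> nat \<Rightarrow> 'k::field"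
  assumes q_nonzero: "i < j \<Longrightarrow> j < n \<Longrightarrow> q i j \<noteq> 0"
begin

text \<open>The bicharacter behind \<open>qcoef\<close>, extended to integer exponents because
  multidegrees may have negative entries.\<close>

definition chi :: "(nat \<Rightarrow> int) \<Rightarrow> (nat \<Rightarrow> int) \<Rightarrow> 'k" where
  "chi a b = (\<Prod>j<n. \<Prod>i<j. q i j powi (a j * b i))"

definition ia :: "mon \<Rightarrow> nat \<Rightarrow> int" where
  "ia a = (\<lambda>i. int (a i))"

lemma ia_add: "ia (a + b) = ia a + ia b"
  by (simp add: ia_def pt fun_eq_iff)

lemma ia_0: "ia 0 = 0"
  by (simp add: ia_def pt fun_eq_iff)

lemma qcoef_chi: "qcoef n q a b = chi (ia a) (ia b)"
  unfolding qcoef_def chi_def ia_def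
  by (intro prod.cong) (simp_all only: of_nat_mult[symmetric] power_int_of_nat)

lemma chi_nonzero [simp]: "chi a b \<noteq> 0"
  by (auto simp: chi_def q_nonzero)

lemma chi_add: "chi (a + a') b = chi a b * chi a' b" "chi a (b + b') = chi a b * chi a b'"
  unfolding chi_def prod.distrib[symmetric]
  by (intro prod.cong; simp add: pt distrib_left distrib_right power_int_add q_nonzero)+

lemma chi_0 [simp]: "chi 0 b = 1" "chi a 0 = 1"
  by (simp_all add: chi_def pt)

text \<open>Dividing the part of multidegree \<open>\<delta>\<close> by \<open>nrm\<close> turns the Hochschild differential into \<open>df\<close> with the
  character \<open>LL \<delta>\<close>, the commutation factor of \<open>a\<close> with multidegree \<open>\<delta>\<close>.\<close>
definition LL :: "(nat \<Rightarrow> int) \<Rightarrow> mon \<Rightarrow> 'k" where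
  "LL \<delta> a = chi (ia a) \<delta> / chi \<delta> (ia a)"

lemma LL_add: "LL \<delta> (a + b) = LL \<delta> a * LL \<delta> b"
  by (simp add: LL_def ia_add chi_add)

lemma LL_0: "LL \<delta> 0 = 1"
  by (simp add: LL_def ia_0)

text \<open>The scalar that arises, truncation apart, when the product of the entries is rewritten
  in the ordered basis.\<close>

fun Th :: "mon list \<Rightarrow> 'k" where
  "Th [] = 1"
| "Th (a # as) = qcoef n q a (sum_list as) * Th as"

lemma Th_nonzero [simp]: "Th as \<noteq> 0"
  by (induction as) (auto simp: qcoef_chi)

lemma Th_merge: "Th (X @ u # v # Y) = qcoef n q u v * Th (X @ (u + v) # Y)"
  by (induction X) (auto simp: qcoef_chi ia_add chi_add add.assoc)

lemma Th_snoc: "Th (as @ [a]) = Th as * qcoef n q (sum_list as) a"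
  by (induction as) (auto simp: qcoef_chi ia_add chi_add ia_0)

text \<open>The scalar of the formal product of \<open>x^\<delta>\<close> with the entries,
  \<open>x^\<delta>\<close> on the left. Hence the right outer face carries no coefficient, and the
  left one only moves its entry past \<open>x^\<delta>\<close>.\<close>

definition nrm :: "(nat \<Rightarrow> int) \<Rightarrow> mon list \<Rightarrow> 'k" where
  "nrm \<delta> as = Th as * chi \<delta> (ia (sum_list as))"

lemma nrm_nonzero [simp]: "nrm \<delta> as \<noteq> 0"
  by (simp add: nrm_def)

definition tgt :: "(nat \<Rightarrow> int) \<Rightarrow> mon list \<Rightarrow> mon" where
  "tgt \<delta> as = (\<lambda>i. nat (int (sum_list as i) + \<delta> i))"

definition mpart :: "(nat \<Rightarrow> int) \<Rightarrow> 'k cochain \<Rightarrow> mon list \<Rightarrow> 'k" where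
  "mpart \<delta> f as = (if cell \<delta> as then f as (tgt \<delta> as) / nrm \<delta> as else 0)"

lemma cell_tgt:
  assumes "cell \<delta> as"
  shows "tgt \<delta> as \<in> M" "ia (tgt \<delta> as) = ia (sum_list as) + \<delta>" "set as \<subseteq> M"
proof -
  have w: "if i < n then 0 \<le> int (sum_list as i) + \<delta> i \<and> int (sum_list as i) + \<delta> i < int (m i)
      else int (sum_list as i) + \<delta> i = 0" for i
    using assms unfolding cell_def win_def by blast
  show "set as \<subseteq> M" using assms by (simp add: cell_def)
  show "tgt \<delta> as \<in> M"
    unfolding Mon_def tgt_def
  proof (intro CollectI allI conjI impI)
    fix i
    show "i < n \<Longrightarrow> nat (int (sum_list as i) + \<delta> i) < m i" using w[of i] m_pos[of i] by auto
    show "n \<le> i \<Longrightarrow> nat (int (sum_list as i) + \<delta> i) = 0" using w[of i] by auto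
  qed
  show "ia (tgt \<delta> as) = ia (sum_list as) + \<delta>"
  proof
    fix i show "ia (tgt \<delta> as) i = (ia (sum_list as) + \<delta>) i"
      using w[of i] by (simp add: ia_def tgt_def pt split: if_splits)
  qed
qed

lemma cell_if:
  assumes "set as \<subseteq> M" "c \<in> M" "ia c = ia (sum_list as) + \<delta>"
  shows "cell \<delta> as" "tgt \<delta> as = c"
proof -
  have e: "int (c i) = int (sum_list as i) + \<delta> i" for i
    using fun_cong[OF assms(3), of i] by (simp add: ia_def pt)
  show "cell \<delta> as" using assms(1) M_less[OF assms(2)] M_zero[OF assms(2)]
    unfolding cell_def win_def e[symmetric] by simp
  show "tgt \<delta> as = c" unfolding tgt_def e[symmetric] by simp
qed

lemma mpart_eq:
  assumes "set as \<subseteq> M" "c \<in> M" "ia c = ia (sum_list as) + \<delta>"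
  shows "f as c = nrm \<delta> as * mpart \<delta> f as"
  using cell_if[OF assms] by (simp add: mpart_def)

lemma mpart_lin: "mpart \<delta> (\<lambda>as x. f as x - g as x) = (\<lambda>as. mpart \<delta> f as - mpart \<delta> g as)"
  by (auto simp: mpart_def diff_divide_distrib)

lemma lmult_alt: "lmult n m q x y c = (\<Sum>a\<in>M. \<Sum>b\<in>M. if c \<in> M \<and> a + b = c then x a * y b * qcoef n q a b else 0)"
  unfolding lmult_def by (intro sum.cong refl) (simp add: fun_eq_iff pt)

lemma mon_diff:
  assumes "a \<le> (c :: mon)"
  shows "a + (c - a) = c" "(c - a) + a = c" "ia c = ia a + ia (c - a)"
  using assms by (auto simp: fun_eq_iff pt ia_def of_nat_diff)

lemma mon_add_eq_iff:
  assumes "b \<le> (c :: mon)"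
  shows "a + b = c \<longleftrightarrow> a = c - b" "b + a = c \<longleftrightarrow> a = c - b"
proof -
  have "a = c - b" if "a + b = c"
  proof -
    have "c = a + b" using that by simp
    then show ?thesis by (simp add: fun_eq_iff pt)
  qed
  then show "a + b = c \<longleftrightarrow> a = c - b" using mon_diff(2)[OF assms] by auto
  then show "b + a = c \<longleftrightarrow> a = c - b" by (simp add: add.commute)
qed

lemma lmult_bas_left:
  assumes "a \<in> M" "c \<in> M"
  shows "lmult n m q (bas a) y c = (if a \<le> c then qcoef n q a (c - a) * y (c - a) else 0)"
proof -
  have "lmult n m q (bas a) y c = (\<Sum>a'\<in>M. if a' = a then (\<Sum>b\<in>M. if a + b = c then y b * qcoef n q a b else 0) else 0)"
    unfolding lmult_alt using assms(2) by (intro sum.cong) (auto simp: bas_def cong: if_cong)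
  also have "\<dots> = (\<Sum>b\<in>M. if a + b = c then y b * qcoef n q a b else 0)"
    using assms(1) by simp
  also have "\<dots> = (if a \<le> c then qcoef n q a (c - a) * y (c - a) else 0)"
  proof (cases "a \<le> c")
    case True
    have "(a + b = c) = (b = c - a)" for b by (rule mon_add_eq_iff[OF True])
    moreover have "c - a \<in> M" by (rule M_downward[OF assms(2)]) (auto simp: le_fun_def)
    ultimately show ?thesis using True by simp
  next
    case False
    have "a + b \<noteq> c" for b using False mon_le_add(1)[of a b] by blast
    then show ?thesis using False by simp
  qed
  finally show ?thesis .
qed

lemma lmult_bas_right:
  assumes "b \<in> M" "c \<in> M"
  shows "lmult n m q y (bas b) c = (if b \<le> c then qcoef n q (c - b) b * y (c - b) else 0)"
proof -
  have "lmult n m q y (bas b) c = (\<Sum>a\<in>M. \<Sum>b'\<in>M. if b' = b then (if a + b = c then y a * qcoef n q a b else 0) else 0)"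
    unfolding lmult_alt using assms(2) by (intro sum.cong) (auto simp: bas_def)
  also have "\<dots> = (\<Sum>a\<in>M. if a + b = c then y a * qcoef n q a b else 0)"
    using assms(1) by simp
  also have "\<dots> = (if b \<le> c then qcoef n q (c - b) b * y (c - b) else 0)"
  proof (cases "b \<le> c")
    case True
    have "(a + b = c) = (a = c - b)" for a by (rule mon_add_eq_iff[OF True])
    moreover have "c - b \<in> M" by (rule M_downward[OF assms(2)]) (auto simp: le_fun_def)
    ultimately show ?thesis using True by simp
  next
    case False
    have "a + b \<noteq> c" for a using False mon_le_add(2)[of b a] by blast
    then show ?thesis using False by simp
  qed
  finally show ?thesis .
qed

lemma lmult_outside: "c \<notin> M \<Longrightarrow> lmult n m q x y c = 0"
  by (simp add: lmult_def)

lemma lmult_bas_bas: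
  assumes "a \<in> M" "b \<in> M"
  shows "lmult n m q (bas a) (bas b) c = (if a + b \<in> M \<and> c = a + b then qcoef n q a b else 0)"
proof (cases "c \<in> M")
  case True
  show ?thesis
  proof (cases "a \<le> c")
    case le: True
    have "(c - a = b) = (c = a + b)" using mon_add_eq_iff(2)[OF le, of b] by auto
    then show ?thesis unfolding lmult_bas_left[OF assms(1) True] using True le by (auto simp: bas_def)
  next
    case False
    have "c \<noteq> a + b" using False mon_le_add(1)[of a b] by blast
    then show ?thesis using True False assms by (simp add: lmult_bas_left)
  qed
qed (auto simp: lmult_outside)

lemma ext_bas:
  fixes f :: "'k cochain"
  assumes X: "set X \<subseteq> M" and Y: "set Y \<subseteq> M"
  shows "ext n m f (map bas X @ [y] @ map bas Y) c = (\<Sum>b\<in>M. y b * f (X @ [b] @ Y) c)"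
proof -
  define pr where "pr xs as = (\<Prod>i<length xs. (xs ! i) (as ! i))" for xs :: "'k elt list" and as
  have pr_Cons: "pr (x # xs) (a # as) = x a * pr xs as" for x xs a as
    by (simp add: pr_def prod.lessThan_Suc_shift del: prod.lessThan_Suc)
  have prY: "pr (map bas Y) as = (if as = Y then 1 else 0)" if "length as = length Y" for Y as
    using that
  proof (induction Y arbitrary: as)
    case Nil
    then show ?case by (simp add: pr_def)
  next
    case (Cons a Y)
    then obtain b bs where "as = b # bs" "length bs = length Y" by (cases as) auto
    then show ?case using Cons.IH[of bs] by (auto simp: pr_Cons bas_def)
  qed
  have prX: "pr (map bas X @ y # map bas Y) as = (if \<exists>b. as = X @ b # Y then y (as ! length X) else 0)"
    if "length as = length X + Suc (length Y)" for X as
    using that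
  proof (induction X arbitrary: as)
    case Nil
    then obtain b bs where "as = b # bs" "length bs = length Y" by (cases as) auto
    then show ?case using prY[of bs Y] by (auto simp: pr_Cons)
  next
    case (Cons a X)
    then obtain b bs where "as = b # bs" "length bs = length X + Suc (length Y)" by (cases as) auto
    then show ?case using Cons.IH[of bs] by (auto simp: pr_Cons bas_def)
  qed
  define S where "S = {as. set as \<subseteq> M \<and> length as = length (map bas X @ [y] @ map bas Y)}"
  have fin: "finite S" unfolding S_def by (rule finite_lists_length_eq) simp
  have sub: "(\<lambda>b. X @ b # Y) ` M \<subseteq> S" using X Y by (auto simp: S_def)
  have "ext n m f (map bas X @ [y] @ map bas Y) c = (\<Sum>as\<in>S. pr (map bas X @ y # map bas Y) as * f as c)"
    by (simp add: ext_def pr_def S_def)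
  also have "\<dots> = (\<Sum>as\<in>(\<lambda>b. X @ b # Y) ` M. pr (map bas X @ y # map bas Y) as * f as c)"
  proof (rule sum.mono_neutral_right[OF fin sub], rule ballI)
    fix as assume as: "as \<in> S - (\<lambda>b. X @ b # Y) ` M"
    then have "\<not> (\<exists>b. as = X @ b # Y)" by (auto simp: S_def)
    then show "pr (map bas X @ y # map bas Y) as * f as c = 0"
      using prX[of as X] as by (simp add: S_def)
  qed
  also have "\<dots> = (\<Sum>b\<in>M. pr (map bas X @ y # map bas Y) (X @ b # Y) * f (X @ b # Y) c)"
    by (rule sum.reindex_cong[of "\<lambda>b. X @ b # Y"]) (auto simp: inj_on_def)
  also have "\<dots> = (\<Sum>b\<in>M. y b * f (X @ [b] @ Y) c)"
    by (rule sum.cong) (auto simp: prX)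
  finally show ?thesis .
qed

lemma inn_sum:
  assumes "as \<noteq> []"
  shows "inn z as = (\<Sum>i\<in>{1..<length as}. (-1) ^ i * (if as ! (i - 1) + as ! i \<in> M
      then z (take (i - 1) as @ (as ! (i - 1) + as ! i) # drop (Suc i) as) else 0))
    + (-1) ^ length as * z (butlast as)"
  using assms
proof (induction z as rule: inn.induct)
  case (3 z a b as)
  define t where "t w l i = (-1) ^ i * (if l ! (i - 1) + l ! i \<in> M
      then w (take (i - 1) l @ (l ! (i - 1) + l ! i) # drop (Suc i) l) else 0)" for w :: "mon list \<Rightarrow> 'a" and l i
  have shift: "t z (a # b # as) (Suc i) = - t (\<lambda>bs. z (a # bs)) (b # as) i" if i1: "1 \<le> i" for i
  proof -
    obtain k where "i = Suc k" using i1 by (cases i) auto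
    then show ?thesis by (simp add: t_def)
  qed
  have "(\<Sum>i\<in>{1..<length (a # b # as)}. t z (a # b # as) i)
      = t z (a # b # as) 1 + (\<Sum>i\<in>{Suc 1..<Suc (length (b # as))}. t z (a # b # as) i)"
    by (subst sum.atLeast_Suc_lessThan) simp_all
  also have "(\<Sum>i\<in>{Suc 1..<Suc (length (b # as))}. t z (a # b # as) i) = (\<Sum>i\<in>{1..<length (b # as)}. t z (a # b # as) (Suc i))"
    by (rule sum.shift_bounds_Suc_ivl)
  also have "\<dots> = - (\<Sum>i\<in>{1..<length (b # as)}. t (\<lambda>bs. z (a # bs)) (b # as) i)"
    unfolding sum_negf[symmetric] by (rule sum.cong) (auto simp: shift)
  finally have s: "(\<Sum>i\<in>{1..<length (a # b # as)}. t z (a # b # as) i)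
     = t z (a # b # as) 1 - (\<Sum>i\<in>{1..<length (b # as)}. t (\<lambda>bs. z (a # bs)) (b # as) i)" by simp
  have IH: "inn (\<lambda>bs. z (a # bs)) (b # as) = (\<Sum>i\<in>{1..<length (b # as)}. t (\<lambda>bs. z (a # bs)) (b # as) i)
      + (-1) ^ length (b # as) * z (a # butlast (b # as))"
    using 3(1) unfolding t_def by blast
  have t1: "t z (a # b # as) 1 = - (if a + b \<in> M then z ((a + b) # as) else 0)" by (simp add: t_def)
  have "inn z (a # b # as) = (\<Sum>i\<in>{1..<length (a # b # as)}. t z (a # b # as) i)
      + (-1) ^ length (a # b # as) * z (butlast (a # b # as))"
    unfolding s inn.simps(3) IH t1 by simp
  then show ?case unfolding t_def .
qed auto

text \<open>Every face rewrites the same formal product. If an outer factor does not divide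
  \<open>c\<close>, the shortened list is no cell and both sides vanish.\<close>

lemma hdiff_mpart:
  assumes as: "set as \<subseteq> M" "length as = Suc d" and c: "c \<in> M" "ia c = ia (sum_list as) + \<delta>"
  shows "hdiff n m q d f as c = nrm \<delta> as * df (LL \<delta>) (mpart \<delta> f) as"
proof -
  define F where "F = mpart \<delta> f"
  have ne: "as \<noteq> []" using as by auto
  define a where "a = hd as"
  have asa: "as = a # tl as" using ne by (simp add: a_def)
  define b where "b = last as"
  have asb: "as = butlast as @ [b]" using ne by (simp add: b_def)
  have aM: "a \<in> M" "set (tl as) \<subseteq> M" "sum_list as = a + sum_list (tl as)"
    using as(1) asa by (metis insert_subset list.simps(15), metis insert_subset list.simps(15), metis sum_list.Cons)
  have bM: "b \<in> M" "set (butlast as) \<subseteq> M" using as(1) asb by (metis Un_subset_iff insert_subset list.simps(15) set_append)+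
  have bS: "sum_list as = sum_list (butlast as) + b" by (subst asb) simp
  have left: "lmult n m q (bas a) (f (tl as)) c = nrm \<delta> as * (LL \<delta> a * F (tl as))"
  proof (cases "a \<le> c")
    case True
    have cM: "c - a \<in> M" by (rule M_downward[OF c(1)]) (auto simp: le_fun_def)
    have e: "ia (c - a) = ia (sum_list (tl as)) + \<delta>"
      using mon_diff(3)[OF True] c(2) aM(3) by (simp add: ia_add fun_eq_iff pt algebra_simps)
    have "lmult n m q (bas a) (f (tl as)) c = qcoef n q a (c - a) * (nrm \<delta> (tl as) * F (tl as))"
      using lmult_bas_left[OF aM(1) c(1)] True mpart_eq[OF aM(2) cM e] by (simp add: F_def)
    also have "\<dots> = nrm \<delta> as * (LL \<delta> a * F (tl as))"
      by (subst (3) asa) (simp add: qcoef_chi e chi_add LL_def nrm_def ia_add)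
    finally show ?thesis .
  next
    case False
    then obtain i where i: "c i < a i" by (auto simp: le_fun_def not_le)
    have "\<not> cell \<delta> (tl as)"
    proof
      assume "cell \<delta> (tl as)"
      from cell_tgt(2)[OF this] have "ia c = ia a + ia (tgt \<delta> (tl as))"
        using c(2) aM(3) by (simp add: ia_add fun_eq_iff pt)
      then have "int (c i) = int (a i) + int (tgt \<delta> (tl as) i)" by (simp add: ia_def fun_eq_iff pt)
      then show False using i by simp
    qed
    then show ?thesis using False lmult_bas_left[OF aM(1) c(1)] by (simp add: F_def mpart_def)
  qed
  have right: "lmult n m q (f (butlast as)) (bas b) c = nrm \<delta> as * F (butlast as)"
  proof (cases "b \<le> c")
    case True
    have cM: "c - b \<in> M" by (rule M_downward[OF c(1)]) (auto simp: le_fun_def)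
    have e: "ia (c - b) = ia (sum_list (butlast as)) + \<delta>"
      using mon_diff(3)[OF True] c(2) bS by (simp add: ia_add fun_eq_iff pt algebra_simps)
    have "lmult n m q (f (butlast as)) (bas b) c = qcoef n q (c - b) b * (nrm \<delta> (butlast as) * F (butlast as))"
      using lmult_bas_right[OF bM(1) c(1)] True mpart_eq[OF bM(2) cM e] by (simp add: F_def)
    also have "\<dots> = nrm \<delta> as * F (butlast as)"
      by (subst (3) asb) (simp add: qcoef_chi e chi_add nrm_def ia_add Th_snoc)
    finally show ?thesis .
  next
    case False
    then obtain i where i: "c i < b i" by (auto simp: le_fun_def not_le)
    have "\<not> cell \<delta> (butlast as)"
    proof
      assume "cell \<delta> (butlast as)"
      from cell_tgt(2)[OF this] have "ia c = ia b + ia (tgt \<delta> (butlast as))"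
        using c(2) bS by (simp add: ia_add fun_eq_iff pt)
      then have "int (c i) = int (b i) + int (tgt \<delta> (butlast as) i)" by (simp add: ia_def fun_eq_iff pt)
      then show False using i by simp
    qed
    then show ?thesis using False lmult_bas_right[OF bM(1) c(1)] by (simp add: F_def mpart_def)
  qed
  have mid: "ext n m f (map bas (take (i - 1) as) @ [lmult n m q (bas (as ! (i - 1))) (bas (as ! i))] @ map bas (drop (Suc i) as)) c
    = nrm \<delta> as * (if as ! (i - 1) + as ! i \<in> M
      then F (take (i - 1) as @ (as ! (i - 1) + as ! i) # drop (Suc i) as) else 0)" if i: "i \<in> {1..d}" for i
  proof -
    define X u v Y where "X = take (i - 1) as" and "u = as ! (i - 1)" and "v = as ! i" and "Y = drop (Suc i) as"
    have dec: "as = X @ u # v # Y"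
      using i as(2) unfolding X_def u_def v_def Y_def
      by (metis Cons_nth_drop_Suc One_nat_def Suc_diff_le Suc_leI Suc_le_lessD atLeastAtMost_iff diff_Suc_1 diff_le_self id_take_nth_drop le_imp_less_Suc le_trans less_imp_le_nat)
    have M': "set X \<subseteq> M" "set Y \<subseteq> M" "u \<in> M" "v \<in> M" using as(1) unfolding dec by auto
    have "ext n m f (map bas X @ [lmult n m q (bas u) (bas v)] @ map bas Y) c
      = (\<Sum>w\<in>M. if w = u + v then qcoef n q u v * f (X @ [w] @ Y) c else 0)"
      unfolding ext_bas[OF M'(1,2)] by (rule sum.cong) (auto simp: lmult_bas_bas M')
    also have "\<dots> = (if u + v \<in> M then qcoef n q u v * f (X @ (u + v) # Y) c else 0)" by simp
    also have "\<dots> = nrm \<delta> as * (if u + v \<in> M then F (X @ (u + v) # Y) else 0)"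
    proof (cases "u + v \<in> M")
      case True
      have s: "sum_list (X @ (u + v) # Y) = sum_list as" by (simp add: dec add.assoc)
      have "f (X @ (u + v) # Y) c = nrm \<delta> (X @ (u + v) # Y) * F (X @ (u + v) # Y)"
        unfolding F_def by (rule mpart_eq) (use M' True c s in auto)
      moreover have "nrm \<delta> as = qcoef n q u v * nrm \<delta> (X @ (u + v) # Y)"
        unfolding nrm_def s by (simp add: dec Th_merge)
      ultimately show ?thesis using True by simp
    qed simp
    finally show ?thesis unfolding X_def u_def v_def Y_def .
  qed
  have mids: "(\<Sum>i\<in>{1..d}. (-1) ^ i * ext n m f (map bas (take (i - 1) as) @ [lmult n m q (bas (as ! (i - 1))) (bas (as ! i))] @ map bas (drop (Suc i) as)) c)
    = (\<Sum>i\<in>{1..d}. (-1) ^ i * (nrm \<delta> as * (if as ! (i - 1) + as ! i \<in> M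
      then F (take (i - 1) as @ (as ! (i - 1) + as ! i) # drop (Suc i) as) else 0)))"
    by (rule sum.cong) (simp_all only: mid)
  have dl: "{1..d} = {1..<length as}" using as(2) by auto
  have "hdiff n m q d f as c = nrm \<delta> as * (LL \<delta> a * F (tl as))
    + (\<Sum>i\<in>{1..d}. (-1) ^ i * (nrm \<delta> as * (if as ! (i - 1) + as ! i \<in> M
      then F (take (i - 1) as @ (as ! (i - 1) + as ! i) # drop (Suc i) as) else 0)))
    + (-1) ^ Suc d * (nrm \<delta> as * F (butlast as))"
    unfolding hdiff_def
    by (simp only: as c(1) simp_thms if_True a_def[symmetric] b_def[symmetric] left right mids)
  also have "\<dots> = nrm \<delta> as * df (LL \<delta>) F as"
    unfolding df_def inn_sum[OF ne] a_def dl as(2)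
    by (simp add: sum_distrib_left algebra_simps)
  finally show ?thesis by (simp add: F_def)
qed

lemma supp_mpart: "f \<in> cochains n m d \<Longrightarrow> supp_in \<delta> d (mpart \<delta> f)"
  unfolding supp_in_def mpart_def cochains_def by (force split: if_splits)

lemma hdiff_cochain: "hdiff n m q d f \<in> cochains n m (Suc d)"
  by (auto simp: hdiff_def cochains_def split: if_splits)

lemma mpart_hdiff: "mpart \<delta> (hdiff n m q d f) = dd \<delta> (LL \<delta>) d (mpart \<delta> f)"
proof
  fix as
  show "mpart \<delta> (hdiff n m q d f) as = dd \<delta> (LL \<delta>) d (mpart \<delta> f) as"
  proof (cases "cell \<delta> as \<and> length as = Suc d")
    case True
    note t = cell_tgt[OF conjunct1[OF True]]
    have "hdiff n m q d f as (tgt \<delta> as) = nrm \<delta> as * df (LL \<delta>) (mpart \<delta> f) as"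
      by (rule hdiff_mpart) (use t True in auto)
    then show ?thesis using True unfolding mpart_def[of _ "hdiff n m q d f"] dd_def by simp
  next
    case False
    then show ?thesis by (auto simp: mpart_def dd_def hdiff_def)
  qed
qed

text \<open>Each entry of a cochain belongs to exactly one multidegree, target minus source.\<close>

lemma cochain_eqI:
  assumes "f \<in> cochains n m d" "g \<in> cochains n m d" "\<And>\<delta>. mpart \<delta> f = mpart \<delta> g"
  shows "f = g"
proof (intro ext)
  fix as c
  show "f as c = g as c"
  proof (cases "set as \<subseteq> M \<and> c \<in> M")
    case True
    define \<delta> where "\<delta> = (\<lambda>i. int (c i) - int (sum_list as i))"
    have "ia c = ia (sum_list as) + \<delta>" by (simp add: \<delta>_def ia_def pt fun_eq_iff)
    then show ?thesis using mpart_eq[of as c \<delta> f] mpart_eq[of as c \<delta> g] True assms(3)[of \<delta>] by simp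
  next
    case False
    have "f as c = 0" using assms(1) False unfolding cochains_def by blast
    moreover have "g as c = 0" using assms(2) False unfolding cochains_def by blast
    ultimately show ?thesis by simp
  qed
qed

lemma cocyc_mpart: "is_cocycle n m q d f \<Longrightarrow> cocyc \<delta> (LL \<delta>) d (mpart \<delta> f)"
  using mpart_hdiff[of \<delta> d f, symmetric] supp_mpart
  by (auto simp: is_cocycle_def cocyc_def mpart_def)

lemma is_cocycleI:
  assumes "f \<in> cochains n m d" "\<And>\<delta>. dd \<delta> (LL \<delta>) d (mpart \<delta> f) = (\<lambda>_. 0)"
  shows "is_cocycle n m q d f"
proof -
  have "hdiff n m q d f = (\<lambda>_ _. 0)"
    by (rule cochain_eqI[OF hdiff_cochain]) (auto simp: cochains_def mpart_hdiff assms(2) mpart_def)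
  then show ?thesis using assms(1) by (simp add: is_cocycle_def)
qed

lemma is_coboundary_0I:
  assumes "f \<in> cochains n m 0" "\<And>\<delta>. mpart \<delta> f = (\<lambda>_. 0)"
  shows "is_coboundary n m q 0 f"
proof -
  have "f = (\<lambda>_ _. 0)"
    by (rule cochain_eqI[OF assms(1)]) (auto simp: cochains_def assms(2) mpart_def)
  then show ?thesis by (simp add: is_coboundary_def)
qed

lemma is_coboundary_SucI:
  assumes f: "f \<in> cochains n m (Suc d)"
    and ex: "\<And>\<delta>. \<exists>g. supp_in \<delta> d g \<and> mpart \<delta> f = dd \<delta> (LL \<delta>) d g"
  shows "is_coboundary n m q (Suc d) f"
proof -
  obtain G where G: "\<And>\<delta>. supp_in \<delta> d (G \<delta>)" "\<And>\<delta>. mpart \<delta> f = dd \<delta> (LL \<delta>) d (G \<delta>)"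
    using ex by metis
  \<comment> \<open>Preimages for infinitely many multidegrees glue, because each entry consults
    only its own.\<close>
  define g where "g as c = (if length as = d \<and> set as \<subseteq> M \<and> c \<in> M
    then nrm (\<lambda>i. int (c i) - int (sum_list as i)) as * G (\<lambda>i. int (c i) - int (sum_list as i)) as else 0)" for as c
  have gc: "g \<in> cochains n m d" by (auto simp: cochains_def g_def split: if_splits)
  have mpart_g: "mpart \<delta> g = G \<delta>" for \<delta>
  proof
    fix as
    show "mpart \<delta> g as = G \<delta> as"
    proof (cases "cell \<delta> as \<and> length as = d")
      case True
      note t = cell_tgt[OF conjunct1[OF True]]
      have "(\<lambda>i. int (tgt \<delta> as i) - int (sum_list as i)) = \<delta>"
        using t(2) by (simp add: ia_def pt fun_eq_iff)
      then show ?thesis using True t by (simp add: mpart_def g_def)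
    next
      case False
      then have "G \<delta> as = 0" using G(1)[of \<delta>] by (auto simp: supp_in_def)
      moreover have "mpart \<delta> g as = 0" using False supp_mpart[OF gc, of \<delta>] by (auto simp: supp_in_def)
      ultimately show ?thesis by simp
    qed
  qed
  have "f = hdiff n m q d g"
    by (rule cochain_eqI[OF f hdiff_cochain]) (simp add: mpart_hdiff mpart_g G(2))
  then show ?thesis using gc by (auto simp: is_coboundary_def)
qed

lemma zero_coboundary: "is_coboundary n m q d (\<lambda>_ _. 0)"
proof (cases d)
  case (Suc e)
  have "\<exists>g. supp_in \<delta> e g \<and> mpart \<delta> (\<lambda>_ _. 0) = dd \<delta> (LL \<delta>) e g" for \<delta>
    by (rule exI[of _ "\<lambda>_. 0"]) (auto simp: supp_in_def mpart_def dd_def)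
  then show ?thesis unfolding Suc by (intro is_coboundary_SucI) (auto simp: cochains_def)
qed (simp add: is_coboundary_def)

subsection \<open>The classes U and V\<close>

definition topm :: mon where
  "topm = (\<lambda>i. if i < n then m i - 1 else 0)"

definition UU :: "'k cochain" where
  "UU as c = (if as = [] \<and> c = topm then 1 else 0)"

text \<open>The Euler derivation of the variable \<open>x\<^sub>i\<close>.\<close>
definition VV :: "nat \<Rightarrow> 'k cochain" where
  "VV i as c = (if length as = 1 \<and> set as \<subseteq> M \<and> c = hd as then of_nat (c i) else 0)"

text \<open>The scalar part of a cup product of Euler derivations, each evaluated at its own
  entry.\<close>

fun P :: "nat list \<Rightarrow> mon list \<Rightarrow> 'k" where
  "P [] [] = 1"
| "P (i # is) (a # as) = of_nat (a i) * P is as"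
| "P _ _ = 0"

lemma topm_M: "topm \<in> M"
  using m_pos by (auto simp: Mon_def topm_def)

lemma P_length: "length as \<noteq> length is \<Longrightarrow> P is as = 0"
  by (induction "is" as rule: P.induct) auto

lemma lmult_scale_left: "lmult n m q (\<lambda>c. k * x c) y c = k * lmult n m q x y c"
  unfolding lmult_def sum_distrib_left by (intro sum.cong) (auto simp: algebra_simps)

lemma lmult_scale_right: "lmult n m q x (\<lambda>c. k * y c) c = k * lmult n m q x y c"
  unfolding lmult_def sum_distrib_left by (intro sum.cong) (auto simp: algebra_simps)

lemma VV_single: "a \<in> M \<Longrightarrow> VV i [a] = (\<lambda>c. of_nat (a i) * bas a c)"
  by (auto simp: VV_def bas_def fun_eq_iff)

lemma cup_list_VV: "cup_list n m q VV is as c =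
  (if set as \<subseteq> M \<and> c \<in> M \<and> c = sum_list as then P is as * Th as else 0)"
proof (induction "is" arbitrary: as c)
  case Nil
  have z: "(\<lambda>_. 0) = (0 :: mon)" by (simp add: fun_eq_iff pt)
  show ?case unfolding cup_list.simps unit0_def z by (cases as) auto
next
  case (Cons i "is")
  show ?case
  proof (cases as)
    case Nil
    then show ?thesis by (simp add: cup_def)
  next
    case (Cons a as')
    show ?thesis
    proof (cases "length as' = length is \<and> set as \<subseteq> M \<and> c \<in> M")
      case True
      then have aM: "a \<in> M" "set as' \<subseteq> M" by (auto simp: Cons)
      have "cup_list n m q VV (i # is) as c = lmult n m q (\<lambda>c. of_nat (a i) * bas a c) (cup_list n m q VV is as') c"
        using True aM by (simp add: cup_def Cons VV_single)
      also have "\<dots> = of_nat (a i) * (if a \<le> c then qcoef n q a (c - a) * cup_list n m q VV is as' (c - a) else 0)"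
        unfolding lmult_scale_left using lmult_bas_left[OF aM(1)] True by simp
      also have "\<dots> = (if c = sum_list as then P (i # is) as * Th as else 0)"
      proof (cases "a \<le> c")
        case le: True
        have "c - a \<in> M" by (rule M_downward[of c]) (use True in \<open>auto simp: le_fun_def\<close>)
        moreover have "c - a = sum_list as' \<longleftrightarrow> c = sum_list as"
          using mon_add_eq_iff(2)[OF le, of "sum_list as'"] by (auto simp: Cons)
        ultimately show ?thesis using le aM unfolding Cons.IH by (auto simp: Cons)
      next
        case False
        then have "c \<noteq> sum_list as" using mon_le_add(1)[of a "sum_list as'"] by (auto simp: Cons)
        then show ?thesis using False by simp
      qed
      finally show ?thesis using True by simp
    next
      case False
      then consider "length as' \<noteq> length is" | "\<not> set as \<subseteq> M" | "c \<notin> M" by blast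
      then show ?thesis
      proof cases
        case 1
        then show ?thesis using P_length[of as' "is"] by (simp add: cup_def Cons)
      qed (auto simp: cup_def lmult_outside)
    qed
  qed
qed

lemma cup_list_single: "cup_list n m q VV [i] = VV i"
proof (intro ext)
  fix as :: "mon list" and c
  consider "as = []" | a where "as = [a]" | a b bs where "as = a # b # bs" by (metis list.exhaust)
  then show "cup_list n m q VV [i] as c = VV i as c"
    unfolding cup_list_VV by cases (auto simp: VV_def qcoef_chi ia_0)
qed

lemma cup_list_pair: "cup_list n m q VV [i, j] = cup n m q 1 1 (VV i) (VV j)"
  using cup_list_single[of j] by simp

lemma cup_list_cochain: "cup_list n m q VV is \<in> cochains n m (length is)"
proof -
  have "length as = length is" if "P is as \<noteq> 0" for as using P_length that by blast
  then show ?thesis by (auto simp: cochains_def cup_list_VV split: if_splits)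
qed

lemma win_0: "win 0 w \<longleftrightarrow> w \<in> M"
  unfolding win_def Mon_def by (simp add: pt) (metis not_le)

lemma mpart_cup_list: "mpart \<delta> (cup_list n m q VV is) as = (if \<delta> = 0 \<and> cell \<delta> as then P is as else 0)"
proof (cases "cell \<delta> as")
  case True
  note t = cell_tgt[OF True]
  have "tgt \<delta> as = sum_list as \<longleftrightarrow> \<delta> = 0"
  proof
    assume "tgt \<delta> as = sum_list as"
    then show "\<delta> = 0" using t(2) by simp
  next
    assume "\<delta> = 0"
    then show "tgt \<delta> as = sum_list as" by (simp add: tgt_def pt)
  qed
  then show ?thesis using True t by (simp add: mpart_def cup_list_VV nrm_def)
qed (simp add: mpart_def)

text \<open>Exponents are additive, which is the Leibniz rule: the faces telescope, and the
  remainder cancels the left outer face when the character is 1.\<close>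

lemma inn_P:
  assumes "sum_list as \<in> M" "length as = Suc (length is)"
  shows "inn (P is) as = - P is (tl as)"
  using assms
proof (induction "is" arbitrary: as)
  case Nil
  then obtain a where "as = [a]" by (metis length_0_conv length_Suc_conv list.size(3))
  then show ?case by simp
next
  case (Cons i "is")
  then obtain a b as' where as: "as = a # b # as'" "length as' = length is" by (metis length_Suc_conv length_Cons)
  have "(a + b) + sum_list as' \<in> M" using Cons.prems(1) by (simp add: as add.assoc)
  then have ab: "a + b \<in> M" using add_M_D(1) by blast
  have "b + sum_list as' \<in> M" using Cons.prems(1) add_M_D(2)[of a "b + sum_list as'"] by (simp add: as)
  then have IH: "inn (P is) (b # as') = - P is as'" using Cons.IH[of "b # as'"] as by simp
  have "inn (\<lambda>bs. of_nat (a i) * P is bs) (b # as') = of_nat (a i) * inn (P is) (b # as')"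
    using inn_lin[of "of_nat (a i)" "P is" "\<lambda>_. 0"] by simp
  then show ?case using ab IH by (simp add: as pt algebra_simps)
qed

lemma LL_at_0: "LL 0 a = 1"
  by (simp add: LL_def)

lemma cup_list_cocycle: "is_cocycle n m q (length is) (cup_list n m q VV is)"
proof (rule is_cocycleI[OF cup_list_cochain], rule ext)
  fix \<delta> as
  show "dd \<delta> (LL \<delta>) (length is) (mpart \<delta> (cup_list n m q VV is)) as = 0"
  proof (cases "\<delta> = 0 \<and> cell \<delta> as \<and> length as = Suc (length is)")
    case True
    then have s: "sum_list as \<in> M" "set as \<subseteq> M" "as \<noteq> []" by (auto simp: cell_def win_0)
    have "df (LL 0) (mpart 0 (cup_list n m q VV is)) as = df (LL 0) (P is) as"
    proof (rule df_cong[OF s(3)])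
      fix v assume "sum_list v \<le> sum_list as" "set as \<subseteq> M \<Longrightarrow> set v \<subseteq> M"
      then have "cell 0 v" using s M_downward[OF s(1)] by (simp add: cell_def win_0)
      then show "mpart 0 (cup_list n m q VV is) v = P is v" by (simp add: mpart_cup_list)
    qed
    also have "\<dots> = 0" using inn_P[OF s(1)] True by (simp add: df_def LL_at_0)
    finally show ?thesis using True by (simp add: dd_def)
  next
    case False
    show ?thesis
    proof (cases "\<delta> = 0")
      case True
      then show ?thesis using False by (auto simp: dd_def)
    next
      case nz: False
      have "mpart \<delta> (cup_list n m q VV is) = (\<lambda>_. 0)" by (rule ext) (simp add: mpart_cup_list nz)
      then show ?thesis by (simp add: dd_def)
    qed
  qed
qed

section \<open>Exterior monomials as a dual basis\<close>

definition bin :: "mon \<Rightarrow> bool" where "bin f \<longleftrightarrow> (\<forall>i. f i \<le> 1)"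

definition ind :: "nat set \<Rightarrow> mon" where "ind S = (\<lambda>i. if i \<in> S then 1 else 0)"

lemma bin_dn: "bin f \<Longrightarrow> bin (dn f i)"
  unfolding bin_def dn_apply by (simp add: le_diff_conv le_SucI)

lemma J_P_Cons:
  assumes "bin f" "i < n"
  shows "J (Suc d) (P (i # is)) f = ew f i * J d (P is) (dn f i)"
proof -
  have "J (Suc d) (P (i # is)) f = (\<Sum>k<n. if k = i then ew f i * J d (P is) (dn f i) else 0)"
    unfolding J.simps
  proof (rule sum.cong)
    fix k
    show "ew f k * (\<Sum>j\<in>exps k (f k). J d (\<lambda>as. P (i # is) (pw k j # as)) (dn f k)) =
      (if k = i then ew f i * J d (P is) (dn f i) else 0)"
    proof (cases "f k = 0")
      case False
      then have "f k = 1" using assms(1) by (metis bin_def le_neq_implies_less less_one)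
      then show ?thesis by (simp add: exps_def J_cmult pw_apply)
    qed (auto simp: ew_def)
  qed simp
  then show ?thesis using assms(2) by simp
qed

text \<open>Each factor consumes its own direction, so only the indicator of the word survives;
  sortedness makes all Koszul signs trivial.\<close>

lemma J_P_sorted:
  assumes "sorted_wrt (<) is" "set is \<subseteq> {..<n}" "f \<in> fs (length is)" "bin f"
  shows "J (length is) (P is) f = (if f = ind (set is) then 1 else 0)"
  using assms
proof (induction "is" arbitrary: f)
  case Nil
  then show ?case by (auto simp: fs_0 ind_def fun_eq_iff pt)
next
  case (Cons i "is")
  have i: "i < n" using Cons.prems by simp
  show ?case
  proof (cases "f i = 0")
    case True
    then have "f \<noteq> ind (set (i # is))" by (auto simp: ind_def)
    then show ?thesis using J_P_Cons[OF Cons.prems(4) i] True by (simp add: ew_def)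
  next
    case False
    then have fi: "f i = 1" using Cons.prems(4) by (metis bin_def le_neq_implies_less less_one)
    have dnf: "dn f i \<in> fs (length is)" using dn_fs[of f "length is" i] Cons.prems i fi by simp
    have IH: "J (length is) (P is) (dn f i) = (if dn f i = ind (set is) then 1 else 0)"
      using Cons.IH[OF _ _ dnf bin_dn] Cons.prems by simp
    have ni: "i \<notin> set is" using Cons.prems(1) by auto
    have iff: "dn f i = ind (set is) \<longleftrightarrow> f = ind (set (i # is))"
    proof
      assume a: "dn f i = ind (set is)"
      show "f = ind (set (i # is))"
      proof
        fix k show "f k = ind (set (i # is)) k"
          using fun_cong[OF a, of k] fi by (auto simp: ind_def dn_apply split: if_splits)
      qed
    next
      assume "f = ind (set (i # is))"
      then show "dn f i = ind (set is)" using ni by (auto simp: ind_def dn_apply fun_eq_iff)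
    qed
    have "eps f i = (1 :: 'k)" if "f = ind (set (i # is))"
    proof -
      have "(\<Sum>k<i. f k) = 0"
        unfolding that using Cons.prems(1) by (intro sum.neutral) (auto simp: ind_def)
      then show ?thesis by (simp add: eps_def)
    qed
    then show ?thesis using J_P_Cons[OF Cons.prems(4) i, of "length is" "is"] IH iff fi by (auto simp: ew_def)
  qed
qed

lemma phi_bin: "bin f \<Longrightarrow> f \<in> fs d \<Longrightarrow> phi f = f"
proof
  fix i assume a: "bin f" "f \<in> fs d"
  then have "f i \<le> 1" by (simp add: bin_def)
  then show "phi f i = f i" using a by (cases "i < n") (auto simp: phi_def fs_def le_Suc_eq)
qed

text \<open>From \<open>f i = 2\<close> on the degree reaches \<open>m i\<close>. Thus the window of
  multidegree 0 admits commutators but no norms.\<close>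

lemma phi_in_M_iff: "f \<in> fs d \<Longrightarrow> phi f \<in> M \<longleftrightarrow> bin f"
proof
  assume f: "f \<in> fs d" "phi f \<in> M"
  show "bin f"
    unfolding bin_def
  proof (intro allI)
    fix i
    show "f i \<le> 1"
    proof (cases "i < n")
      case True
      have "(f i div 2) * m i + f i mod 2 < m i" using M_less[OF f(2) True] True by (simp add: phi_def)
      then have "f i div 2 = 0" by (cases "f i div 2") auto
      then show ?thesis by simp
    qed (use f in \<open>auto simp: fs_def\<close>)
  qed
next
  assume f: "f \<in> fs d" "bin f"
  have "f i < m i" if "i < n" for i
    using m2[OF that] f(2) unfolding bin_def by (metis le_less_trans less_le_trans one_less_numeral_iff semiring_norm(76))
  then show "phi f \<in> M" unfolding phi_bin[OF f(2,1)] using f(1) by (auto simp: Mon_def fs_def)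
qed

lemma J_mpart_cup_list:
  assumes "f \<in> fs d" "bin f"
  shows "J d (mpart 0 (cup_list n m q VV is)) f = J d (P is) f"
proof (rule J_cong)
  fix w assume w: "set w \<subseteq> M" "sum_list w \<le> phi f"
  have "sum_list w \<in> M" using M_downward[OF _ w(2)] phi_in_M_iff assms by blast
  then have "cell 0 w" using w by (simp add: cell_def win_0)
  then show "mpart 0 (cup_list n m q VV is) w = P is w" by (simp add: mpart_cup_list)
qed

lemma mpart_UU: "mpart \<delta> UU as = (if \<delta> = ia topm \<and> as = [] then 1 else 0)"
proof (cases "as = []")
  case True
  have "cell \<delta> as \<and> tgt \<delta> as = topm \<longleftrightarrow> \<delta> = ia topm"
  proof
    assume "cell \<delta> as \<and> tgt \<delta> as = topm"
    then show "\<delta> = ia topm" using cell_tgt(2)[of \<delta> as] True by (simp add: ia_0)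
  next
    assume "\<delta> = ia topm"
    then show "cell \<delta> as \<and> tgt \<delta> as = topm"
      using cell_if[of as topm \<delta>] topm_M True by (simp add: ia_0)
  qed
  then show ?thesis using True by (auto simp: mpart_def UU_def nrm_def ia_0)
qed (simp add: mpart_def UU_def)

lemma mpart_lincomb: "mpart \<delta> (lincomb n m q UU VV d u cS) as =
  (if d = 0 then u * mpart \<delta> UU as else 0)
  + (\<Sum>S\<in>{S. S \<subseteq> {..<n} \<and> card S = d}. cS S * mpart \<delta> (Vset n m q VV S) as)"
  by (simp add: mpart_def lincomb_def sum_divide_distrib add_divide_distrib)

lemma lincomb_cochain: "lincomb n m q UU VV d u cS \<in> cochains n m d"
proof -
  have "length as = d \<and> set as \<subseteq> M \<and> c \<in> M" if nz: "lincomb n m q UU VV d u cS as c \<noteq> 0" for as c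
  proof (rule ccontr)
    assume n: "\<not> (length as = d \<and> set as \<subseteq> M \<and> c \<in> M)"
    have "(if d = 0 then u * UU as c else 0) = 0" using n topm_M by (auto simp: UU_def)
    moreover have "Vset n m q VV S as c = 0" if S: "S \<subseteq> {..<n}" "card S = d" for S
    proof -
      have "finite S" using S finite_subset by blast
      then have "length (sorted_list_of_set S) = d" using S by simp
      then show ?thesis using n cup_list_cochain[of "sorted_list_of_set S"] by (auto simp: Vset_def cochains_def)
    qed
    ultimately have "lincomb n m q UU VV d u cS as c = 0" by (simp add: lincomb_def)
    then show False using nz by simp
  qed
  then show ?thesis by (auto simp: cochains_def)
qed

lemma ind_fs: "S \<subseteq> {..<n} \<Longrightarrow> ind S \<in> fs (card S) \<and> bin (ind S)"
proof -
  assume S: "S \<subseteq> {..<n}"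
  have "tot (ind S) = (\<Sum>i\<in>{..<n} \<inter> S. 1)"
    unfolding tot_def ind_def by (simp add: sum.If_cases)
  also have "\<dots> = card S" using S by (simp add: Int_absorb1)
  finally show ?thesis using S by (auto simp: fs_def bin_def ind_def)
qed

lemma ind_inject: "ind S = ind T \<longleftrightarrow> S = T"
  by (auto simp: ind_def fun_eq_iff split: if_splits)

lemma bin_ind: "bin f \<Longrightarrow> f \<in> fs d \<Longrightarrow> \<exists>S. S \<subseteq> {..<n} \<and> card S = d \<and> f = ind S"
proof -
  assume f: "bin f" "f \<in> fs d"
  define S where "S = {i. f i = 1}"
  have "f i = ind S i" for i using f(1) unfolding bin_def S_def ind_def
    by (auto simp: le_Suc_eq dest!: spec[of _ i])
  then have fS: "f = ind S" by auto
  have Sn: "S \<subseteq> {..<n}" using f(2) unfolding S_def fs_def by (auto simp: not_less[symmetric] intro: ccontr)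
  have "card S = d" using ind_fs[OF Sn] f(2) fS by (auto simp: fs_def)
  then show ?thesis using fS Sn by blast
qed

lemma J_Vset:
  assumes "S \<subseteq> {..<n}" "card S = d" "T \<subseteq> {..<n}" "card T = d"
  shows "J d (mpart 0 (Vset n m q VV S)) (ind T) = (if S = T then 1 else 0)"
proof -
  have fin: "finite S" using assms finite_subset by blast
  have T: "ind T \<in> fs d" "bin (ind T)" using ind_fs[OF assms(3)] assms(4) by auto
  have len: "length (sorted_list_of_set S) = d" using fin assms by simp
  have "J d (mpart 0 (Vset n m q VV S)) (ind T) = J d (P (sorted_list_of_set S)) (ind T)"
    unfolding Vset_def by (rule J_mpart_cup_list[OF T])
  also have "\<dots> = (if ind T = ind S then 1 else 0)"
    using J_P_sorted[of "sorted_list_of_set S" "ind T"] fin assms T len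
    by (simp add: strict_sorted_list_of_set)
  finally show ?thesis by (auto simp: ind_inject)
qed

lemma J_lincomb:
  assumes "T \<subseteq> {..<n}" "card T = d" "ia topm \<noteq> 0"
  shows "J d (mpart 0 (lincomb n m q UU VV d u cS)) (ind T) = cS T"
proof -
  have fin: "finite {S. S \<subseteq> {..<n} \<and> card S = d}" by (rule finite_subset[of _ "Pow {..<n}"]) auto
  have "mpart 0 (lincomb n m q UU VV d u cS) = (\<lambda>as. \<Sum>S\<in>{S. S \<subseteq> {..<n} \<and> card S = d}. cS S * mpart 0 (Vset n m q VV S) as)"
    using assms(3) by (auto simp: mpart_lincomb mpart_UU fun_eq_iff)
  then have "J d (mpart 0 (lincomb n m q UU VV d u cS)) (ind T)
    = (\<Sum>S\<in>{S. S \<subseteq> {..<n} \<and> card S = d}. cS S * J d (mpart 0 (Vset n m q VV S)) (ind T))"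
    by (simp add: J_sum[OF fin] J_cmult)
  also have "\<dots> = (\<Sum>S\<in>{S. S \<subseteq> {..<n} \<and> card S = d}. if S = T then cS T else 0)"
    by (rule sum.cong) (use assms J_Vset in auto)
  also have "\<dots> = cS T" using assms fin by simp
  finally show ?thesis .
qed

lemma mpart_lincomb_other: "\<delta> \<noteq> 0 \<Longrightarrow> mpart \<delta> (lincomb n m q UU VV d u cS) as =
  (if d = 0 then u * mpart \<delta> UU as else 0)"
  by (simp add: mpart_lincomb Vset_def mpart_cup_list)

lemma coboundary_at_0:
  assumes z: "cocyc 0 (LL 0) (Suc d) z" and J0: "\<And>f. f \<in> fs (Suc d) \<Longrightarrow> bin f \<Longrightarrow> J (Suc d) z f = 0"
  shows "\<exists>g. supp_in 0 d g \<and> z = dd 0 (LL 0) d g"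
  by (rule coboundary_if_J_zero[OF LL_add LL_0 z]) (use J0 phi_in_M_iff win_0 in blast)

subsection \<open>Generic parameters\<close>

lemma LL_power:
  "LL \<delta> a ^ t = (\<Prod>j<n. \<Prod>i<j. q i j powi (int t * (ia a j * \<delta> i - \<delta> j * ia a i)))"
proof -
  have "LL \<delta> a = (\<Prod>j<n. \<Prod>i<j. q i j powi (ia a j * \<delta> i - \<delta> j * ia a i))"
    unfolding LL_def chi_def prod_dividef[symmetric]
    by (intro prod.cong refl) (simp add: power_int_diff q_nonzero)
  then show ?thesis
    by (simp add: prod_power_distrib mult.commute[of "int t"] power_int_mult power_int_of_nat)
qed

text \<open>In the \<open>t\<close>-th power of the commutation factor of \<open>x_i\<close>, the
  parameter joining \<open>i\<close> and \<open>j\<close> has exponent \<open>t * \<delta> j\<close>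
  up to sign, so freeness excludes the value 1. The norm times \<open>?l - 1\<close> is such a power
  minus 1.\<close>

lemma kap_nonzero:
  assumes qfree: "\<forall>e :: nat \<Rightarrow> nat \<Rightarrow> int.
      (\<Prod>j<n. \<Prod>i<j. q i j powi e i j) = 1 \<longrightarrow> (\<forall>j<n. \<forall>i<j. e i j = 0)"
    and i: "i < n" and j: "j < n" "j \<noteq> i" "\<delta> j \<noteq> 0"
  shows "kap (LL \<delta>) i e \<noteq> 0"
proof -
  let ?l = "LL \<delta> (pw i 1)"
  have pow: "?l ^ t \<noteq> 1" if "0 < t" for t
  proof
    assume "?l ^ t = 1"
    then have "\<forall>b<n. \<forall>a<b. int t * (ia (pw i 1) b * \<delta> a - \<delta> b * ia (pw i 1) a) = 0"
      using qfree[rule_format, of "\<lambda>a b. int t * (ia (pw i 1) b * \<delta> a - \<delta> b * ia (pw i 1) a)"]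
      unfolding LL_power by blast
    then have E: "a < b \<Longrightarrow> b < n \<Longrightarrow> ia (pw i 1) b * \<delta> a - \<delta> b * ia (pw i 1) a = 0" for a b
      using that by simp
    show False
    proof (cases "j < i")
      case True
      then show False using E[of j i] i j by (simp add: ia_def pw_apply)
    next
      case False
      then show False using E[of i j] i j by (simp add: ia_def pw_apply)
    qed
  qed
  show ?thesis
  proof (cases "odd e")
    case True
    then show ?thesis using pow[of 1] by (simp add: kap_def)
  next
    case False
    have "(?l - 1) * (\<Sum>k<m i. ?l ^ k) \<noteq> 0"
      using pow[OF m_pos[OF i]] unfolding power_diff_1_eq[symmetric] by simp
    then show ?thesis using False by (simp add: kap_def)
  qed
qed

text \<open>Without a pair as in the third case, one non-maximal entry forces all others to be 0. As
  0 is not maximal, exchanging roles makes that entry 0 too.\<close>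

lemma degree_cases:
  assumes n2: "2 \<le> n" and beyond: "\<And>k. n \<le> k \<Longrightarrow> \<delta> k = 0"
  obtains "\<delta> = 0" | "\<delta> = ia topm"
    | i j where "i < n" "j < n" "j \<noteq> i" "\<delta> j \<noteq> 0" "\<delta> i \<noteq> int (m i) - 1"
proof -
  have "\<delta> = 0 \<or> \<delta> = ia topm" if no: "\<not> (\<exists>i<n. \<exists>j<n. j \<noteq> i \<and> \<delta> j \<noteq> 0 \<and> \<delta> i \<noteq> int (m i) - 1)"
  proof (cases "\<forall>i<n. \<delta> i = int (m i) - 1")
    case True
    have "\<delta> k = ia topm k" for k
      using True beyond[of k] m_pos[of k] by (cases "k < n") (auto simp: ia_def topm_def of_nat_diff)
    then show ?thesis by blast
  next
    case False
    then obtain i where i: "i < n" "\<delta> i \<noteq> int (m i) - 1" by blast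
    have others: "\<delta> j = 0" if "j < n" "j \<noteq> i" for j using no i that by blast
    obtain j where j: "j < n" "j \<noteq> i"
      using n2 by (metis One_nat_def Suc_1 Suc_le_lessD less_trans zero_less_Suc zero_neq_one)
    have "\<delta> j \<noteq> int (m j) - 1" using others[OF j] m2[OF j(1)] by simp
    then have "\<delta> i = 0" using no i(1) j by blast
    then have "\<delta> k = 0 k" for k using others[of k] beyond[of k] by (cases "k = i"; cases "k < n") (auto simp: pt)
    then show ?thesis by blast
  qed
  then show thesis using that by blast
qed

lemma topm_nonzero: "2 \<le> n \<Longrightarrow> ia topm \<noteq> 0"
  using m2[of 0] by (auto simp: ia_def topm_def fun_eq_iff pt intro!: exI[of _ 0])

lemma supp_in_beyond: "supp_in \<delta> d z \<Longrightarrow> n \<le> k \<Longrightarrow> \<delta> k \<noteq> 0 \<Longrightarrow> z as = 0"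
  using cell_beyond unfolding supp_in_def by blast

lemma df_sum: "finite S \<Longrightarrow> df L (\<lambda>as. \<Sum>s\<in>S. a s * z s as) as = (\<Sum>s\<in>S. a s * df L (z s) as)"
  by (induction S rule: finite_induct) (simp_all add: df_lin)

lemma finite_subsets: "finite {S. S \<subseteq> {..<n} \<and> card S = d}"
  by (rule finite_subset[of _ "Pow {..<n}"]) auto

lemma Vset_cocycle:
  assumes "S \<subseteq> {..<n}" "card S = d"
  shows "is_cocycle n m q d (Vset n m q VV S)"
proof -
  have "length (sorted_list_of_set S) = d" using assms finite_subset by auto
  then show ?thesis using cup_list_cocycle[of "sorted_list_of_set S"] by (simp add: Vset_def)
qed

lemma lincomb_cocyc_0:
  assumes "ia topm \<noteq> 0"
  shows "cocyc 0 (LL 0) d (mpart 0 (lincomb n m q UU VV d u cS))"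
proof -
  define Z where "Z S = mpart 0 (Vset n m q VV S)" for S
  have e: "mpart 0 (lincomb n m q UU VV d u cS) = (\<lambda>as. \<Sum>S\<in>{S. S \<subseteq> {..<n} \<and> card S = d}. cS S * Z S as)"
    using assms by (auto simp: mpart_lincomb mpart_UU fun_eq_iff Z_def)
  have Z: "cell 0 as \<Longrightarrow> length as = Suc d \<Longrightarrow> df (LL 0) (Z S) as = 0" if "S \<subseteq> {..<n}" "card S = d" for S as
    using cocyc_mpart[OF Vset_cocycle[OF that], of 0] unfolding cocyc_def Z_def
    by (auto simp: dd_def fun_eq_iff split: if_splits)
  have "dd 0 (LL 0) d (mpart 0 (lincomb n m q UU VV d u cS)) as = 0" for as
    unfolding e dd_def df_sum[OF finite_subsets] using Z by (auto intro!: sum.neutral)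
  then show ?thesis using supp_mpart[OF lincomb_cochain] by (auto simp: cocyc_def)
qed

lemma mpart_coboundary:
  assumes qfree: "\<forall>e :: nat \<Rightarrow> nat \<Rightarrow> int.
      (\<Prod>j<n. \<Prod>i<j. q i j powi e i j) = 1 \<longrightarrow> (\<forall>j<n. \<forall>i<j. e i j = 0)"
    and n2: "2 \<le> n" and z: "cocyc \<delta> (LL \<delta>) d z" and \<delta>: "\<delta> \<noteq> 0" "\<delta> \<noteq> ia topm \<or> 0 < d"
  shows "if d = 0 then z = (\<lambda>_. 0) else \<exists>g. supp_in \<delta> (d - 1) g \<and> z = dd \<delta> (LL \<delta>) (d - 1) g"
proof (cases "\<exists>k\<ge>n. \<delta> k \<noteq> 0")
  case True
  then obtain k where "n \<le> k" "\<delta> k \<noteq> 0" by blast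
  then have "z = (\<lambda>_. 0)" using z supp_in_beyond[of \<delta> d z k] by (simp add: cocyc_def fun_eq_iff)
  moreover have "supp_in \<delta> (d - 1) (\<lambda>_. 0 :: 'k)" "dd \<delta> (LL \<delta>) (d - 1) (\<lambda>_. 0) = (\<lambda>_. 0)"
    by (auto simp: supp_in_def dd_def)
  ultimately show ?thesis by metis
next
  case False
  then have beyond: "n \<le> k \<Longrightarrow> \<delta> k = 0" for k by blast
  show ?thesis
  proof (rule degree_cases[OF n2 beyond])
    assume "\<delta> = 0" then show ?thesis using \<delta> by simp
  next
    assume top: "\<delta> = ia topm"
    then obtain e where d: "d = Suc e" using \<delta> by (cases d) auto
    have "\<exists>g. supp_in \<delta> e g \<and> z = dd \<delta> (LL \<delta>) e g"
    proof (rule coboundary_if_J_zero[OF LL_add LL_0])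
      show "cocyc \<delta> (LL \<delta>) (Suc e) z" using z d by simp
      fix f assume f: "f \<in> fs (Suc e)" "win \<delta> (phi f)"
      define p where "p = mi f"
      have p: "p < n" "0 < f p" using fs_Suc_mi[OF f(1)] by (auto simp: p_def)
      \<comment> \<open>In the top multidegree the window contains only degree 0, which no generator
        of positive length has.\<close>
      have "phi f p < 1"
        using f(2)[unfolded win_def, rule_format, of p] p(1) m_pos[OF p(1)] by (simp add: top ia_def topm_def of_nat_diff)
      moreover have "0 < phi f p" using phi_dn[of p f, OF p] top_exp_pos(1)[OF p(1)] by (simp add: pt pw_apply)
      ultimately show "J (Suc e) z f = 0" by simp
    qed
    then show ?thesis using d by simp
  next
    fix i j assume ij: "i < n" "j < n" "j \<noteq> i" "\<delta> j \<noteq> 0" "\<delta> i \<noteq> int (m i) - 1"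
    show ?thesis
      by (rule coboundary_off_diagonal[OF LL_add LL_0 z ij(1,5) kap_nonzero[where \<delta> = \<delta>, OF qfree ij(1-4)]])
  qed
qed

text \<open>In degree 0 the only coboundary is 0. Above it, evaluate at \<open>ind S\<close>: its
  nonzero exponents are odd, and in multidegree 0 the commutator coefficient is
  \<open>1 - 1\<close>.\<close>

lemma lincomb_independent:
  assumes n2: "2 \<le> n" and cb: "is_coboundary n m q d (lincomb n m q UU VV d u cS)"
  shows "(d = 0 \<longrightarrow> u = 0) \<and> (\<forall>S. S \<subseteq> {..<n} \<and> card S = d \<longrightarrow> cS S = 0)"
proof (cases d)
  case 0
  then have z: "lincomb n m q UU VV d u cS = (\<lambda>_ _. 0)" using cb by (simp add: is_coboundary_def)
  have "mpart (ia topm) (lincomb n m q UU VV d u cS) [] = u"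
    using mpart_lincomb_other[OF topm_nonzero[OF n2], of d u cS "[]"] 0 by (simp add: mpart_UU)
  then have "u = 0" unfolding z by (simp add: mpart_def split: if_splits)
  moreover have "cS S = 0" if S: "S \<subseteq> {..<n}" "card S = d" for S
  proof -
    have "mpart 0 (\<lambda>_ _. 0) = (\<lambda>_. 0)" by (simp add: mpart_def fun_eq_iff)
    then show ?thesis using J_lincomb[OF S topm_nonzero[OF n2], of u cS] unfolding z by simp
  qed
  ultimately show ?thesis by blast
next
  case (Suc e)
  then obtain g where g: "g \<in> cochains n m e" "lincomb n m q UU VV d u cS = hdiff n m q e g"
    using cb by (auto simp: is_coboundary_def)
  have "cS S = 0" if S: "S \<subseteq> {..<n}" "card S = d" for S
  proof -
    have f: "ind S \<in> fs (Suc e)" "bin (ind S)" using ind_fs[OF S(1)] S(2) Suc by auto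
    have w: "win 0 (phi (ind S))" using phi_in_M_iff[OF f(1)] f(2) by (simp add: win_0)
    have "cS S = J (Suc e) (dd 0 (LL 0) e (mpart 0 g)) (ind S)"
      using J_lincomb[OF S topm_nonzero[OF n2], of u cS] unfolding g(2) mpart_hdiff unfolding Suc by (rule sym)
    also have "\<dots> = (\<Sum>i<n. ew (ind S) i * (kap (LL 0) i (ind S i) * J e (mpart 0 g) (dn (ind S) i)))"
      by (rule J_dd[OF LL_add LL_0 supp_mpart[OF g(1)] f(1) w])
    also have "\<dots> = 0"
    proof (rule sum.neutral, rule ballI)
      fix i
      show "ew (ind S) i * (kap (LL 0) i (ind S i) * J e (mpart 0 g) (dn (ind S) i)) = 0"
        by (cases "i \<in> S") (auto simp: ind_def ew_def kap_def LL_at_0)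
    qed
    finally show ?thesis .
  qed
  then show ?thesis using Suc by simp
qed

lemma lincomb_spanning:
  assumes qfree: "\<forall>e :: nat \<Rightarrow> nat \<Rightarrow> int.
      (\<Prod>j<n. \<Prod>i<j. q i j powi e i j) = 1 \<longrightarrow> (\<forall>j<n. \<forall>i<j. e i j = 0)"
    and n2: "2 \<le> n" and z: "is_cocycle n m q d z"
  shows "\<exists>u cS. is_coboundary n m q d (\<lambda>as x. z as x - lincomb n m q UU VV d u cS as x)"
proof -
  \<comment> \<open>The coefficients are forced: the value at the top monomial, and the values at
    the generators dual to the exterior monomials.\<close>
  define u where "u = mpart (ia topm) z []"
  define cS where "cS S = J d (mpart 0 z) (ind S)" for S
  define l where "l = lincomb n m q UU VV d u cS"
  define y where "y = (\<lambda>as x. z as x - l as x)"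
  have zc: "z \<in> cochains n m d" using z by (simp add: is_cocycle_def)
  have lc: "l \<in> cochains n m d" unfolding l_def by (rule lincomb_cochain)
  have yc: "y \<in> cochains n m d"
    unfolding cochains_def
  proof (intro CollectI allI impI)
    fix as c assume "y as c \<noteq> 0"
    then have "z as c \<noteq> 0 \<or> l as c \<noteq> 0" by (auto simp: y_def)
    then show "length as = d \<and> set as \<subseteq> M \<and> c \<in> M" using zc lc unfolding cochains_def by blast
  qed
  have my: "mpart \<delta> y = (\<lambda>as. mpart \<delta> z as - mpart \<delta> l as)" for \<delta> unfolding y_def by (rule mpart_lin)
  have Jy: "J d (mpart 0 y) f = 0" if f: "f \<in> fs d" "bin f" for f
  proof -
    obtain S where S: "S \<subseteq> {..<n}" "card S = d" "f = ind S" using bin_ind[OF f(2,1)] by blast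
    show ?thesis unfolding my J_diff l_def S(3)
      using J_lincomb[OF S(1,2) topm_nonzero[OF n2]] by (simp add: cS_def)
  qed
  have other: "mpart \<delta> y = mpart \<delta> z" if "\<delta> \<noteq> 0" "\<delta> \<noteq> ia topm \<or> 0 < d" for \<delta>
    unfolding my l_def using that by (auto simp: mpart_lincomb_other mpart_UU)
  have "is_coboundary n m q d y"
  proof (cases d)
    case 0
    have "mpart \<delta> y as = 0" for \<delta> as
    proof (cases "as = []")
      case False
      then show ?thesis using supp_mpart[OF yc, of \<delta>] 0 by (auto simp: supp_in_def)
    next
      case True
      consider "\<delta> = 0" | "\<delta> = ia topm" "\<delta> \<noteq> 0" | "\<delta> \<noteq> 0" "\<delta> \<noteq> ia topm" by blast
      then show ?thesis
      proof cases
        case 1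
        have "(0 :: mon) \<in> fs d" "bin 0" using 0 fs_0 by (auto simp: bin_def pt)
        then show ?thesis using Jy[of 0] 0 1 True by simp
      next
        case 2
        then show ?thesis unfolding my l_def mpart_lincomb_other[OF 2(2)] using 0 True by (simp add: mpart_UU u_def)
      next
        case 3
        then show ?thesis
          using other[of \<delta>] mpart_coboundary[OF qfree n2 cocyc_mpart[OF z, of \<delta>]] 0 by simp
      qed
    qed
    then show ?thesis using is_coboundary_0I[of y] yc 0 by (simp add: fun_eq_iff)
  next
    case (Suc e)
    have "\<exists>g. supp_in \<delta> e g \<and> mpart \<delta> y = dd \<delta> (LL \<delta>) e g" for \<delta>
    proof (cases "\<delta> = 0")
      case True
      have "cocyc 0 (LL 0) d (mpart 0 y)"
        using cocyc_mpart[OF z, of 0] lincomb_cocyc_0[OF topm_nonzero[OF n2], of d u cS] supp_mpart[OF yc, of 0]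
        unfolding cocyc_def my l_def[symmetric] by (simp add: fun_eq_iff dd_diff)
      then show ?thesis unfolding True using Jy Suc by (intro coboundary_at_0) auto
    next
      case False
      then show ?thesis
        using other[of \<delta>] mpart_coboundary[OF qfree n2 cocyc_mpart[OF z, of \<delta>]] Suc by simp
    qed
    then show ?thesis using is_coboundary_SucI[of y e] yc Suc by simp
  qed
  then show ?thesis unfolding y_def l_def by blast
qed

lemma UU_cocycle: "2 \<le> n \<Longrightarrow> is_cocycle n m q 0 UU"
proof (rule is_cocycleI, goal_cases)
  case 1
  show ?case using topm_M by (auto simp: cochains_def UU_def)
next
  case (2 \<delta>)
  show ?case
  proof
    fix as
    show "dd \<delta> (LL \<delta>) 0 (mpart \<delta> UU) as = 0"
    proof (cases "cell \<delta> as \<and> length as = 1 \<and> \<delta> = ia topm")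
      case True
      then obtain a where a: "as = [a]" by (auto simp: length_Suc_conv)
      \<comment> \<open>Only the unit multiplies the top monomial without leaving the box, so the
        commutator is tested at 1 alone.\<close>
      have "a i = 0" for i
      proof (cases "i < n")
        case i: True
        have "cell \<delta> as" using True by blast
        then have "int (a i) + \<delta> i < int (m i)" using i unfolding cell_def win_def a by (auto dest!: spec[of _ i])
        then show ?thesis using True m_pos[OF i] i by (auto simp: ia_def topm_def of_nat_diff)
      next
        case False
        then show ?thesis using True M_zero[of a i] by (auto simp: a cell_def)
      qed
      then have "a = 0" by (auto simp: fun_eq_iff pt)
      then show ?thesis using a by (simp add: dd_def df_def LL_0)
    next
      case False
      then have "\<delta> \<noteq> ia topm \<or> dd \<delta> (LL \<delta>) 0 (mpart \<delta> UU) as = 0" by (auto simp: dd_def)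
      moreover have "mpart \<delta> UU = (\<lambda>_. 0)" if "\<delta> \<noteq> ia topm" using that by (auto simp: mpart_UU fun_eq_iff)
      moreover have "dd \<delta> (LL \<delta>) 0 (\<lambda>_. 0) as = 0" by (simp add: dd_def)
      ultimately show ?thesis by metis
    qed
  qed
qed

section \<open>Products and brackets\<close>

lemma topm_add_in_M: "topm + a \<in> M \<Longrightarrow> i < n \<Longrightarrow> a i = 0"
  using M_less[of "topm + a" i] m_pos[of i] by (simp add: pt topm_def)

lemma UU_Nil: "UU [] = bas topm"
  by (simp add: UU_def bas_def fun_eq_iff)

lemma UU_cup_UU:
  assumes "2 \<le> n"
  shows "cup n m q 0 0 UU UU = (\<lambda>_ _. 0)"
proof -
  have "topm + topm \<notin> M"
    using topm_add_in_M[of topm 0] assms m2[of 0] by (auto simp: topm_def)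
  then show ?thesis by (auto simp: cup_def UU_Nil lmult_bas_bas[OF topm_M topm_M] fun_eq_iff)
qed

text \<open>A product with the top monomial survives only where \<open>x_i\<close> is absent, and
  there the Euler derivation is zero.\<close>

lemma UU_cup_VV:
  assumes "i < n"
  shows "cup n m q 0 1 UU (VV i) = (\<lambda>_ _. 0)"
proof (intro HOL.ext)
  fix as c
  show "cup n m q 0 1 UU (VV i) as c = 0"
  proof (cases "length as = 1 \<and> set as \<subseteq> M")
    case True
    then obtain a where a: "as = [a]" "a \<in> M" by (auto simp: length_Suc_conv)
    show ?thesis using topm_add_in_M[OF _ assms, of a] a
      by (auto simp: cup_def UU_Nil VV_single lmult_scale_right lmult_bas_bas[OF topm_M])
  qed (auto simp: cup_def)
qed

lemma VV_cup_UU: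
  assumes "i < n"
  shows "cup n m q 1 0 (VV i) UU = (\<lambda>_ _. 0)"
proof (intro HOL.ext)
  fix as c
  show "cup n m q 1 0 (VV i) UU as c = 0"
  proof (cases "length as = 1 \<and> set as \<subseteq> M")
    case True
    then obtain a where a: "as = [a]" "a \<in> M" by (auto simp: length_Suc_conv)
    show ?thesis using topm_add_in_M[OF _ assms, of a] a
      by (auto simp: cup_def UU_Nil VV_single lmult_scale_left lmult_bas_bas[OF _ topm_M] add.commute)
  qed (auto simp: cup_def)
qed

lemma J_P_pair:
  assumes "f \<in> fs 2" "bin f" "i < n" "j < n"
  shows "J 2 (P [i, j]) f = (if i \<noteq> j then ew f i * ew (dn f i) j else 0)"
proof -
  have "J (Suc (Suc 0)) (P [i, j]) f = ew f i * (ew (dn f i) j * 1)"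
    unfolding J_P_Cons[OF assms(2,3)] J_P_Cons[OF bin_dn[OF assms(2)] assms(4)] by simp
  moreover have "ew f i * ew (dn f i) i = (0 :: 'k)"
    using assms(2) unfolding bin_def by (auto simp: ew_def dn_apply le_Suc_eq dest!: spec[of _ i])
  ultimately show ?thesis by (auto simp: numeral_2_eq_2)
qed

text \<open>Products of Euler derivations live in multidegree 0, where \<open>J\<close> on the
  generators with exponents 0 and 1 decides the class.\<close>

lemma pair_coboundary:
  assumes f: "f = (\<lambda>as x. a * cup n m q 1 1 (VV i) (VV j) as x + b * cup n m q 1 1 (VV j) (VV i) as x)"
    and J: "\<And>h. h \<in> fs 2 \<Longrightarrow> bin h \<Longrightarrow> a * J 2 (P [i, j]) h + b * J 2 (P [j, i]) h = 0"
  shows "is_coboundary n m q 2 f"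
proof -
  define F where "F k l = cup_list n m q VV [k, l]" for k l
  have f': "f = (\<lambda>as x. a * F i j as x + b * F j i as x)" unfolding f F_def cup_list_pair ..
  have Fc: "is_cocycle n m q 2 (F k l)" for k l
    using cup_list_cocycle[of "[k, l]"] by (simp only: F_def list.size numeral_2_eq_2 add_0_left plus_1_eq_Suc add_Suc_right add_0_right add_Suc)
  have fc: "f \<in> cochains n m 2"
    unfolding cochains_def
  proof (intro CollectI allI impI)
    fix as c assume "f as c \<noteq> 0"
    then have "F i j as c \<noteq> 0 \<or> F j i as c \<noteq> 0" by (auto simp: f')
    then show "length as = 2 \<and> set as \<subseteq> M \<and> c \<in> M"
      using Fc[of i j] Fc[of j i] unfolding is_cocycle_def cochains_def by blast
  qed
  have mf: "mpart \<delta> f = (\<lambda>as. a * mpart \<delta> (F i j) as + b * mpart \<delta> (F j i) as)" for \<delta>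
    by (auto simp: f' mpart_def fun_eq_iff add_divide_distrib)
  have "\<exists>g. supp_in \<delta> 1 g \<and> mpart \<delta> f = dd \<delta> (LL \<delta>) 1 g" for \<delta>
  proof (cases "\<delta> = 0")
    case True
    have "df (LL 0) (mpart 0 f) as = a * df (LL 0) (mpart 0 (F i j)) as + b * df (LL 0) (mpart 0 (F j i)) as" for as
      unfolding mf df_lin[of _ a] using df_lin[of "LL 0" b "mpart 0 (F j i)" "\<lambda>_. 0"] by simp
    then have "cocyc 0 (LL 0) 2 (mpart 0 f)"
      using cocyc_mpart[OF Fc[of i j], of 0] cocyc_mpart[OF Fc[of j i], of 0] supp_mpart[OF fc, of 0]
      by (auto simp: cocyc_def dd_def fun_eq_iff split: if_splits)
    moreover have "J 2 (mpart 0 f) h = 0" if "h \<in> fs 2" "bin h" for h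
    proof -
      have "J 2 (mpart 0 f) h = a * J 2 (P [i, j]) h + b * J 2 (P [j, i]) h"
        unfolding mf J_lin J_cmult F_def J_mpart_cup_list[OF that] ..
      then show ?thesis using J[OF that] by simp
    qed
    ultimately show ?thesis using coboundary_at_0[of 1 "mpart 0 f"] True by (simp add: numeral_2_eq_2)
  next
    case False
    then have "mpart \<delta> f as = 0" for as unfolding mf F_def mpart_cup_list by simp
    then have "mpart \<delta> f = (\<lambda>_. 0)" by blast
    then show ?thesis by (intro exI[of _ "\<lambda>_. 0"]) (auto simp: supp_in_def dd_def)
  qed
  then show ?thesis using is_coboundary_SucI[of f 1] fc by (simp add: numeral_2_eq_2)
qed

text \<open>Interchanging the two lowered directions reverses the Koszul sign.\<close>

lemma VV_anticommute:
  assumes "i < n" "j < n"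
  shows "is_coboundary n m q 2 (\<lambda>as x. cup n m q 1 1 (VV i) (VV j) as x + cup n m q 1 1 (VV j) (VV i) as x)"
proof (rule pair_coboundary[of _ 1 i j 1])
  fix h assume h: "h \<in> fs 2" "bin h"
  have "ew h i * ew (dn h i) j + ew h j * ew (dn h j) i = (0 :: 'k)" if "i \<noteq> j"
    using that by (auto simp: ew_def dn_apply eps_dn)
  then show "1 * J 2 (P [i, j]) h + 1 * J 2 (P [j, i]) h = 0"
    using J_P_pair[OF h assms] J_P_pair[OF h assms(2,1)] by auto
qed simp

text \<open>An exponent of at most 1 cannot be lowered twice. This covers characteristic 2, where
  anticommutativity says nothing about squares.\<close>

lemma VV_square:
  assumes "i < n"
  shows "is_coboundary n m q 2 (cup n m q 1 1 (VV i) (VV i))"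
proof (rule pair_coboundary[of _ 1 i i 0])
  fix h assume "h \<in> fs 2" "bin h"
  then show "1 * J 2 (P [i, i]) h + 0 * J 2 (P [i, i]) h = 0"
    using J_P_pair[of h i i] assms by simp
qed simp

text \<open>The top monomial is an eigenvector of the Euler derivation with eigenvalue
  \<open>m i - 1\<close>. The other composition is an empty sum, as a 0-cochain has no
  argument.\<close>

lemma bracket_VV_UU:
  assumes "i < n"
  shows "(\<lambda>as x. gbr n m 1 0 (VV i) UU as x - of_nat (m i - 1) * UU as x) = (\<lambda>_ _. 0)"
proof (intro HOL.ext)
  fix as c
  have "ext n m (VV i) [bas topm] c = of_nat (m i - 1) * bas topm c"
    using ext_bas[of "[]" "[]" "VV i" "bas topm" c] topm_M assms
    by (simp add: bas_def VV_def topm_def if_distrib[of "\<lambda>x. x * _"] cong: if_cong)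
  then show "gbr n m 1 0 (VV i) UU as c - of_nat (m i - 1) * UU as c = 0"
    by (cases "as = []") (auto simp: gbr_def gcirc_def UU_Nil, simp add: UU_def)
qed

text \<open>Euler derivations are diagonal in the monomial basis, so they commute as maps and not
  merely up to coboundary.\<close>

lemma bracket_VV_VV: "gbr n m 1 1 (VV i) (VV j) = (\<lambda>_ _. 0)"
proof (intro HOL.ext)
  fix as c
  have E: "ext n m (VV i) [VV j [a]] c = of_nat (a i) * of_nat (a j) * bas a c" if a: "a \<in> M" for a i j
  proof -
    have "ext n m (VV i) [VV j [a]] c = (\<Sum>b\<in>M. if b = a then of_nat (a j) * VV i [a] c else 0)"
      using ext_bas[of "[]" "[]" "VV i" "VV j [a]" c] by (simp add: VV_single[OF a] bas_def if_distrib[of "\<lambda>x. _ * x"] if_distrib[of "\<lambda>x. x * _"] cong: if_cong)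
    then show ?thesis using a by (simp add: VV_single[OF a])
  qed
  show "gbr n m 1 1 (VV i) (VV j) as c = 0"
  proof (cases "length as = 1 \<and> set as \<subseteq> M")
    case True
    then obtain a where a: "as = [a]" "a \<in> M" by (auto simp: length_Suc_conv)
    then show ?thesis using E[OF a(2), of i j] E[OF a(2), of j i] by (simp add: gbr_def gcirc_def)
  qed (auto simp: gbr_def gcirc_def)
qed

end

theorem theorem6p3:
  fixes n :: nat and m :: "nat \<Rightarrow> nat" and q :: "nat \<Rightarrow> nat \<Rightarrow> 'k::field"
  assumes n2: "2 \<le> n"
    and m2: "\<forall>i<n. 2 \<le> m i"
    and qnz: "\<forall>i j. i < j \<and> j < n \<longrightarrow> q i j \<noteq> 0"
    and qfree: "\<forall>e :: nat \<Rightarrow> nat \<Rightarrow> int.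
                 (\<Prod>j<n. \<Prod>i<j. q i j powi e i j) = 1 \<longrightarrow> (\<forall>j<n. \<forall>i<j. e i j = 0)"
  shows "\<exists>(U :: 'k cochain) (V :: nat \<Rightarrow> 'k cochain).
     is_cocycle n m q 0 U \<and> (\<forall>i<n. is_cocycle n m q 1 (V i))
     \<comment> \<open>the classes of the basis elements are linearly independent in HH^d\<close>
     \<and> (\<forall>d u cS. is_coboundary n m q d (lincomb n m q U V d u cS) \<longrightarrow>
           (d = 0 \<longrightarrow> u = 0) \<and> (\<forall>S. S \<subseteq> {..<n} \<and> card S = d \<longrightarrow> cS S = 0))
     \<comment> \<open>and span HH^d\<close>
     \<and> (\<forall>d z. is_cocycle n m q d z \<longrightarrow>
           (\<exists>u cS. is_coboundary n m q d (\<lambda>as x. z as x - lincomb n m q U V d u cS as x)))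
     \<comment> \<open>algebra relations of k[U]/(U^2) \<times>_k exterior algebra, holding in HH\<close>
     \<and> is_coboundary n m q 0 (cup n m q 0 0 U U)
     \<and> (\<forall>i<n. is_coboundary n m q 1 (cup n m q 0 1 U (V i))
             \<and> is_coboundary n m q 1 (cup n m q 1 0 (V i) U)
             \<and> is_coboundary n m q 2 (cup n m q 1 1 (V i) (V i)))
     \<and> (\<forall>i<n. \<forall>j<n. is_coboundary n m q 2
             (\<lambda>as x. cup n m q 1 1 (V i) (V j) as x + cup n m q 1 1 (V j) (V i) as x))
     \<comment> \<open>Gerstenhaber brackets\<close>
     \<and> (\<forall>i<n. is_coboundary n m q 0
             (\<lambda>as x. gbr n m 1 0 (V i) U as x - of_nat (m i - 1) * U as x))
     \<and> (\<forall>i<n. \<forall>j<n. is_coboundary n m q 1 (gbr n m 1 1 (V i) (V j)))"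
proof -
  interpret quantum_box n m q
    by unfold_locales (use m2 qnz in auto)
  have VV: "is_cocycle n m q 1 (VV i)" for i
    using cup_list_cocycle[of "[i]"] by (simp only: cup_list_single) simp
  show ?thesis
  proof (intro exI[of _ UU] exI[of _ VV] conjI allI impI)
    show "is_cocycle n m q 0 UU" by (rule UU_cocycle[OF n2])
    show "is_cocycle n m q 1 (VV i)" for i by (rule VV)
    show "u = 0" if "is_coboundary n m q d (lincomb n m q UU VV d u cS)" "d = 0" for d u cS
      using lincomb_independent[OF n2 that(1)] that(2) by blast
    show "cS S = 0" if "is_coboundary n m q d (lincomb n m q UU VV d u cS)" "S \<subseteq> {..<n} \<and> card S = d" for d u cS S
      using lincomb_independent[OF n2 that(1)] that(2) by blast
    show "\<exists>u cS. is_coboundary n m q d (\<lambda>as x. z as x - lincomb n m q UU VV d u cS as x)"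
      if "is_cocycle n m q d z" for d z by (rule lincomb_spanning[OF qfree n2 that])
  qed (simp_all only: UU_cup_UU[OF n2] UU_cup_VV VV_cup_UU VV_square VV_anticommute bracket_VV_UU bracket_VV_VV zero_coboundary)
qed

end
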